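(* Let $d\ge2$ and $1\le j\le d-1$ be integers, let $f_1,\dots,f_d:\mathbb Z\to\mathbb C^*$ be additive characters with $\prod_{k=i}^d|f_k(1)|\le1$ for all $1\le i\le d$, let $n\in\mathbb Z$, let $k_j',\dots,k_d'$ be non-negative integers, and let $$b_d(j):=-2k_d'(j)+\frac{\log g_j^d(1)}{\log\alpha}+k_d'(j)\frac{\log|Q|}{\log\alpha}+\left(2n+\ell_{Q,k_j',\dots,k_d'}\right)\frac{\pi i}{\log\alpha}.$$ Then $$\underset{s_d(j)=b_d(j)}{\mathrm{Res}}\ \mathcal L_U^d(\mathbf s\mid\mathbf f)=D^{b_d(j)/2}\,\mathcal L_U^{j-1}(s_1,\dots,s_{j-1}\mid f_1,\dots,f_{j-1})\sum_{\substack{k_j\ge0,\dots,k_d\ge0\\ k_d(j)=k_d'(j)}}\binom{-s_j}{k_j}(-1)^{k_j}\cdots\binom{-s_d}{k_d}(-1)^{k_d}\left(\prod_{t=j+1}^d\frac{g_t^d(1)\,Q^{k_d(t)}}{\alpha^{s_d(t)+2k_d(t)}-g_t^d(1)\,Q^{k_d(t)}}\right)\frac1{\log\alpha}.$$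
   Context: Standing assumptions: $P,Q$ are real numbers with $P>0$, $Q\ne 0$, $D:=P^2-4Q$, and $Q<P-1$ if $0<P\le 2$, $Q\le P-1$ if $P>2$. Let $\alpha,\beta$ be the roots of $x^2-Px+Q=0$, with $\alpha=(P+\sqrt D)/2$, $\beta=(P-\sqrt D)/2$, and let $U_n=(\alpha^n-\beta^n)/(\alpha-\beta)$ for $n\ge 0$ (Lucas sequence of the first kind). Complex powers of positive reals are taken with the real logarithm; $\log g_j^d(1)$ is a fixed value of the complex logarithm. Notation: $s_d(t):=s_t+\cdots+s_d$, $k_d(t):=k_t+\cdots+k_d$, $k_d'(t):=k_t'+\cdots+k_d'$, $g_t^d:=\prod_{k=t}^d f_k$ (so $g_d^d=f_d$). $\ell_{Q,k_j,\dots,k_d}:=0$ if $Q>0$ and $:=k_j+\cdots+k_d$ if $Q<0$. An additive character is a group homomorphism $f:\mathbb Z\to\mathbb C^*$, so $f(n)=f(1)^n$. The multiple Lucas additive $L$-function of depth $e$ is the meromorphic continuation to $\mathbb C^e$ (from its region of absolute convergence) of $$\mathcal L_U^e(s_1,\dots,s_e\mid f_1,\dots,f_e):=\sum_{0<n_1<\cdots<n_e}\frac{f_1(n_1)}{U_{n_1}^{s_1}}\cdots\frac{f_e(n_e)}{U_{n_e}^{s_e}},$$ with $\mathcal L_U^0:=1$; $\mathcal L_U^d(\mathbf s\mid\mathbf f)$ abbreviates $\mathcal L_U^d(s_1,\dots,s_d\mid f_1,\dots,f_d)$. The residue along the hyperplane $s_d(j)=b_d(j)$ is the restriction of the meromorphic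 function $(s_d(j)-b_d(j))\,\mathcal L_U^d(\mathbf s\mid\mathbf f)$ to that hyperplane. *)

theory Defs
  imports "HOL-Analysis.Analysis"
begin

section \<open>Lucas sequences\<close>

text \<open>Under the parameter conditions below the discriminant is positive, so the two roots are real.\<close>

definition lucas_params :: "real \<Rightarrow> real \<Rightarrow> bool" where
  "lucas_params P Q \<longleftrightarrow>
     P > 0 \<and> Q \<noteq> 0 \<and> (P \<le> 2 \<longrightarrow> Q < P - 1) \<and> (P > 2 \<longrightarrow> Q \<le> P - 1)"

definition lucas_D :: "real \<Rightarrow> real \<Rightarrow> real" where
  "lucas_D P Q = P\<^sup>2 - 4 * Q"

definition lucas_alpha :: "real \<Rightarrow> real \<Rightarrow> real" where
  "lucas_alpha P Q = (P + sqrt (lucas_D P Q)) / 2"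

definition lucas_beta :: "real \<Rightarrow> real \<Rightarrow> real" where
  "lucas_beta P Q = (P - sqrt (lucas_D P Q)) / 2"

definition lucas_U :: "real \<Rightarrow> real \<Rightarrow> nat \<Rightarrow> real" where
  "lucas_U P Q n = (lucas_alpha P Q ^ n - lucas_beta P Q ^ n) / (lucas_alpha P Q - lucas_beta P Q)"

definition additive_character :: "(int \<Rightarrow> complex) \<Rightarrow> bool" where
  "additive_character f \<longleftrightarrow> (\<forall>m. f m \<noteq> 0) \<and> (\<forall>m n. f (m + n) = f m * f n)"


section \<open>Holomorphic and meromorphic functions of several complex variables\<close>

text \<open>
  Since spaces of different dimensions occur in one statement, the space of \<open>e\<close>-tuples of complex
  numbers is modelled by the extensional functions on \<open>{1..e}\<close>. For \<open>e = 0\<close> it is a single point.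
\<close>

definition Cn :: "nat \<Rightarrow> (nat \<Rightarrow> complex) topology" where
  "Cn e = product_topology (\<lambda>_. euclidean) {1..e}"

text \<open>Holomorphic means continuous and holomorphic in each variable separately.\<close>

definition Cn_holomorphic :: "nat \<Rightarrow> (nat \<Rightarrow> complex) set \<Rightarrow> ((nat \<Rightarrow> complex) \<Rightarrow> complex) \<Rightarrow> bool" where
  "Cn_holomorphic e V F \<longleftrightarrow>
     openin (Cn e) V \<and> continuous_map (subtopology (Cn e) V) euclidean F \<and>
     (\<forall>s\<in>V. \<forall>i\<in>{1..e}. (\<lambda>z. F (s(i := z))) field_differentiable (at (s i)))"

text \<open>
  A meromorphic function is locally a quotient of holomorphic functions. As for \<open>meromorphic_on\<close>
  in one variable, the values at the zeros of the denominators are irrelevant; the function that is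
  meant is determined by the values on an open dense set.
\<close>

definition Cn_meromorphic :: "nat \<Rightarrow> ((nat \<Rightarrow> complex) \<Rightarrow> complex) \<Rightarrow> bool" where
  "Cn_meromorphic e F \<longleftrightarrow>
     (\<forall>p\<in>topspace (Cn e). \<exists>V g h.
        p \<in> V \<and> connectedin (Cn e) V \<and> Cn_holomorphic e V g \<and> Cn_holomorphic e V h \<and>
        (\<exists>s\<in>V. h s \<noteq> 0) \<and> (\<forall>s\<in>V. h s \<noteq> 0 \<longrightarrow> F s = g s / h s))"

text \<open>\<open>G\<close> is a holomorphic function near \<open>p\<close> that agrees with \<open>F\<close> on an open dense set near \<open>p\<close>.\<close>

definition Cn_extension_at ::
    "nat \<Rightarrow> ((nat \<Rightarrow> complex) \<Rightarrow> complex) \<Rightarrow> (nat \<Rightarrow> complex) \<Rightarrow> ((nat \<Rightarrow> complex) \<Rightarrow> complex) \<Rightarrow> bool" where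
  "Cn_extension_at e F p G \<longleftrightarrow>
     (\<exists>V W. p \<in> V \<and> Cn_holomorphic e V G \<and>
        openin (Cn e) W \<and> W \<subseteq> V \<and> V \<subseteq> Cn e closure_of W \<and> (\<forall>s\<in>W. F s = G s))"

definition Cn_regular_at :: "nat \<Rightarrow> ((nat \<Rightarrow> complex) \<Rightarrow> complex) \<Rightarrow> (nat \<Rightarrow> complex) \<Rightarrow> bool" where
  "Cn_regular_at e F p \<longleftrightarrow> (\<exists>G. Cn_extension_at e F p G)"

text \<open>
  The value of a meromorphic function at a regular point (by continuity it does not depend on the
  extension); the value 0 at the other points is a dummy. This is the analogue of \<open>remove_sings\<close>.
\<close>

definition Cn_remove_sings ::
    "nat \<Rightarrow> ((nat \<Rightarrow> complex) \<Rightarrow> complex) \<Rightarrow> (nat \<Rightarrow> complex) \<Rightarrow> complex" where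
  "Cn_remove_sings e F p =
     (if Cn_regular_at e F p then THE w. \<exists>G. Cn_extension_at e F p G \<and> w = G p else 0)"

text \<open>
  The residue of \<open>F\<close> along the hyperplane \<open>l s = b\<close> is the restriction of the meromorphic function
  \<open>(l s - b) * F s\<close> to this hyperplane, so only its values at points with \<open>l s = b\<close> are of interest.
  It is defined where that product is regular.
\<close>

definition hyperplane_residue_defined ::
    "nat \<Rightarrow> ((nat \<Rightarrow> complex) \<Rightarrow> complex) \<Rightarrow> complex \<Rightarrow> ((nat \<Rightarrow> complex) \<Rightarrow> complex) \<Rightarrow>
     (nat \<Rightarrow> complex) \<Rightarrow> bool" where
  "hyperplane_residue_defined e l b F = Cn_regular_at e (\<lambda>s. (l s - b) * F s)"

definition hyperplane_residue ::
    "nat \<Rightarrow> ((nat \<Rightarrow> complex) \<Rightarrow> complex) \<Rightarrow> complex \<Rightarrow> ((nat \<Rightarrow> complex) \<Rightarrow> complex) \<Rightarrow>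
     (nat \<Rightarrow> complex) \<Rightarrow> complex" where
  "hyperplane_residue e l b F = Cn_remove_sings e (\<lambda>s. (l s - b) * F s)"


section \<open>Multiple additive L-functions\<close>

definition increasing_tuples :: "nat \<Rightarrow> (nat \<Rightarrow> nat) set" where
  "increasing_tuples e = {m \<in> {1..e} \<rightarrow>\<^sub>E {0<..}. strict_mono_on {1..e} m}"

definition multiple_L_term ::
    "(nat \<Rightarrow> real) \<Rightarrow> nat \<Rightarrow> (nat \<Rightarrow> int \<Rightarrow> complex) \<Rightarrow> (nat \<Rightarrow> complex) \<Rightarrow> (nat \<Rightarrow> nat) \<Rightarrow> complex" where
  "multiple_L_term U e f s m = (\<Prod>i=1..e. f i (int (m i)) / of_real (U (m i)) powr s i)"

definition multiple_L_region ::
    "(nat \<Rightarrow> real) \<Rightarrow> nat \<Rightarrow> (nat \<Rightarrow> int \<Rightarrow> complex) \<Rightarrow> (nat \<Rightarrow> complex) set" where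
  "multiple_L_region U e f =
     {s \<in> topspace (Cn e). (\<lambda>m. norm (multiple_L_term U e f s m)) summable_on increasing_tuples e}"

definition multiple_L_series ::
    "(nat \<Rightarrow> real) \<Rightarrow> nat \<Rightarrow> (nat \<Rightarrow> int \<Rightarrow> complex) \<Rightarrow> (nat \<Rightarrow> complex) \<Rightarrow> complex" where
  "multiple_L_series U e f s = (\<Sum>\<^sub>\<infinity>m\<in>increasing_tuples e. multiple_L_term U e f s m)"

text \<open>
  All meromorphic continuations agree on an open dense set, so after removing the singularities
  the choice of the continuation does not matter.
\<close>

definition multiple_L ::
    "(nat \<Rightarrow> real) \<Rightarrow> nat \<Rightarrow> (nat \<Rightarrow> int \<Rightarrow> complex) \<Rightarrow> (nat \<Rightarrow> complex) \<Rightarrow> complex" where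
  "multiple_L U e f =
     (if e = 0 then (\<lambda>_. 1)
      else Cn_remove_sings e (SOME F. Cn_meromorphic e F \<and>
             (\<forall>s\<in>multiple_L_region U e f. F s = multiple_L_series U e f s)))"

end

theory Submission
  imports Defs "HOL-Complex_Analysis.Complex_Analysis"
begin

text \<open>
  Let \<open>r = \<beta> / \<alpha>\<close>, so \<open>U n = \<alpha> ^ n * (1 - r ^ n) / sqrt D\<close> with \<open>\<bar>r\<bar> < 1\<close>. Expanding each
  \<open>(1 - r ^ n) powr (- s i)\<close> by the binomial series and summing the resulting multiple geometric series
  gives, where the series converges, a sum over \<open>k \<in> \<nat>\<^sup>e\<close> whose terms are products of binomial
  coefficients and of factors \<open>q / (\<alpha> powr (s t + \<dots> + s e) - q)\<close> with \<open>q = g t * r ^ (k t + \<dots> + k e)\<close>.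
  Since \<open>q \<rightarrow> 0\<close>, near a given point at most one value of \<open>k t + \<dots> + k e\<close> is singular for each \<open>t\<close>;
  multiplying by these finitely many denominators leaves a locally uniformly convergent sum, so the sum is
  the meromorphic continuation. At a point of the hyperplane where only the \<open>j\<close>-th denominator vanishes
  the residue picks the terms with \<open>k j + \<dots> + k d = K\<close>, and \<open>\<alpha> powr (s j + \<dots> + s d) = q\<close> makes the factors
  with \<open>t < j\<close> split off as the continuation in depth \<open>j - 1\<close>. Such points are dense in the hyperplane, and
  both sides are continuous wherever they are defined.
\<close>

section \<open>Holomorphic functions of several variables\<close>

text \<open>\<open>multiple_L\<close> is chosen by \<open>SOME\<close> among all continuations, so
  no formula for it is available before uniqueness is known: every meromorphic function equal to the
  series on its full region of absolute convergence has to agree with \<open>cont\<close>. This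
  calls for an identity theorem in several variables and for an exact description of that region.
  Equality at every point cannot be expected, since values on the zeros of denominators are
  arbitrary; agreement on an open dense set is the notion that survives. Convergence rests on
  geometric decay in the tail sums \<open>k t + ... + k e\<close>, which dominate the single
  exponents. The linear form \<open>l s - b\<close> and the true denominator differ by a factor that
  does not vanish near the hyperplane and equals \<open>q\<close> times \<open>ln \<alpha>\<close>
  on it; this is the origin of the final \<open>1 / ln \<alpha>\<close>. The vanishing of another
  denominator does not by itself exclude regularity, as its residue may vanish. Hence the formula is
  carried over to such points by limits along lines inside the hyperplane.\<close>

lemma topspace_Cn: "topspace (Cn e) = extensional {1..e}"
  by (simp add: Cn_def PiE_UNIV_domain PiE_def)

text \<open>Polydiscs are the working neighbourhoods: they form a base, are connected, and allow one
  coordinate to move freely inside its disc.\<close>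

definition polydisc :: "nat \<Rightarrow> (nat \<Rightarrow> complex) \<Rightarrow> real \<Rightarrow> (nat \<Rightarrow> complex) set" where
  "polydisc e p \<epsilon> = PiE {1..e} (\<lambda>i. ball (p i) \<epsilon>)"

lemma openin_polydisc: "openin (Cn e) (polydisc e p \<epsilon>)"
  unfolding polydisc_def Cn_def by (subst openin_PiE) auto

lemma connectedin_polydisc: "connectedin (Cn e) (polydisc e p \<epsilon>)"
  unfolding polydisc_def Cn_def by (subst connectedin_PiE) (auto simp: connected_ball)

lemma polydisc_center: "p \<in> topspace (Cn e) \<Longrightarrow> \<epsilon> > 0 \<Longrightarrow> p \<in> polydisc e p \<epsilon>"
  by (auto simp: polydisc_def topspace_Cn PiE_def)

lemma polydisc_subset_topspace: "polydisc e p \<epsilon> \<subseteq> topspace (Cn e)"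
  by (auto simp: polydisc_def topspace_Cn PiE_def)

lemma polydisc_neighbourhood:
  assumes "openin (Cn e) V" "p \<in> V"
  obtains \<epsilon> where "\<epsilon> > 0" "polydisc e p \<epsilon> \<subseteq> V"
proof -
  obtain U where U: "\<And>i. i \<in> {1..e} \<Longrightarrow> open (U i)" "p \<in> PiE {1..e} U" "PiE {1..e} U \<subseteq> V"
    using assms unfolding Cn_def openin_product_topology_alt by (metis open_openin)
  have "\<exists>\<delta>>0. ball (p i) \<delta> \<subseteq> U i" if "i \<in> {1..e}" for i
    using U(1)[OF that] U(2) that by (auto simp: open_contains_ball PiE_def Pi_def)
  then obtain \<delta> where \<delta>: "\<And>i. i \<in> {1..e} \<Longrightarrow> \<delta> i > 0 \<and> ball (p i) (\<delta> i) \<subseteq> U i"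
    by metis
  \<comment> \<open>The element 1 keeps the set non-empty when \<open>e = 0\<close>.\<close>
  define \<epsilon> where "\<epsilon> = Min (insert 1 (\<delta> ` {1..e}))"
  have "\<epsilon> > 0" using \<delta> by (auto simp: \<epsilon>_def)
  moreover have "\<epsilon> \<le> \<delta> i" if "i \<in> {1..e}" for i
    unfolding \<epsilon>_def by (rule Min_le) (use that in auto)
  then have "polydisc e p \<epsilon> \<subseteq> PiE {1..e} U"
    unfolding polydisc_def by (intro PiE_mono) (use \<delta> in fastforce)
  ultimately show ?thesis using that U(3) by blast
qed

text \<open>This makes the type class notions (\<open>continuous_on\<close>, limits of sequences)
  available for \<open>Cn e\<close>. The topologies agree because extensional functions all take the
  same value off \<open>{1..e}\<close>.\<close>

lemma Cn_eq: "Cn e = top_of_set (extensional {1..e})"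
proof (rule topology_eq[THEN iffD2], intro allI iffI)
  fix V assume V: "openin (Cn e) V"
  have "\<exists>T. open T \<and> p \<in> T \<inter> extensional {1..e} \<and> T \<inter> extensional {1..e} \<subseteq> V" if p: "p \<in> V" for p
  proof -
    obtain \<epsilon> where e: "\<epsilon> > 0" "polydisc e p \<epsilon> \<subseteq> V" using polydisc_neighbourhood[OF V p] .
    have pe: "p \<in> topspace (Cn e)" using V p openin_subset by blast
    \<comment> \<open>Only finitely many coordinates are constrained, so the box is open in the
      infinite product.\<close>
    define T where "T = (\<Pi>\<^sub>E i\<in>UNIV. if i \<in> {1..e} then ball (p i) \<epsilon> else UNIV)"
    have "finite {i. (if i \<in> {1..e} then ball (p i) \<epsilon> else UNIV) \<noteq> UNIV}"
      by (rule finite_subset[of _ "{1..e}"]) auto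
    then have "open T" unfolding T_def by (intro open_PiE) auto
    moreover have "T \<inter> extensional {1..e} = polydisc e p \<epsilon>"
      by (auto simp: T_def polydisc_def PiE_def Pi_def split: if_splits)
    ultimately show ?thesis using e polydisc_center[OF pe e(1)] by blast
  qed
  then have "\<exists>\<T>. (\<forall>p\<in>V. open (\<T> p) \<and> p \<in> \<T> p \<inter> extensional {1..e} \<and> \<T> p \<inter> extensional {1..e} \<subseteq> V)"
    by metis
  then obtain \<T> where T: "\<And>p. p \<in> V \<Longrightarrow> open (\<T> p) \<and> p \<in> \<T> p \<inter> extensional {1..e} \<and> \<T> p \<inter> extensional {1..e} \<subseteq> V"
    by metis
  show "openin (top_of_set (extensional {1..e})) V"
    unfolding openin_open by (rule exI[of _ "\<Union>p\<in>V. \<T> p"]) (use T in fastforce)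
next
  fix V :: "(nat \<Rightarrow> complex) set" assume "openin (top_of_set (extensional {1..e})) V"
  then obtain T where T: "open T" "V = extensional {1..e} \<inter> T" by (auto simp: openin_open)
  have "\<exists>W. openin (Cn e) W \<and> p \<in> W \<and> W \<subseteq> V" if p: "p \<in> V" for p
  proof -
    have *: "openin (product_topology (\<lambda>_. euclidean) UNIV) T"
      using T(1) by (simp add: euclidean_product_topology)
    have "p \<in> T" using p T(2) by blast
    from bspec[OF iffD1[OF openin_product_topology_alt *] this] obtain U where U: "\<And>i. open (U i)" "p \<in> PiE UNIV U" "PiE UNIV U \<subseteq> T"
      by auto
    have "openin (Cn e) (PiE {1..e} U)"
      unfolding Cn_def by (subst openin_PiE) (use U in auto)
    moreover have "p \<in> PiE {1..e} U" using p T(2) U(2) by (auto simp: PiE_def)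
    moreover have "PiE {1..e} U \<subseteq> V"
    proof
      fix x assume x: "x \<in> PiE {1..e} U"
      have "x i = p i" if "i \<notin> {1..e}" for i
        using x p T(2) that by (auto simp: PiE_def extensional_def)
      then have "x i \<in> U i" for i using x U(2) by (cases "i \<in> {1..e}") (auto simp: PiE_def Pi_def)
      then have "x \<in> PiE UNIV U" by (simp add: PiE_UNIV_domain)
      then show "x \<in> V" using x U(3) T(2) by (auto simp: PiE_def)
    qed
    ultimately show ?thesis by blast
  qed
  then show "openin (Cn e) V" by (subst openin_subopen) blast
qed

lemma Cn_holomorphic_iff:
  "Cn_holomorphic e V F \<longleftrightarrow>
     openin (Cn e) V \<and> continuous_on V F \<and>
     (\<forall>s\<in>V. \<forall>i\<in>{1..e}. (\<lambda>z. F (s(i := z))) field_differentiable (at (s i)))"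
proof -
  have "subtopology (Cn e) V = top_of_set V" if "openin (Cn e) V"
    using openin_subset[OF that] unfolding topspace_Cn
    by (simp add: Cn_eq subtopology_subtopology Int_absorb1)
  then show ?thesis unfolding Cn_holomorphic_def by (auto simp: continuous_map_iff_continuous)
qed

lemma Cn_holomorphicD:
  assumes "Cn_holomorphic e V F"
  shows "openin (Cn e) V" "continuous_on V F" "V \<subseteq> extensional {1..e}"
  using assms openin_subset unfolding Cn_holomorphic_iff topspace_Cn[symmetric] by auto

lemma Cn_holomorphic_subset:
  assumes "Cn_holomorphic e V F" "openin (Cn e) W" "W \<subseteq> V"
  shows "Cn_holomorphic e W F"
  using assms unfolding Cn_holomorphic_iff by (blast intro: continuous_on_subset)

lemma slice_in_polydisc:
  assumes "s \<in> polydisc e p \<epsilon>" "i \<in> {1..e}" "z \<in> ball (p i) \<epsilon>"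
  shows "s(i := z) \<in> polydisc e p \<epsilon>"
  using assms by (auto simp: polydisc_def PiE_def extensional_def)

lemma Cn_holomorphic_slice:
  assumes F: "Cn_holomorphic e (polydisc e p \<epsilon>) F" and s: "s \<in> polydisc e p \<epsilon>" and i: "i \<in> {1..e}"
  shows "(\<lambda>z. F (s(i := z))) holomorphic_on ball (p i) \<epsilon>"
proof -
  have "(\<lambda>z. F (s(i := z))) field_differentiable (at w)" if "w \<in> ball (p i) \<epsilon>" for w
  proof -
    have "(\<lambda>z. F ((s(i := w))(i := z))) field_differentiable (at ((s(i := w)) i))"
      using F slice_in_polydisc[OF s i that] i unfolding Cn_holomorphic_iff by blast
    then show ?thesis by simp
  qed
  then show ?thesis by (auto simp: holomorphic_on_def intro: field_differentiable_at_within)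
qed

lemma slice_neighbourhood:
  assumes "openin (Cn e) V" "s \<in> V" "i \<in> {1..e}"
  shows "\<forall>\<^sub>F z in nhds (s i). s(i := z) \<in> V"
proof -
  obtain \<epsilon> where e: "\<epsilon> > 0" "polydisc e s \<epsilon> \<subseteq> V" using polydisc_neighbourhood assms by blast
  have s: "s \<in> polydisc e s \<epsilon>" using e assms openin_subset polydisc_center by blast
  have "s(i := z) \<in> V" if "z \<in> ball (s i) \<epsilon>" for z
    using slice_in_polydisc[OF s assms(3) that] e by blast
  then show ?thesis unfolding eventually_nhds_metric using e(1) by (auto simp: dist_commute)
qed

lemma Cn_holomorphic_const: "openin (Cn e) V \<Longrightarrow> Cn_holomorphic e V (\<lambda>_. c)"
  by (simp add: Cn_holomorphic_iff)

lemma Cn_holomorphic_coord: "openin (Cn e) V \<Longrightarrow> Cn_holomorphic e V (\<lambda>s. s i)"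
  unfolding Cn_holomorphic_iff
proof (intro conjI ballI)
  show "continuous_on V (\<lambda>s. s i)"
    by (rule continuous_on_subset[OF continuous_on_product_coordinates]) auto
  fix s k show "(\<lambda>z. (s(k := z)) i) field_differentiable at (s k)"
    by (cases "i = k") auto
qed auto

lemma Cn_holomorphic_add:
  "Cn_holomorphic e V F \<Longrightarrow> Cn_holomorphic e V G \<Longrightarrow> Cn_holomorphic e V (\<lambda>s. F s + G s)"
  unfolding Cn_holomorphic_iff
  by (auto intro: continuous_on_add field_differentiable_add)

lemma Cn_holomorphic_diff:
  "Cn_holomorphic e V F \<Longrightarrow> Cn_holomorphic e V G \<Longrightarrow> Cn_holomorphic e V (\<lambda>s. F s - G s)"
  unfolding Cn_holomorphic_iff
  by (auto intro: continuous_on_diff field_differentiable_diff)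

lemma Cn_holomorphic_mult:
  "Cn_holomorphic e V F \<Longrightarrow> Cn_holomorphic e V G \<Longrightarrow> Cn_holomorphic e V (\<lambda>s. F s * G s)"
  unfolding Cn_holomorphic_iff
  by (auto intro: continuous_on_mult field_differentiable_mult)

lemma Cn_holomorphic_divide:
  "Cn_holomorphic e V F \<Longrightarrow> Cn_holomorphic e V G \<Longrightarrow> (\<And>s. s \<in> V \<Longrightarrow> G s \<noteq> 0) \<Longrightarrow>
   Cn_holomorphic e V (\<lambda>s. F s / G s)"
  unfolding Cn_holomorphic_iff
  by (auto intro!: continuous_on_divide field_differentiable_divide)

lemma Cn_holomorphic_compose:
  assumes F: "Cn_holomorphic e V F" and g: "g holomorphic_on U" "open U" "\<And>s. s \<in> V \<Longrightarrow> F s \<in> U"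
  shows "Cn_holomorphic e V (\<lambda>s. g (F s))"
  unfolding Cn_holomorphic_iff
proof (intro conjI ballI)
  show "openin (Cn e) V" using F by (simp add: Cn_holomorphic_iff)
  show "continuous_on V (\<lambda>s. g (F s))"
    using continuous_on_compose2[OF holomorphic_on_imp_continuous_on[OF g(1)], of V F] F g(3)
    unfolding Cn_holomorphic_iff by blast
  fix s i assume s: "s \<in> V" "i \<in> {1..e}"
  have 1: "(\<lambda>z. F (s(i := z))) field_differentiable at (s i)"
    using F s by (auto simp: Cn_holomorphic_iff)
  have "g field_differentiable at (F s)"
    using g s(1) holomorphic_on_imp_differentiable_at by blast
  then show "(\<lambda>z. g (F (s(i := z)))) field_differentiable at (s i)"
    using field_differentiable_compose[OF 1, of g] by (simp add: o_def)
qed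

lemma Cn_holomorphic_sum:
  "openin (Cn e) V \<Longrightarrow> (\<And>x. x \<in> A \<Longrightarrow> Cn_holomorphic e V (F x)) \<Longrightarrow> Cn_holomorphic e V (\<lambda>s. \<Sum>x\<in>A. F x s)"
  by (induction A rule: infinite_finite_induct) (auto intro: Cn_holomorphic_const Cn_holomorphic_add)

lemma Cn_holomorphic_prod:
  "openin (Cn e) V \<Longrightarrow> (\<And>x. x \<in> A \<Longrightarrow> Cn_holomorphic e V (F x)) \<Longrightarrow> Cn_holomorphic e V (\<lambda>s. \<Prod>x\<in>A. F x s)"
  by (induction A rule: infinite_finite_induct) (auto intro: Cn_holomorphic_const Cn_holomorphic_mult)

lemma Cn_holomorphic_cong:
  assumes "Cn_holomorphic e V F" "\<And>s. s \<in> V \<Longrightarrow> F s = G s"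
  shows "Cn_holomorphic e V G"
  unfolding Cn_holomorphic_iff
proof (intro conjI ballI)
  show "openin (Cn e) V" using assms by (simp add: Cn_holomorphic_iff)
  show "continuous_on V G" using assms by (simp add: Cn_holomorphic_iff cong: continuous_on_cong)
  fix s i assume s: "s \<in> V" "i \<in> {1..e}"
  then have "(\<lambda>z. F (s(i := z))) field_differentiable at (s i)"
    using assms by (auto simp: Cn_holomorphic_iff)
  moreover have "\<forall>\<^sub>F z in nhds (s i). F (s(i := z)) = G (s(i := z))"
    using slice_neighbourhood[of e V s i] assms s by (auto simp: Cn_holomorphic_iff elim: eventually_mono)
  ultimately show "(\<lambda>z. G (s(i := z))) field_differentiable at (s i)"
    unfolding field_differentiable_def
    using DERIV_cong_ev[OF refl, of "\<lambda>z. F (s(i := z))" "\<lambda>z. G (s(i := z))" "s i"] by blast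
qed

text \<open>The M-test makes the finite partial sums converge uniformly, which gives continuity; on
  each one-variable slice a uniform limit of holomorphic functions is holomorphic.\<close>

lemma Cn_holomorphic_infsum:
  assumes V: "openin (Cn e) V"
    and T: "\<And>k. k \<in> S \<Longrightarrow> Cn_holomorphic e V (T k)"
    and M: "\<And>k s. k \<in> S \<Longrightarrow> s \<in> V \<Longrightarrow> norm (T k s) \<le> M k" "M summable_on S"
  shows "Cn_holomorphic e V (\<lambda>s. \<Sum>\<^sub>\<infinity>k\<in>S. T k s)"
proof -
  have ul: "uniform_limit V (\<lambda>X s. \<Sum>k\<in>X. T k s) (\<lambda>s. \<Sum>\<^sub>\<infinity>k\<in>S. T k s) (finite_subsets_at_top S)"
    using M by (intro Weierstrass_m_test_general) auto
  have part: "\<forall>\<^sub>F X in finite_subsets_at_top S. Cn_holomorphic e V (\<lambda>s. \<Sum>k\<in>X. T k s)"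
    unfolding eventually_finite_subsets_at_top
    by (rule exI[of _ "{}"]) (auto intro!: Cn_holomorphic_sum[OF V] T)
  show ?thesis unfolding Cn_holomorphic_iff
  proof (intro conjI ballI)
    show "openin (Cn e) V" by fact
    show "continuous_on V (\<lambda>s. \<Sum>\<^sub>\<infinity>k\<in>S. T k s)"
      by (rule uniform_limit_theorem[OF _ ul]) (use part in \<open>auto simp: Cn_holomorphic_iff elim: eventually_mono\<close>)
    fix s i assume s: "s \<in> V" and i: "i \<in> {1..e}"
    obtain \<epsilon> where e: "\<epsilon> > 0" "polydisc e s \<epsilon> \<subseteq> V" using polydisc_neighbourhood V s by blast
    have sp: "s \<in> polydisc e s \<epsilon>" using e V s openin_subset polydisc_center by blast
    \<comment> \<open>Half the radius keeps a closed disc inside the slice, as the theorem on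
      uniform limits asks for continuity up to the boundary.\<close>
    have sub: "s(i := z) \<in> V" if "z \<in> cball (s i) (\<epsilon>/2)" for z
      using slice_in_polydisc[OF sp i, of z] e that by fastforce
    have ul': "uniform_limit (cball (s i) (\<epsilon>/2)) (\<lambda>X z. \<Sum>k\<in>X. T k (s(i := z)))
                 (\<lambda>z. \<Sum>\<^sub>\<infinity>k\<in>S. T k (s(i := z))) (finite_subsets_at_top S)"
      by (rule uniform_limit_compose'[OF ul]) (use sub in auto)
    have "\<forall>\<^sub>F X in finite_subsets_at_top S. (\<lambda>z. \<Sum>k\<in>X. T k (s(i := z))) holomorphic_on ball (s i) \<epsilon>"
      using part
    proof eventually_elim
      case (elim X)
      then show ?case
        using Cn_holomorphic_slice[OF Cn_holomorphic_subset[OF elim openin_polydisc e(2)] sp i] by simp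
    qed
    then have "\<forall>\<^sub>F X in finite_subsets_at_top S.
        continuous_on (cball (s i) (\<epsilon>/2)) (\<lambda>z. \<Sum>k\<in>X. T k (s(i := z))) \<and>
        (\<lambda>z. \<Sum>k\<in>X. T k (s(i := z))) holomorphic_on ball (s i) (\<epsilon>/2)"
    proof eventually_elim
      case (elim X)
      have "cball (s i) (\<epsilon>/2) \<subseteq> ball (s i) \<epsilon>" "ball (s i) (\<epsilon>/2) \<subseteq> ball (s i) \<epsilon>" using e(1) by auto
      then show ?case using elim by (blast intro: holomorphic_on_subset holomorphic_on_imp_continuous_on)
    qed
    then have "(\<lambda>z. \<Sum>\<^sub>\<infinity>k\<in>S. T k (s(i := z))) holomorphic_on ball (s i) (\<epsilon>/2)"
      by (rule holomorphic_uniform_limit[OF _ ul']) (auto simp: finite_subsets_at_top_neq_bot)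
    then show "(\<lambda>z. \<Sum>\<^sub>\<infinity>k\<in>S. T k (s(i := z))) field_differentiable at (s i)"
      using e(1) by (intro holomorphic_on_imp_differentiable_at[of _ "ball (s i) (\<epsilon>/2)"]) auto
  qed
qed

section \<open>Uniqueness of meromorphic continuation\<close>

text \<open>This is agreement on an open dense subset of \<open>V\<close>. Phrased by shrinking open
  sets, it is visibly transitive and local; \<open>eq_densely_iff\<close> recovers the form with
  closures used in \<open>Cn_extension_at\<close>.\<close>

definition eq_densely ::
    "nat \<Rightarrow> (nat \<Rightarrow> complex) set \<Rightarrow> ((nat \<Rightarrow> complex) \<Rightarrow> complex) \<Rightarrow> ((nat \<Rightarrow> complex) \<Rightarrow> complex) \<Rightarrow> bool" where
  "eq_densely e V F G \<longleftrightarrow>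
     (\<forall>B. openin (Cn e) B \<and> B \<subseteq> V \<and> B \<noteq> {} \<longrightarrow>
        (\<exists>B'. openin (Cn e) B' \<and> B' \<subseteq> B \<and> B' \<noteq> {} \<and> (\<forall>s\<in>B'. F s = G s)))"

lemma eq_denselyD:
  assumes "eq_densely e V F G" "openin (Cn e) B" "B \<subseteq> V" "B \<noteq> {}"
  shows "\<exists>B'. openin (Cn e) B' \<and> B' \<subseteq> B \<and> B' \<noteq> {} \<and> (\<forall>s\<in>B'. F s = G s)"
  using assms(1)[unfolded eq_densely_def, rule_format, of B] assms(2-4) by simp

lemma eq_densely_sym: "eq_densely e V F G \<Longrightarrow> eq_densely e V G F"
  unfolding eq_densely_def eq_commute[of "F _"] by assumption

lemma eq_densely_trans:
  assumes "eq_densely e V F G" "eq_densely e V G H"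
  shows "eq_densely e V F H"
  unfolding eq_densely_def
proof (intro allI impI, elim conjE)
  fix B assume B: "openin (Cn e) B" "B \<subseteq> V" "B \<noteq> {}"
  obtain B1 where B1: "openin (Cn e) B1" "B1 \<subseteq> B" "B1 \<noteq> {}" "\<forall>s\<in>B1. F s = G s"
    using eq_denselyD[OF assms(1) B] by blast
  obtain B2 where B2: "openin (Cn e) B2" "B2 \<subseteq> B1" "B2 \<noteq> {}" "\<forall>s\<in>B2. G s = H s"
    using eq_denselyD[OF assms(2) B1(1) order_trans[OF B1(2) B(2)] B1(3)] by blast
  show "\<exists>B'. openin (Cn e) B' \<and> B' \<subseteq> B \<and> B' \<noteq> {} \<and> (\<forall>s\<in>B'. F s = H s)"
    using B1 B2 by (intro exI[of _ B2]) auto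
qed

lemma eq_densely_mono: "eq_densely e V F G \<Longrightarrow> W \<subseteq> V \<Longrightarrow> eq_densely e W F G"
  unfolding eq_densely_def by (blast intro: order_trans)

lemma eq_densely_local:
  assumes "\<And>p. p \<in> V \<Longrightarrow> \<exists>U. openin (Cn e) U \<and> p \<in> U \<and> eq_densely e U F G"
  shows "eq_densely e V F G"
  unfolding eq_densely_def
proof (intro allI impI, elim conjE)
  fix B assume B: "openin (Cn e) B" "B \<subseteq> V" "B \<noteq> {}"
  then obtain p where p: "p \<in> B" by blast
  then obtain U where U: "openin (Cn e) U" "p \<in> U" "eq_densely e U F G" using assms B by blast
  have "openin (Cn e) (U \<inter> B)" "U \<inter> B \<noteq> {}" using U B p by auto
  then obtain B' where "openin (Cn e) B'" "B' \<subseteq> U \<inter> B" "B' \<noteq> {}" "\<forall>s\<in>B'. F s = G s"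
    using eq_denselyD[OF U(3) _ Int_lower1, of B] by blast
  then show "\<exists>B'. openin (Cn e) B' \<and> B' \<subseteq> B \<and> B' \<noteq> {} \<and> (\<forall>s\<in>B'. F s = G s)"
    by (intro exI[of _ B']) auto
qed

lemma subset_closure_of_iff:
  assumes "openin (Cn e) V"
  shows "V \<subseteq> Cn e closure_of W \<longleftrightarrow>
           (\<forall>B. openin (Cn e) B \<and> B \<subseteq> V \<and> B \<noteq> {} \<longrightarrow> B \<inter> W \<noteq> {})"
proof
  assume R: "\<forall>B. openin (Cn e) B \<and> B \<subseteq> V \<and> B \<noteq> {} \<longrightarrow> B \<inter> W \<noteq> {}"
  show "V \<subseteq> Cn e closure_of W"
  proof
    fix x assume x: "x \<in> V"
    have "\<exists>y. y \<in> W \<and> y \<in> T" if "x \<in> T" "openin (Cn e) T" for T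
      using R[rule_format, of "T \<inter> V"] that x assms by auto
    then show "x \<in> Cn e closure_of W"
      using x openin_subset[OF assms] unfolding in_closure_of by blast
  qed
next
  assume L: "V \<subseteq> Cn e closure_of W"
  show "\<forall>B. openin (Cn e) B \<and> B \<subseteq> V \<and> B \<noteq> {} \<longrightarrow> B \<inter> W \<noteq> {}"
  proof (intro allI impI, elim conjE)
    fix B assume B: "openin (Cn e) B" "B \<subseteq> V" "B \<noteq> {}"
    then obtain x where "x \<in> B" "x \<in> Cn e closure_of W" using L by blast
    then show "B \<inter> W \<noteq> {}" using B(1) unfolding in_closure_of by blast
  qed
qed

lemma eq_densely_iff:
  assumes "openin (Cn e) V"
  shows "eq_densely e V F G \<longleftrightarrow>
           (\<exists>W. openin (Cn e) W \<and> W \<subseteq> V \<and> V \<subseteq> Cn e closure_of W \<and> (\<forall>s\<in>W. F s = G s))"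
proof
  assume E: "eq_densely e V F G"
  let ?W = "\<Union>{B. openin (Cn e) B \<and> B \<subseteq> V \<and> (\<forall>s\<in>B. F s = G s)}"
  have "openin (Cn e) ?W" by (rule openin_Union) simp
  moreover have "?W \<subseteq> V" "\<forall>s\<in>?W. F s = G s" by auto
  moreover have "V \<subseteq> Cn e closure_of ?W"
    unfolding subset_closure_of_iff[OF assms]
  proof (intro allI impI, elim conjE)
    fix B assume B: "openin (Cn e) B" "B \<subseteq> V" "B \<noteq> {}"
    obtain B' where B': "openin (Cn e) B'" "B' \<subseteq> B" "B' \<noteq> {}" "\<forall>s\<in>B'. F s = G s"
      using eq_denselyD[OF E B] by blast
    have "B' \<in> {B. openin (Cn e) B \<and> B \<subseteq> V \<and> (\<forall>s\<in>B. F s = G s)}"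
      using B'(1,4) order_trans[OF B'(2) B(2)] by simp
    then have "B' \<subseteq> ?W" by (rule Union_upper)
    then have "B' \<subseteq> B \<inter> ?W" using B'(2) by (rule Int_greatest[rotated])
    then show "B \<inter> ?W \<noteq> {}" using B'(3) by auto
  qed
  ultimately show "\<exists>W. openin (Cn e) W \<and> W \<subseteq> V \<and> V \<subseteq> Cn e closure_of W \<and> (\<forall>s\<in>W. F s = G s)"
    by (intro exI[of _ ?W] conjI)
next
  assume "\<exists>W. openin (Cn e) W \<and> W \<subseteq> V \<and> V \<subseteq> Cn e closure_of W \<and> (\<forall>s\<in>W. F s = G s)"
  then obtain W where W: "openin (Cn e) W" "V \<subseteq> Cn e closure_of W" "\<forall>s\<in>W. F s = G s" by blast
  show "eq_densely e V F G"
    unfolding eq_densely_def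
  proof (intro allI impI, elim conjE)
    fix B assume B: "openin (Cn e) B" "B \<subseteq> V" "B \<noteq> {}"
    then have "B \<inter> W \<noteq> {}" using W(2) unfolding subset_closure_of_iff[OF assms] by blast
    then show "\<exists>B'. openin (Cn e) B' \<and> B' \<subseteq> B \<and> B' \<noteq> {} \<and> (\<forall>s\<in>B'. F s = G s)"
      using W B by (intro exI[of _ "B \<inter> W"]) auto
  qed
qed

lemma Cn_extension_at_iff:
  "Cn_extension_at e F p G \<longleftrightarrow> (\<exists>V. p \<in> V \<and> Cn_holomorphic e V G \<and> eq_densely e V F G)"
  unfolding Cn_extension_at_def by (metis Cn_holomorphicD(1) eq_densely_iff)

lemma openin_nonzero:
  assumes "openin (Cn e) V" "continuous_on V F"
  shows "openin (Cn e) {s \<in> V. F s \<noteq> (0::complex)}"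
proof -
  have "openin (top_of_set V) (V \<inter> F -` (- {0}))"
    by (rule continuous_openin_preimage_gen[OF assms(2)]) auto
  moreover have "V \<inter> F -` (- {0}) = {s \<in> V. F s \<noteq> 0}" by auto
  ultimately show ?thesis using assms(1) openin_trans unfolding Cn_eq by metis
qed

lemma eq_densely_imp_eq:
  assumes V: "openin (Cn e) V" and c: "continuous_on V F" "continuous_on V G"
    and E: "eq_densely e V F G" and p: "p \<in> V"
  shows "F p = G p"
proof (rule ccontr)
  assume "F p \<noteq> G p"
  then have ne: "{s \<in> V. F s - G s \<noteq> 0} \<noteq> {}" using p by auto
  have op: "openin (Cn e) {s \<in> V. F s - G s \<noteq> 0}"
    by (rule openin_nonzero[OF V]) (intro continuous_on_diff c)
  obtain B where "openin (Cn e) B" "B \<subseteq> {s \<in> V. F s - G s \<noteq> 0}" "B \<noteq> {}" "\<forall>s\<in>B. F s = G s"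
    using eq_denselyD[OF E op _ ne] by auto
  then show False by auto
qed

text \<open>Both extensions agree densely with \<open>F\<close>, hence with each other, and by
  continuity also at \<open>p\<close>. This makes the \<open>THE\<close> in
  \<open>Cn_remove_sings\<close> well defined.\<close>

lemma Cn_extension_unique:
  assumes "Cn_extension_at e F p G" "Cn_extension_at e F p H"
  shows "G p = H p"
proof -
  obtain V where V: "p \<in> V" "Cn_holomorphic e V G" "eq_densely e V F G"
    using assms by (auto simp: Cn_extension_at_iff)
  obtain W where W: "p \<in> W" "Cn_holomorphic e W H" "eq_densely e W F H"
    using assms by (auto simp: Cn_extension_at_iff)
  have "eq_densely e (V \<inter> W) G H"
    by (rule eq_densely_trans[of _ _ _ F])
      (use V W in \<open>auto intro: eq_densely_mono eq_densely_sym\<close>)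
  moreover have "continuous_on (V \<inter> W) G" "continuous_on (V \<inter> W) H"
    using Cn_holomorphicD(2)[OF V(2)] Cn_holomorphicD(2)[OF W(2)]
    by (auto elim: continuous_on_subset)
  moreover have "openin (Cn e) (V \<inter> W)"
    using Cn_holomorphicD(1)[OF V(2)] Cn_holomorphicD(1)[OF W(2)] by auto
  moreover have "p \<in> V \<inter> W" using V(1) W(1) by blast
  ultimately show ?thesis by (metis eq_densely_imp_eq)
qed

lemma Cn_remove_sings_eqI:
  assumes "Cn_extension_at e F p G"
  shows "Cn_remove_sings e F p = G p"
proof -
  have "(THE w. \<exists>G. Cn_extension_at e F p G \<and> w = G p) = G p"
  proof (rule the_equality)
    fix w assume "\<exists>G'. Cn_extension_at e F p G' \<and> w = G' p"
    then show "w = G p" using Cn_extension_unique[OF assms] by metis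
  qed (use assms in auto)
  then show ?thesis using assms by (auto simp: Cn_remove_sings_def Cn_regular_at_def)
qed

lemma Cn_remove_sings_eq_on:
  assumes "Cn_holomorphic e V G" "eq_densely e V F G" "p \<in> V"
  shows "Cn_remove_sings e F p = G p"
  using assms by (intro Cn_remove_sings_eqI) (auto simp: Cn_extension_at_iff)

text \<open>Moving one coordinate at a time reduces this to the identity theorem in one variable.\<close>

lemma Cn_zero_polydisc:
  assumes F: "Cn_holomorphic e (polydisc e p \<epsilon>) F"
    and W: "openin (Cn e) W" "W \<subseteq> polydisc e p \<epsilon>" "W \<noteq> {}" "\<And>s. s \<in> W \<Longrightarrow> F s = 0"
    and s: "s \<in> polydisc e p \<epsilon>"
  shows "F s = 0"
proof -
  obtain q where q: "q \<in> W" using W by blast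
  obtain \<delta> where \<delta>: "\<delta> > 0" "polydisc e q \<delta> \<subseteq> W" using polydisc_neighbourhood W(1) q by blast
  \<comment> \<open>Coordinates up to \<open>m\<close> are free, the later ones lie near
    \<open>q\<close>. For \<open>m = 0\<close> the point is in \<open>W\<close>, for
    \<open>m = e\<close> no restriction is left, and each step frees one coordinate.\<close>
  have claim: "\<forall>s\<in>polydisc e p \<epsilon>. (\<forall>i\<in>{m<..e}. s i \<in> ball (q i) \<delta>) \<longrightarrow> F s = 0" for m
  proof (induction m)
    case 0
    have "s \<in> W" if "s \<in> polydisc e p \<epsilon>" "\<forall>i\<in>{0<..e}. s i \<in> ball (q i) \<delta>" for s
      using that \<delta>(2) by (auto simp: polydisc_def PiE_def Pi_def)
    then show ?case using W(4) by blast
  next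
    case (Suc m)
    show ?case
    proof (intro ballI impI)
      fix s assume s: "s \<in> polydisc e p \<epsilon>" and near: "\<forall>i\<in>{Suc m<..e}. s i \<in> ball (q i) \<delta>"
      show "F s = 0"
      proof (cases "Suc m \<le> e")
        case False
        then show ?thesis using Suc s by auto
      next
        case True
        then have i: "Suc m \<in> {1..e}" by auto
        let ?i = "Suc m"
        have hol: "(\<lambda>z. F (s(?i := z))) holomorphic_on ball (p ?i) \<epsilon>"
          by (rule Cn_holomorphic_slice[OF F s i])
        have q_in: "q ?i \<in> ball (p ?i) \<epsilon>" using q W(2) i by (auto simp: polydisc_def PiE_def Pi_def)
        have zero: "F (s(?i := z)) = 0" if z: "z \<in> ball (p ?i) \<epsilon> \<inter> ball (q ?i) \<delta>" for z
        proof -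
          have "s(?i := z) \<in> polydisc e p \<epsilon>" using slice_in_polydisc[OF s i] z by blast
          moreover have "(s(?i := z)) k \<in> ball (q k) \<delta>" if "k \<in> {m<..e}" for k
            using that near z by (cases "k = ?i") auto
          ultimately show ?thesis using Suc.IH by blast
        qed
        have si: "s ?i \<in> ball (p ?i) \<epsilon>" using s i by (auto simp: polydisc_def PiE_def Pi_def)
        have "q ?i \<in> ball (p ?i) \<epsilon> \<inter> ball (q ?i) \<delta>" using q_in \<delta>(1) by simp
        then have ne: "ball (p ?i) \<epsilon> \<inter> ball (q ?i) \<delta> \<noteq> {}" by blast
        have "F (s(?i := s ?i)) = 0"
          by (rule analytic_continuation_open[where f = "\<lambda>z. F (s(?i := z))" and g = "\<lambda>_. 0", OF open_Int[OF open_ball open_ball] open_ball ne connected_ball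
                Int_lower1 hol holomorphic_on_const zero si])
        then show ?thesis by simp
      qed
    qed
  qed
  show ?thesis using claim[of e] s by auto
qed

text \<open>An open-closed argument: \<open>Z\<close> is the largest open set on which
  \<open>h\<close> vanishes, \<open>Y\<close> its exterior in \<open>V\<close>. The identity theorem
  on polydiscs leaves no point between them, so connectedness would make \<open>h\<close> vanish
  identically.\<close>

lemma Cn_holomorphic_nonzero_dense:
  assumes h: "Cn_holomorphic e V h" and con: "connectedin (Cn e) V" and nz: "\<exists>s\<in>V. h s \<noteq> 0"
    and W: "openin (Cn e) W" "W \<subseteq> V" "W \<noteq> {}"
  shows "\<exists>s\<in>W. h s \<noteq> 0"
proof (rule ccontr)
  assume "\<not> (\<exists>s\<in>W. h s \<noteq> 0)"
  then have W0: "\<And>s. s \<in> W \<Longrightarrow> h s = 0" by blast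
  define Z where "Z = \<Union>{B. openin (Cn e) B \<and> B \<subseteq> V \<and> (\<forall>s\<in>B. h s = 0)}"
  define Y where "Y = \<Union>{B. openin (Cn e) B \<and> B \<subseteq> V \<and> B \<inter> Z = {}}"
  have "V \<subseteq> Z \<union> Y"
  proof
    fix p assume p: "p \<in> V"
    obtain \<epsilon> where e: "\<epsilon> > 0" "polydisc e p \<epsilon> \<subseteq> V"
      using polydisc_neighbourhood Cn_holomorphicD(1)[OF h] p by blast
    have pp: "p \<in> polydisc e p \<epsilon>"
      using polydisc_center e(1) p Cn_holomorphicD(3)[OF h] by (auto simp: topspace_Cn)
    show "p \<in> Z \<union> Y"
    proof (cases "polydisc e p \<epsilon> \<inter> Z = {}")
      case True
      then show ?thesis unfolding Y_def by (intro UnI2 UnionI[OF _ pp]) (use e openin_polydisc in auto)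
    next
      case False
      then obtain B where B: "openin (Cn e) B" "\<forall>s\<in>B. h s = 0" "polydisc e p \<epsilon> \<inter> B \<noteq> {}"
        unfolding Z_def by blast
      have "h s = 0" if "s \<in> polydisc e p \<epsilon>" for s
        by (rule Cn_zero_polydisc[OF Cn_holomorphic_subset[OF h openin_polydisc e(2)], of "polydisc e p \<epsilon> \<inter> B"])
          (use B that openin_polydisc in auto)
      then show ?thesis unfolding Z_def by (intro UnI1 UnionI[OF _ pp]) (use e openin_polydisc in auto)
    qed
  qed
  moreover have "openin (Cn e) Z" "openin (Cn e) Y" unfolding Z_def Y_def by auto
  moreover have "Z \<inter> Y \<inter> V = {}" unfolding Y_def by blast
  moreover have "Z \<inter> V \<noteq> {}" using W W0 unfolding Z_def by blast
  ultimately have "Y \<inter> V = {}" using con unfolding connectedin by blast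
  then have "V \<subseteq> Z" using \<open>V \<subseteq> Z \<union> Y\<close> by blast
  then show False using nz unfolding Z_def by blast
qed

text \<open>Locally both functions are quotients. If they agree on an open piece,
  cross-multiplication gives a holomorphic function vanishing there and hence on the whole polydisc,
  so they agree off the zeros of the denominators. Connectedness of the whole space spreads this
  from \<open>R\<close>.\<close>

lemma Cn_meromorphic_identity:
  assumes F: "Cn_meromorphic e F" and G: "Cn_meromorphic e G"
    and R: "openin (Cn e) R" "R \<noteq> {}" "\<And>s. s \<in> R \<Longrightarrow> F s = G s"
  shows "eq_densely e (topspace (Cn e)) F G"
proof -
  \<comment> \<open>Each point gets a polydisc on which agreement on any open piece forces dense
    agreement; hence the set of dense agreement has no boundary.\<close>
  have polydisc_dichotomy: "\<exists>\<epsilon>>0. \<forall>B. openin (Cn e) B \<and> B \<subseteq> polydisc e p \<epsilon> \<and> B \<noteq> {} \<and> (\<forall>s\<in>B. F s = G s) \<longrightarrow>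
      eq_densely e (polydisc e p \<epsilon>) F G" if p: "p \<in> topspace (Cn e)" for p
  proof -
    obtain V1 g1 h1 where 1: "p \<in> V1" "connectedin (Cn e) V1" "Cn_holomorphic e V1 g1"
      "Cn_holomorphic e V1 h1" "\<exists>s\<in>V1. h1 s \<noteq> 0" "\<forall>s\<in>V1. h1 s \<noteq> 0 \<longrightarrow> F s = g1 s / h1 s"
      using bspec[OF F[unfolded Cn_meromorphic_def] p] by (elim exE conjE) (rule that; assumption)
    obtain V2 g2 h2 where 2: "p \<in> V2" "connectedin (Cn e) V2" "Cn_holomorphic e V2 g2"
      "Cn_holomorphic e V2 h2" "\<exists>s\<in>V2. h2 s \<noteq> 0" "\<forall>s\<in>V2. h2 s \<noteq> 0 \<longrightarrow> G s = g2 s / h2 s"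
      using bspec[OF G[unfolded Cn_meromorphic_def] p] by (elim exE conjE) (rule that; assumption)
    have "openin (Cn e) (V1 \<inter> V2)"
      by (intro openin_Int Cn_holomorphicD(1)[OF 1(3)] Cn_holomorphicD(1)[OF 2(3)])
    then obtain \<epsilon> where e: "\<epsilon> > 0" "polydisc e p \<epsilon> \<subseteq> V1 \<inter> V2"
      by (rule polydisc_neighbourhood) (use 1(1) 2(1) in simp)
    then have e1: "polydisc e p \<epsilon> \<subseteq> V1" and e2: "polydisc e p \<epsilon> \<subseteq> V2" by auto
    let ?N = "polydisc e p \<epsilon>"
    have hol: "Cn_holomorphic e ?N g1" "Cn_holomorphic e ?N h1" "Cn_holomorphic e ?N g2" "Cn_holomorphic e ?N h2"
      using Cn_holomorphic_subset[OF _ openin_polydisc e1] Cn_holomorphic_subset[OF _ openin_polydisc e2]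
        1(3,4) 2(3,4) by simp_all
    \<comment> \<open>Density of the non-zeros is applied on the connected \<open>V1\<close> and
      \<open>V2\<close>, where the denominators are known not to vanish identically.\<close>
    have nz: "\<exists>B'. openin (Cn e) B' \<and> B' \<subseteq> B \<and> B' \<noteq> {} \<and> (\<forall>s\<in>B'. h1 s \<noteq> 0 \<and> h2 s \<noteq> 0)"
      if B: "openin (Cn e) B" "B \<subseteq> ?N" "B \<noteq> {}" for B
    proof -
      have o1: "openin (Cn e) {s \<in> B. h1 s \<noteq> 0}" 
        by (rule openin_nonzero[OF B(1) continuous_on_subset[OF Cn_holomorphicD(2)[OF hol(2)] B(2)]])
      have n1: "{s \<in> B. h1 s \<noteq> 0} \<noteq> {}"
        using Cn_holomorphic_nonzero_dense[OF 1(4,2,5) B(1) order_trans[OF B(2) e1] B(3)] by auto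
      have "openin (Cn e) {s \<in> {s \<in> B. h1 s \<noteq> 0}. h2 s \<noteq> 0}"
        by (rule openin_nonzero[OF o1 continuous_on_subset[OF Cn_holomorphicD(2)[OF hol(4)]]]) (use B(2) in auto)
      moreover have "{s \<in> {s \<in> B. h1 s \<noteq> 0}. h2 s \<noteq> 0} \<noteq> {}"
        using Cn_holomorphic_nonzero_dense[OF 2(4,2,5) o1 _ n1] B(2) e2 by auto
      ultimately show ?thesis by (intro exI[of _ "{s \<in> {s \<in> B. h1 s \<noteq> 0}. h2 s \<noteq> 0}"]) auto
    qed
    have "eq_densely e ?N F G"
      if B: "openin (Cn e) B" "B \<subseteq> ?N" "B \<noteq> {}" "\<forall>s\<in>B. F s = G s" for B
    proof -
      obtain B' where B': "openin (Cn e) B'" "B' \<subseteq> B" "B' \<noteq> {}" "\<forall>s\<in>B'. h1 s \<noteq> 0 \<and> h2 s \<noteq> 0"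
        using nz[OF B(1-3)] by blast
      have z: "g1 s * h2 s - g2 s * h1 s = 0" if s: "s \<in> ?N" for s
      proof (rule Cn_zero_polydisc[OF _ B'(1) _ B'(3) _ s])
        show "Cn_holomorphic e ?N (\<lambda>s. g1 s * h2 s - g2 s * h1 s)"
          by (intro Cn_holomorphic_diff Cn_holomorphic_mult hol)
        fix t assume t: "t \<in> B'"
        then have "t \<in> V1" "t \<in> V2" "h1 t \<noteq> 0" "h2 t \<noteq> 0" "F t = G t" using B' B e1 e2 by auto
        then have "g1 t / h1 t = g2 t / h2 t" using 1(6) 2(6) by metis
        then show "g1 t * h2 t - g2 t * h1 t = 0"
          using \<open>h1 t \<noteq> 0\<close> \<open>h2 t \<noteq> 0\<close> by (simp add: field_simps)
      qed (rule order_trans[OF B'(2) B(2)])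
      show ?thesis unfolding eq_densely_def
      proof (intro allI impI, elim conjE)
        fix A assume A: "openin (Cn e) A" "A \<subseteq> ?N" "A \<noteq> {}"
        obtain A' where A': "openin (Cn e) A'" "A' \<subseteq> A" "A' \<noteq> {}" "\<forall>s\<in>A'. h1 s \<noteq> 0 \<and> h2 s \<noteq> 0"
          using nz[OF A(1-3)] by blast
        have "F t = G t" if t: "t \<in> A'" for t
        proof -
          have t': "t \<in> ?N" "t \<in> V1" "t \<in> V2" "h1 t \<noteq> 0" "h2 t \<noteq> 0" using A A' t e1 e2 by auto
          then have "g1 t / h1 t = g2 t / h2 t" using z[of t] by (simp add: field_simps)
          then show ?thesis using 1(6) 2(6) t' by metis
        qed
        then show "\<exists>B'. openin (Cn e) B' \<and> B' \<subseteq> A \<and> B' \<noteq> {} \<and> (\<forall>s\<in>B'. F s = G s)"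
          using A' by blast
      qed
    qed
    then show ?thesis using e(1) by blast
  qed
  define Z where "Z = \<Union>{B. openin (Cn e) B \<and> eq_densely e B F G}"
  define Y where "Y = \<Union>{B. openin (Cn e) B \<and> B \<inter> Z = {}}"
  have cov: "topspace (Cn e) \<subseteq> Z \<union> Y"
  proof
    fix p assume p: "p \<in> topspace (Cn e)"
    obtain \<epsilon> where e: "\<epsilon> > 0" "\<And>B. openin (Cn e) B \<Longrightarrow> B \<subseteq> polydisc e p \<epsilon> \<Longrightarrow> B \<noteq> {} \<Longrightarrow> \<forall>s\<in>B. F s = G s \<Longrightarrow>
      eq_densely e (polydisc e p \<epsilon>) F G"
      using polydisc_dichotomy[OF p] by meson
    have pp: "p \<in> polydisc e p \<epsilon>" using polydisc_center p e(1) by blast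
    show "p \<in> Z \<union> Y"
    proof (cases "polydisc e p \<epsilon> \<inter> Z = {}")
      case True
      then show ?thesis unfolding Y_def by (intro UnI2 UnionI[OF _ pp]) (use openin_polydisc in auto)
    next
      case False
      then obtain B where B: "openin (Cn e) B" "eq_densely e B F G" "polydisc e p \<epsilon> \<inter> B \<noteq> {}"
        unfolding Z_def by blast
      have "openin (Cn e) (polydisc e p \<epsilon> \<inter> B)" using B(1) openin_polydisc by blast
      then obtain B' where B': "openin (Cn e) B'" "B' \<subseteq> polydisc e p \<epsilon> \<inter> B" "B' \<noteq> {}" "\<forall>s\<in>B'. F s = G s"
        using eq_denselyD[OF B(2), of "polydisc e p \<epsilon> \<inter> B"] B(3) by blast
      then have "eq_densely e (polydisc e p \<epsilon>) F G" by (intro e(2)[of B']) auto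
      then show ?thesis unfolding Z_def by (intro UnI1 UnionI[OF _ pp]) (use openin_polydisc in auto)
    qed
  qed
  have "connected_space (euclidean :: complex topology)"
    unfolding connectedin_topspace[symmetric] topspace_euclidean connectedin_iff_connected by (rule connected_UNIV)
  then have "connectedin (Cn e) (topspace (Cn e))"
    unfolding Cn_def connectedin_topspace connected_space_product_topology by simp
  moreover have "openin (Cn e) Z" "openin (Cn e) Y" unfolding Z_def Y_def by auto
  moreover have "Z \<inter> Y \<inter> topspace (Cn e) = {}" unfolding Y_def by blast
  moreover have "eq_densely e R F G" unfolding eq_densely_def using R(3) by blast
  then have "R \<subseteq> Z" using R(1) unfolding Z_def by blast
  then have "Z \<inter> topspace (Cn e) \<noteq> {}" using R(1,2) openin_subset by fastforce
  ultimately have "Y \<inter> topspace (Cn e) = {}" using cov unfolding connectedin by blast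
  then have "topspace (Cn e) \<subseteq> Z" using cov by blast
  then show ?thesis
    by (intro eq_densely_local) (auto simp: Z_def)
qed

section \<open>The continuation as a sum over exponents\<close>

lemma Cn_holomorphic_openin_vimage:
  assumes "Cn_holomorphic e V F" "open T"
  shows "openin (Cn e) {s \<in> V. F s \<in> T}"
proof -
  have "openin (top_of_set V) (V \<inter> F -` T)"
    by (rule continuous_openin_preimage_gen[OF Cn_holomorphicD(2)[OF assms(1)] assms(2)])
  moreover have "V \<inter> F -` T = {s \<in> V. F s \<in> T}" by auto
  ultimately show ?thesis using Cn_holomorphicD(1)[OF assms(1)] openin_trans unfolding Cn_eq by metis
qed

section \<open>Products of binomial series and their majorants\<close>

lemma summable_on_prod_PiE:
  fixes f :: "'a \<Rightarrow> nat \<Rightarrow> real"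
  assumes "finite A" and "\<And>x k. x \<in> A \<Longrightarrow> 0 \<le> f x k" and "\<And>x. x \<in> A \<Longrightarrow> f x summable_on B x"
  shows "(\<lambda>g. \<Prod>x\<in>A. f x (g x)) summable_on PiE A B"
proof -
  have "Infinite_Set_Sum.abs_summable_on (f x) (B x)" if "x \<in> A" for x
    using assms(2,3)[OF that] by (simp add: abs_summable_equivalent[symmetric])
  then have "Infinite_Set_Sum.abs_summable_on (\<lambda>g. \<Prod>x\<in>A. f x (g x)) (PiE A B)"
    by (intro abs_summable_on_prod_PiE assms(1)) auto
  then show ?thesis unfolding abs_summable_equivalent[symmetric] by (rule abs_summable_summable)
qed

text \<open>The coefficients of the binomial series, \<open>(1 - x) powr (- z) = (\<Sum>k. rising z k * x ^ k)\<close>.\<close>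

definition rising :: "'a::{real_normed_field} \<Rightarrow> nat \<Rightarrow> 'a" where
  "rising z k = pochhammer z k / fact k"

lemma norm_pochhammer_le:
  fixes z :: "'a::real_normed_field"
  assumes "norm z \<le> B"
  shows "norm (pochhammer z k) \<le> pochhammer B k"
proof (induction k)
  case (Suc k)
  have "norm (z + of_nat k) \<le> B + of_nat k"
    using norm_triangle_ineq[of z "of_nat k"] assms by simp
  moreover have "0 \<le> pochhammer B k" using Suc by (rule order_trans[OF norm_ge_zero])
  ultimately show ?case using Suc by (simp add: pochhammer_Suc norm_mult mult_mono)
qed simp

text \<open>One real majorant serves all complex parameters in a bounded set, as uniform convergence
  requires.\<close>

lemma norm_rising_le:
  fixes z :: "'a::real_normed_field"
  shows "norm z \<le> B \<Longrightarrow> norm (rising z k) \<le> rising B k"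
  using norm_pochhammer_le[of z B k] by (simp add: rising_def norm_divide divide_right_mono)

lemma rising_nonneg: "0 \<le> B \<Longrightarrow> 0 \<le> rising (B::real) k"
  using order_trans[OF norm_ge_zero norm_rising_le[of B B k]] by simp

text \<open>This is the binomial series of \<open>(1 - x) powr (- B)\<close>; its terms are
  non-negative, so ordinary summability is unconditional.\<close>

lemma summable_on_rising:
  assumes "0 \<le> B" "0 \<le> x" "x < 1"
  shows "(\<lambda>k. rising (B::real) k * x ^ k) summable_on UNIV"
proof -
  have "(\<lambda>n. ((- B) gchoose n) * (- x) ^ n) sums (1 + (- x)) powr (- B)"
    by (rule gen_binomial_real) (use assms in auto)
  moreover have "((- B) gchoose n) * (- x) ^ n = rising B n * x ^ n" for n
  proof -
    have "(- x) ^ n = (- 1) ^ n * x ^ n" by (rule power_minus)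
    then show ?thesis
      by (simp add: gbinomial_pochhammer rising_def mult.assoc[symmetric] power_add[symmetric] flip: mult_2)
  qed
  ultimately have "summable (\<lambda>k. rising B k * x ^ k)" by (simp add: sums_iff)
  then show ?thesis
    by (rule summable_nonneg_imp_summable_on) (use assms rising_nonneg in auto)
qed

lemma has_sum_rising:
  fixes z :: complex and x :: real
  assumes "\<bar>x\<bar> < 1"
  shows "((\<lambda>k. rising z k * of_real x ^ k) has_sum of_real (1 - x) powr (- z)) UNIV"
proof -
  have "(\<lambda>n. ((- z) gchoose n) * (- of_real x) ^ n) sums (1 + (- of_real x)) powr (- z)"
    by (rule gen_binomial_complex) (use assms in auto)
  moreover have "((- z) gchoose n) * (- of_real x) ^ n = rising z n * of_real x ^ n" for n
  proof -
    have "(- complex_of_real x) ^ n = (- 1) ^ n * of_real x ^ n" by (rule power_minus)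
    then show ?thesis
      by (simp add: gbinomial_pochhammer rising_def mult.assoc[symmetric] power_add[symmetric] flip: mult_2)
  qed
  ultimately have s: "(\<lambda>k. rising z k * of_real x ^ k) sums of_real (1 - x) powr (- z)" by simp
  have "(\<lambda>k. norm (rising z k * of_real x ^ k)) summable_on UNIV"
  proof (rule summable_on_comparison_test[OF summable_on_rising[of "norm z" "\<bar>x\<bar>"]])
    fix k show "norm (rising z k * of_real x ^ k) \<le> rising (norm z) k * \<bar>x\<bar> ^ k"
      using norm_rising_le[of z "norm z" k]
      by (simp add: norm_mult norm_power mult_right_mono)
  qed (use assms in auto)
  then have "summable (\<lambda>k. norm (rising z k * of_real x ^ k))" by (rule summable_on_imp_summable)
  then show ?thesis using s by (simp add: norm_summable_imp_has_sum sums_iff)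
qed

lemma Cn_holomorphic_rising:
  assumes "openin (Cn e) V"
  shows "Cn_holomorphic e V (\<lambda>s. rising (s i) k)"
proof -
  have "(\<lambda>z. rising z k) holomorphic_on UNIV"
    unfolding rising_def pochhammer_prod by (intro holomorphic_intros) auto
  from Cn_holomorphic_compose[OF Cn_holomorphic_coord[OF assms] this] show ?thesis by simp
qed

abbreviation exponents :: "nat \<Rightarrow> (nat \<Rightarrow> nat) set" where
  "exponents e \<equiv> PiE {1..e} (\<lambda>_. UNIV)"

text \<open>A tail sum is at least its first exponent. This trades decay in the tail sums for decay
  in the single exponents, so that the multiple sum is dominated by a product of one-variable
  series.\<close>

lemma prod_tail_power_le:
  fixes x :: real and k :: "nat \<Rightarrow> nat"
  assumes "0 \<le> x" "x \<le> 1"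
  shows "(\<Prod>t=1..e. x ^ (\<Sum>i=t..e. k i)) \<le> (\<Prod>t=1..e. x ^ k t)"
proof (intro prod_mono conjI)
  fix t assume t: "t \<in> {1..e}"
  then have "k t \<le> (\<Sum>i=t..e. k i)" by (intro member_le_sum) auto
  then show "x ^ (\<Sum>i=t..e. k i) \<le> x ^ k t" using assms by (intro power_decreasing) auto
qed (use assms in auto)

lemma summable_on_rising_prod:
  assumes "0 \<le> B" "0 \<le> x" "x < 1"
  shows "(\<lambda>k. \<Prod>i=1..e. rising (B::real) (k i) * x ^ k i) summable_on exponents e"
  by (rule summable_on_prod_PiE) (use assms summable_on_rising rising_nonneg in auto)

text \<open>\<open>\<phi> t \<kappa>\<close> stands for the \<open>t\<close>-th factor of a term
  with tail sum \<open>\<kappa>\<close>, be it the quotient in \<open>cont\<close> or its cleared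
  form; the estimate uses only its geometric decay in \<open>\<kappa>\<close>.\<close>

lemma binomial_series_bound:
  fixes \<phi> :: "nat \<Rightarrow> nat \<Rightarrow> complex"
  assumes x: "0 \<le> x" "x < 1"
    and B: "\<And>i. i \<in> {1..e} \<Longrightarrow> norm (s i) \<le> B"
    and M: "\<And>t \<kappa>. t \<in> {1..e} \<Longrightarrow> norm (\<phi> t \<kappa>) \<le> M t * x ^ \<kappa>"
  shows "norm ((\<Prod>i=1..e. rising (s i :: complex) (k i)) * (\<Prod>t=1..e. \<phi> t (\<Sum>i=t..e. k i)))
      \<le> (\<Prod>t=1..e. max (M t) 0) * (\<Prod>i=1..e. rising (max B 0) (k i) * x ^ k i)"
proof -
  \<comment> \<open>Truncation at 0 makes the constants non-negative, as monotonicity of products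
    demands.\<close>
  let ?B = "max B 0" and ?M = "\<lambda>t. max (M t) 0"
  have "norm (\<Prod>i=1..e. rising (s i) (k i)) \<le> (\<Prod>i=1..e. rising ?B (k i))"
    unfolding prod_norm[symmetric]
    by (intro prod_mono conjI norm_ge_zero norm_rising_le) (use B in fastforce)
  moreover have "norm (\<Prod>t=1..e. \<phi> t (\<Sum>i=t..e. k i)) \<le> (\<Prod>t=1..e. ?M t * x ^ (\<Sum>i=t..e. k i))"
    unfolding prod_norm[symmetric]
  proof (intro prod_mono conjI norm_ge_zero)
    fix t assume t: "t \<in> {1..e}"
    have "M t * x ^ (\<Sum>i=t..e. k i) \<le> ?M t * x ^ (\<Sum>i=t..e. k i)"
      using x by (intro mult_right_mono) auto
    then show "norm (\<phi> t (\<Sum>i=t..e. k i)) \<le> ?M t * x ^ (\<Sum>i=t..e. k i)"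
      using M[OF t] by (rule order_trans[rotated])
  qed
  moreover have "(\<Prod>t=1..e. ?M t * x ^ (\<Sum>i=t..e. k i)) \<le> (\<Prod>t=1..e. ?M t) * (\<Prod>t=1..e. x ^ k t)"
    unfolding prod.distrib using prod_tail_power_le[of x k e] x by (intro mult_left_mono prod_nonneg) auto
  ultimately have "norm (\<Prod>i=1..e. rising (s i) (k i)) * norm (\<Prod>t=1..e. \<phi> t (\<Sum>i=t..e. k i))
      \<le> (\<Prod>i=1..e. rising ?B (k i)) * ((\<Prod>t=1..e. ?M t) * (\<Prod>t=1..e. x ^ k t))"
    by (intro mult_mono) (auto intro!: prod_nonneg rising_nonneg)
  then show ?thesis by (simp add: norm_mult prod.distrib mult_ac)
qed

lemma summable_on_binomial_bound:
  assumes "0 \<le> x" "x < 1"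
  shows "(\<lambda>k. C * (\<Prod>i=1..e. rising (max B 0 :: real) (k i) * x ^ k i)) summable_on exponents e"
  by (intro summable_on_cmult_right summable_on_rising_prod) (use assms in auto)

lemma summable_on_binomial_series:
  fixes \<phi> :: "nat \<Rightarrow> nat \<Rightarrow> complex"
  assumes x: "0 \<le> x" "x < 1"
    and M: "\<And>t \<kappa>. t \<in> {1..e} \<Longrightarrow> norm (\<phi> t \<kappa>) \<le> M t * x ^ \<kappa>"
  shows "(\<lambda>k. (\<Prod>i=1..e. rising (s i :: complex) (k i)) * (\<Prod>t=1..e. \<phi> t (\<Sum>i=t..e. k i)))
           summable_on exponents e"
proof (rule abs_summable_summable, rule summable_on_comparison_test[OF summable_on_binomial_bound[OF x]])
  fix k
  show "norm ((\<Prod>i=1..e. rising (s i) (k i)) * (\<Prod>t=1..e. \<phi> t (\<Sum>i=t..e. k i)))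
      \<le> (\<Prod>t=1..e. max (M t) 0) * (\<Prod>i=1..e. rising (max (\<Sum>i=1..e. norm (s i)) 0) (k i) * x ^ k i)"
    by (rule binomial_series_bound[OF x _ M]) (auto intro!: member_le_sum)
qed simp

lemma Cn_holomorphic_binomial_series:
  fixes \<phi> :: "nat \<Rightarrow> nat \<Rightarrow> (nat \<Rightarrow> complex) \<Rightarrow> complex"
  assumes V: "openin (Cn e) V" and x: "0 \<le> x" "x < 1"
    and B: "\<And>s i. s \<in> V \<Longrightarrow> i \<in> {1..e} \<Longrightarrow> norm (s i) \<le> B"
    and hol: "\<And>t \<kappa>. t \<in> {1..e} \<Longrightarrow> Cn_holomorphic e V (\<phi> t \<kappa>)"
    and M: "\<And>t \<kappa> s. t \<in> {1..e} \<Longrightarrow> s \<in> V \<Longrightarrow> norm (\<phi> t \<kappa> s) \<le> M t * x ^ \<kappa>"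
  shows "Cn_holomorphic e V (\<lambda>s. \<Sum>\<^sub>\<infinity>k\<in>exponents e.
           (\<Prod>i=1..e. rising (s i) (k i)) * (\<Prod>t=1..e. \<phi> t (\<Sum>i=t..e. k i) s))"
proof (rule Cn_holomorphic_infsum[OF V _ _ summable_on_binomial_bound[OF x]])
  fix k assume "k \<in> exponents e"
  show "Cn_holomorphic e V (\<lambda>s. (\<Prod>i=1..e. rising (s i) (k i)) * (\<Prod>t=1..e. \<phi> t (\<Sum>i=t..e. k i) s))"
    by (intro Cn_holomorphic_mult Cn_holomorphic_prod V hol Cn_holomorphic_rising)
  fix s assume s: "s \<in> V"
  show "norm ((\<Prod>i=1..e. rising (s i) (k i)) * (\<Prod>t=1..e. \<phi> t (\<Sum>i=t..e. k i) s))
      \<le> (\<Prod>t=1..e. max (M t) 0) * (\<Prod>i=1..e. rising (max B 0) (k i) * x ^ k i)"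
    by (rule binomial_series_bound[OF x B[OF s] M[OF _ s]])
qed

text \<open>In the application \<open>u i\<close> is the character value \<open>f i 1\<close>. The
  continuation is studied by itself; the series enters in \<open>lucas_series\<close>.\<close>

locale lucas_continuation =
  fixes \<alpha> r D :: real and u :: "nat \<Rightarrow> complex"
  assumes alpha: "\<alpha> > 1" and r: "r \<noteq> 0" "\<bar>r\<bar> < 1" and D: "D > 0"
begin

text \<open>
  Here \<open>r\<close> stands for \<open>\<beta> / \<alpha>\<close>, so that \<open>Q = \<alpha>\<^sup>2 * r\<close>. Cancelling \<open>\<alpha> ^ (2 * \<kappa>)\<close> turns the factor
  \<open>g t * Q ^ \<kappa> / (\<alpha> powr (s t + \<dots> + s e + 2 * \<kappa>) - g t * Q ^ \<kappa>)\<close> into \<open>q e t \<kappa> / (E e s t - q e t \<kappa>)\<close>.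
\<close>

definition E :: "nat \<Rightarrow> (nat \<Rightarrow> complex) \<Rightarrow> nat \<Rightarrow> complex" where
  "E e s t = exp (of_real (ln \<alpha>) * (\<Sum>i=t..e. s i))"

definition q :: "nat \<Rightarrow> nat \<Rightarrow> nat \<Rightarrow> complex" where
  "q e t \<kappa> = (\<Prod>i=t..e. u i) * of_real r ^ \<kappa>"

text \<open>The denominator \<open>sqrt D\<close> of \<open>U n\<close> contributes
  \<open>D powr (s i / 2)\<close> for each \<open>i\<close>, independently of the summation
  variables.\<close>

definition Dpow :: "nat \<Rightarrow> (nat \<Rightarrow> complex) \<Rightarrow> complex" where
  "Dpow e s = exp (of_real (ln D) * (\<Sum>i=1..e. s i) / 2)"

definition cont :: "nat \<Rightarrow> (nat \<Rightarrow> complex) \<Rightarrow> complex" where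
  "cont e s = Dpow e s * (\<Sum>\<^sub>\<infinity>k\<in>exponents e. (\<Prod>i=1..e. rising (s i) (k i)) *
     (\<Prod>t=1..e. q e t (\<Sum>i=t..e. k i) / (E e s t - q e t (\<Sum>i=t..e. k i))))"

definition regular_points :: "nat \<Rightarrow> (nat \<Rightarrow> complex) set" where
  "regular_points e = {s \<in> topspace (Cn e). \<forall>t\<in>{1..e}. \<forall>\<kappa>. E e s t \<noteq> q e t \<kappa>}"

lemma ln_alpha: "ln \<alpha> > 0" using alpha by simp

lemma E_nonzero: "E e s t \<noteq> 0" by (simp add: E_def)

lemma Cn_holomorphic_E: "openin (Cn e) V \<Longrightarrow> Cn_holomorphic e V (\<lambda>s. E e s t)"
  unfolding E_def
  by (rule Cn_holomorphic_compose[where g = exp and U = UNIV])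
    (auto intro!: Cn_holomorphic_mult Cn_holomorphic_const Cn_holomorphic_sum Cn_holomorphic_coord holomorphic_intros)

lemma Cn_holomorphic_Dpow: "openin (Cn e) V \<Longrightarrow> Cn_holomorphic e V (\<lambda>s. Dpow e s)"
  unfolding Dpow_def
  by (rule Cn_holomorphic_compose[where g = exp and U = UNIV])
    (auto intro!: Cn_holomorphic_mult Cn_holomorphic_divide Cn_holomorphic_const Cn_holomorphic_sum
       Cn_holomorphic_coord holomorphic_intros)

text \<open>As \<open>q e t \<kappa>\<close> tends to 0, all but finitely many values keep distance
  \<open>norm w / 2\<close> from \<open>w\<close>, and the remaining ones different from
  \<open>w\<close> have a least distance. The factor 2 leaves room to move \<open>w\<close> by
  \<open>\<delta>\<close>.\<close>

lemma q_gap: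
  assumes "w \<noteq> 0"
  obtains \<delta> where "\<delta> > 0" "\<And>\<kappa>. q e t \<kappa> \<noteq> w \<Longrightarrow> norm (w - q e t \<kappa>) \<ge> 2 * \<delta>"
proof -
  have "(\<lambda>\<kappa>. q e t \<kappa>) \<longlonglongrightarrow> (\<Prod>i=t..e. u i) * 0"
    unfolding q_def by (intro tendsto_mult tendsto_const LIMSEQ_power_zero) (use r in auto)
  then have "\<forall>\<^sub>F \<kappa> in sequentially. norm (q e t \<kappa>) < norm w / 2"
    using assms by (auto simp: tendsto_iff dest!: spec[of _ "norm w / 2"])
  then obtain N where N: "\<And>\<kappa>. \<kappa> \<ge> N \<Longrightarrow> norm (q e t \<kappa>) < norm w / 2"
    by (auto simp: eventually_sequentially)
  define S where "S = insert (norm w / 2) ((\<lambda>\<kappa>. norm (w - q e t \<kappa>)) ` {\<kappa>. \<kappa> < N \<and> q e t \<kappa> \<noteq> w})"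
  have fin: "finite S" "S \<noteq> {}" by (auto simp: S_def)
  have "Min S > 0" using fin assms by (subst Min_gr_iff) (auto simp: S_def)
  moreover have "norm (w - q e t \<kappa>) \<ge> Min S" if "q e t \<kappa> \<noteq> w" for \<kappa>
  proof (cases "\<kappa> < N")
    case True
    then show ?thesis using fin that by (intro Min_le) (auto simp: S_def)
  next
    case False
    have "Min S \<le> norm w / 2" using fin by (intro Min_le) (auto simp: S_def)
    moreover have "norm w - norm (q e t \<kappa>) \<le> norm (w - q e t \<kappa>)" by (rule norm_triangle_ineq2)
    ultimately show ?thesis using N[of \<kappa>] False by simp
  qed
  ultimately show ?thesis using that[of "Min S / 2"] by simp
qed

text \<open>Near a point \<open>p\<close> the \<open>t\<close>-th factor of the terms has at most one pole, the one with \<open>q e t \<kappa> = E e p t\<close>;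
  \<open>clear_factor e p t\<close> cancels it.\<close>

definition clear_factor :: "nat \<Rightarrow> (nat \<Rightarrow> complex) \<Rightarrow> nat \<Rightarrow> (nat \<Rightarrow> complex) \<Rightarrow> complex" where
  "clear_factor e p t s = (if \<exists>\<kappa>. q e t \<kappa> = E e p t then E e s t - E e p t else 1)"

text \<open>In the singular case the cancelled quotient is written out as a constant, which is the
  right value on the polar set too; division by 0 would give 0 there.\<close>

definition cleared :: "nat \<Rightarrow> (nat \<Rightarrow> complex) \<Rightarrow> nat \<Rightarrow> nat \<Rightarrow> (nat \<Rightarrow> complex) \<Rightarrow> complex" where
  "cleared e p t \<kappa> s =
     (if q e t \<kappa> = E e p t then q e t \<kappa> else q e t \<kappa> / (E e s t - q e t \<kappa>) * clear_factor e p t s)"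

definition numerator :: "nat \<Rightarrow> (nat \<Rightarrow> complex) \<Rightarrow> (nat \<Rightarrow> complex) \<Rightarrow> complex" where
  "numerator e p s = Dpow e s * (\<Sum>\<^sub>\<infinity>k\<in>exponents e. (\<Prod>i=1..e. rising (s i) (k i)) *
     (\<Prod>t=1..e. cleared e p t (\<Sum>i=t..e. k i) s))"

lemma cleared_eq:
  assumes "clear_factor e p t s \<noteq> 0"
  shows "q e t \<kappa> / (E e s t - q e t \<kappa>) * clear_factor e p t s = cleared e p t \<kappa> s"
proof (cases "q e t \<kappa> = E e p t")
  case True
  then have "clear_factor e p t s = E e s t - q e t \<kappa>" by (auto simp: clear_factor_def)
  then show ?thesis using True assms by (simp add: cleared_def)
qed (simp add: cleared_def)

text \<open>The clearing factors do not depend on \<open>k\<close>, so their product moves into the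
  sum and meets each quotient there.\<close>

lemma cont_eq_numerator:
  assumes "\<And>t. t \<in> {1..e} \<Longrightarrow> clear_factor e p t s \<noteq> 0"
  shows "cont e s = numerator e p s / (\<Prod>t=1..e. clear_factor e p t s)"
proof -
  let ?h = "\<Prod>t=1..e. clear_factor e p t s"
  have h: "?h \<noteq> 0" using assms by simp
  have "cont e s * ?h = Dpow e s * (\<Sum>\<^sub>\<infinity>k\<in>exponents e. (\<Prod>i=1..e. rising (s i) (k i)) *
     (\<Prod>t=1..e. q e t (\<Sum>i=t..e. k i) / (E e s t - q e t (\<Sum>i=t..e. k i))) * ?h)"
    unfolding cont_def by (simp only: mult.assoc infsum_cmult_left'[symmetric])
  also have "\<dots> = numerator e p s"
  proof -
    have "(\<Prod>t=1..e. q e t (\<Sum>i=t..e. k i) / (E e s t - q e t (\<Sum>i=t..e. k i))) * ?h =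
        (\<Prod>t=1..e. cleared e p t (\<Sum>i=t..e. k i) s)" for k
      unfolding prod.distrib[symmetric] by (intro prod.cong refl cleared_eq assms)
    then show ?thesis unfolding numerator_def mult.assoc by simp
  qed
  finally show ?thesis using h by (simp add: field_simps)
qed

lemma cleared_bound:
  assumes p: "p \<in> topspace (Cn e)"
  obtains U M where "openin (Cn e) U" "p \<in> U"
    "\<And>\<kappa> s. s \<in> U \<Longrightarrow> q e t \<kappa> \<noteq> E e p t \<Longrightarrow> E e s t \<noteq> q e t \<kappa>"
    "\<And>\<kappa> s. s \<in> U \<Longrightarrow> norm (cleared e p t \<kappa> s) \<le> M * \<bar>r\<bar> ^ \<kappa>"
proof -
  obtain \<delta> where d: "\<delta> > 0" "\<And>\<kappa>. q e t \<kappa> \<noteq> E e p t \<Longrightarrow> norm (E e p t - q e t \<kappa>) \<ge> 2 * \<delta>"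
    using q_gap[OF E_nonzero] by blast
  define U where "U = {s \<in> topspace (Cn e). E e s t \<in> ball (E e p t) \<delta>}"
  define c where "c = norm (\<Prod>i=t..e. u i)"
  have gap: "norm (E e s t - q e t \<kappa>) \<ge> \<delta>" if "s \<in> U" "q e t \<kappa> \<noteq> E e p t" for s \<kappa>
  proof -
    have "dist (E e p t) (q e t \<kappa>) \<le> dist (E e p t) (E e s t) + dist (E e s t) (q e t \<kappa>)"
      by (rule dist_triangle)
    moreover have "dist (E e p t) (q e t \<kappa>) \<ge> 2 * \<delta>" using d(2)[OF that(2)] by (simp add: dist_norm)
    moreover have "dist (E e p t) (E e s t) < \<delta>" using that(1) by (simp add: U_def)
    ultimately show ?thesis unfolding dist_norm by linarith
  qed
  show ?thesis
  proof
    show "openin (Cn e) U"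
      unfolding U_def by (intro Cn_holomorphic_openin_vimage Cn_holomorphic_E) auto
    show "p \<in> U" using p d(1) by (simp add: U_def)
    show "E e s t \<noteq> q e t \<kappa>" if "s \<in> U" "q e t \<kappa> \<noteq> E e p t" for \<kappa> s
      using gap[OF that] d(1) by auto
    \<comment> \<open>The summand \<open>c\<close> covers the singular \<open>\<kappa>\<close>.
      Otherwise the denominator is at least \<open>\<delta>\<close> in norm, and the clearing factor
      is at most \<open>1 + \<delta>\<close>, being 1 or of norm below
      \<open>\<delta>\<close>.\<close>
    show "norm (cleared e p t \<kappa> s) \<le> (c + c / \<delta> * (1 + \<delta>)) * \<bar>r\<bar> ^ \<kappa>" if s: "s \<in> U" for \<kappa> s
    proof -
      have c0: "0 \<le> c" by (simp add: c_def)
      have nq: "norm (q e t \<kappa>) = c * \<bar>r\<bar> ^ \<kappa>" by (simp add: q_def c_def norm_mult norm_power)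
      show ?thesis
      proof (cases "q e t \<kappa> = E e p t")
        case True
        have "c * \<bar>r\<bar> ^ \<kappa> \<le> (c + c / \<delta> * (1 + \<delta>)) * \<bar>r\<bar> ^ \<kappa>"
          using c0 d(1) by (intro mult_right_mono) auto
        then show ?thesis using True nq by (simp add: cleared_def)
      next
        case False
        have "dist (E e s t) (E e p t) < \<delta>" using s by (simp add: U_def dist_commute)
        then have cf: "norm (clear_factor e p t s) \<le> 1 + \<delta>"
          using d(1) by (simp add: clear_factor_def dist_norm)
        have "norm (q e t \<kappa> / (E e s t - q e t \<kappa>)) \<le> c * \<bar>r\<bar> ^ \<kappa> / \<delta>"
          unfolding norm_divide nq using gap[OF s False] d(1) c0
          by (intro divide_left_mono mult_pos_pos mult_nonneg_nonneg) auto
        then have "norm (q e t \<kappa> / (E e s t - q e t \<kappa>)) * norm (clear_factor e p t s)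
            \<le> c * \<bar>r\<bar> ^ \<kappa> / \<delta> * (1 + \<delta>)"
          using cf d(1) c0 by (intro mult_mono) auto
        then have "norm (cleared e p t \<kappa> s) \<le> c * \<bar>r\<bar> ^ \<kappa> / \<delta> * (1 + \<delta>)"
          using False by (simp only: cleared_def if_False norm_mult)
        also have "\<dots> = c / \<delta> * (1 + \<delta>) * \<bar>r\<bar> ^ \<kappa>" by simp
        also have "\<dots> \<le> (c + c / \<delta> * (1 + \<delta>)) * \<bar>r\<bar> ^ \<kappa>" using c0 by (intro mult_right_mono) auto
        finally show ?thesis .
      qed
    qed
  qed
qed

lemma Cn_holomorphic_clear_factor: "openin (Cn e) V \<Longrightarrow> Cn_holomorphic e V (clear_factor e p t)"
  unfolding clear_factor_def
  by (cases "\<exists>\<kappa>. q e t \<kappa> = E e p t")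
    (auto intro!: Cn_holomorphic_diff Cn_holomorphic_E Cn_holomorphic_const)

text \<open>The neighbourhoods from \<open>cleared_bound\<close> for the finitely many
  \<open>t\<close> contain a common polydisc. Its coordinates are bounded, so one majorant controls
  all terms. By the last conclusion only poles through \<open>p\<close> can be met in it.\<close>

lemma local_quotient:
  assumes p: "p \<in> topspace (Cn e)"
  obtains \<epsilon> where "\<epsilon> > 0" "Cn_holomorphic e (polydisc e p \<epsilon>) (numerator e p)"
    "\<And>t \<kappa> s. t \<in> {1..e} \<Longrightarrow> s \<in> polydisc e p \<epsilon> \<Longrightarrow> q e t \<kappa> \<noteq> E e p t \<Longrightarrow> E e s t \<noteq> q e t \<kappa>"
proof -
  have "\<exists>U M. openin (Cn e) U \<and> p \<in> U \<and> (\<forall>\<kappa> s. s \<in> U \<longrightarrow> q e t \<kappa> \<noteq> E e p t \<longrightarrow> E e s t \<noteq> q e t \<kappa>) \<and>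
      (\<forall>\<kappa> s. s \<in> U \<longrightarrow> norm (cleared e p t \<kappa> s) \<le> M * \<bar>r\<bar> ^ \<kappa>)" for t
    by (rule cleared_bound[OF p, of t]) blast
  then obtain U M where U: "\<And>t. openin (Cn e) (U t)" "\<And>t. p \<in> U t"
      "\<And>t \<kappa> s. s \<in> U t \<Longrightarrow> q e t \<kappa> \<noteq> E e p t \<Longrightarrow> E e s t \<noteq> q e t \<kappa>"
      "\<And>t \<kappa> s. s \<in> U t \<Longrightarrow> norm (cleared e p t \<kappa> s) \<le> M t * \<bar>r\<bar> ^ \<kappa>"
    by metis
  have "openin (Cn e) ((\<Inter>t\<in>{1..e}. U t) \<inter> topspace (Cn e))" by (rule openin_INT) (use U in auto)
  then obtain \<epsilon>0 where e0: "\<epsilon>0 > 0" "polydisc e p \<epsilon>0 \<subseteq> (\<Inter>t\<in>{1..e}. U t) \<inter> topspace (Cn e)"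
    by (rule polydisc_neighbourhood) (use U p in auto)
  let ?V = "polydisc e p \<epsilon>0"
  have VU: "?V \<subseteq> U t" if "t \<in> {1..e}" for t using e0 that by blast
  have "Cn_holomorphic e ?V (\<lambda>s. \<Sum>\<^sub>\<infinity>k\<in>exponents e.
           (\<Prod>i=1..e. rising (s i) (k i)) * (\<Prod>t=1..e. cleared e p t (\<Sum>i=t..e. k i) s))"
  proof (rule Cn_holomorphic_binomial_series[OF openin_polydisc, where x = "\<bar>r\<bar>" and M = M and
        B = "(\<Sum>i=1..e. norm (p i)) + \<epsilon>0"])
    fix s i assume "s \<in> ?V" and i: "i \<in> {1..e}"
    then have "dist (p i) (s i) < \<epsilon>0" by (auto simp: polydisc_def PiE_def Pi_def)
    moreover have "norm (s i) \<le> norm (p i) + dist (p i) (s i)"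
      using norm_triangle_sub[of "s i" "p i"] by (simp add: dist_norm norm_minus_commute)
    moreover have "norm (p i) \<le> (\<Sum>i=1..e. norm (p i))" using i by (intro member_le_sum) auto
    ultimately show "norm (s i) \<le> (\<Sum>i=1..e. norm (p i)) + \<epsilon>0" by linarith
  next
    fix t \<kappa> assume t: "t \<in> {1..e}"
    show "Cn_holomorphic e ?V (cleared e p t \<kappa>)"
    proof (cases "q e t \<kappa> = E e p t")
      case True
      then show ?thesis by (simp add: cleared_def[abs_def] Cn_holomorphic_const openin_polydisc)
    next
      case False
      then have "Cn_holomorphic e ?V (\<lambda>s. q e t \<kappa> / (E e s t - q e t \<kappa>) * clear_factor e p t s)"
        using U(3)[OF subsetD[OF VU[OF t]] False]
        by (intro Cn_holomorphic_mult Cn_holomorphic_divide Cn_holomorphic_diff Cn_holomorphic_const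
            Cn_holomorphic_E Cn_holomorphic_clear_factor openin_polydisc) auto
      then show ?thesis using False by (simp add: cleared_def[abs_def])
    qed
    fix s assume "s \<in> ?V"
    then show "norm (cleared e p t \<kappa> s) \<le> M t * \<bar>r\<bar> ^ \<kappa>" using U(4) VU[OF t] by blast
  qed (use r in auto)
  then have "Cn_holomorphic e ?V (numerator e p)"
    unfolding numerator_def[abs_def] by (intro Cn_holomorphic_mult Cn_holomorphic_Dpow openin_polydisc)
  then show ?thesis
    by (rule that[OF e0(1)]) (use U(3) VU in blast)
qed

end

text \<open>A real parameter suffices: moving along \<open>v\<close> multiplies each
  \<open>E\<close> by a positive real number, and absolute values are enough to tell when a pole is
  left.\<close>

definition line :: "nat \<Rightarrow> (nat \<Rightarrow> complex) \<Rightarrow> (nat \<Rightarrow> real) \<Rightarrow> real \<Rightarrow> nat \<Rightarrow> complex" where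
  "line e p v x = (\<lambda>i\<in>{1..e}. p i + of_real (x * v i))"

lemma line_in_polydisc:
  assumes "\<And>i. \<bar>v i\<bar> \<le> 1" "\<bar>x\<bar> < \<epsilon>"
  shows "line e p v x \<in> polydisc e p \<epsilon>"
proof -
  have "dist (p i) (p i + of_real (x * v i)) < \<epsilon>" for i
  proof -
    have "\<bar>x\<bar> * \<bar>v i\<bar> \<le> \<bar>x\<bar> * 1" using assms(1) by (intro mult_left_mono) auto
    then show ?thesis using assms(2) by (simp add: dist_norm norm_mult del: of_real_mult flip: abs_mult)
  qed
  then show ?thesis by (auto simp: line_def polydisc_def)
qed

lemma small_outside_countable:
  fixes \<epsilon> :: real
  assumes "countable S" "\<epsilon> > 0"
  shows "\<exists>x\<in>{0<..<\<epsilon>}. x \<notin> S"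
proof -
  have "uncountable {0<..<\<epsilon>}" using assms(2) by (simp add: uncountable_open_interval)
  then have "{0<..<\<epsilon>} - S \<noteq> {}" using assms(1) uncountable_minus_countable[of "{0<..<\<epsilon>}" S] by force
  then show ?thesis by blast
qed

section \<open>Density of the regular points and meromorphy of the continuation\<close>

context lucas_continuation
begin

lemma E_line:
  assumes "1 \<le> t"
  shows "E e (line e p v x) t = E e p t * of_real (exp (ln \<alpha> * x * (\<Sum>i=t..e. v i)))"
proof -
  have "(\<Sum>i=t..e. line e p v x i) = (\<Sum>i=t..e. p i + of_real (x * v i))"
    using assms by (intro sum.cong) (auto simp: line_def)
  then show ?thesis
    unfolding E_def exp_of_real[symmetric] exp_add[symmetric]
    by (simp add: sum.distrib algebra_simps sum_distrib_left)
qed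

text \<open>Absolute values in the equation determine \<open>x\<close> from the pair
  \<open>(t, \<kappa>)\<close>, and there are countably many pairs. \<open>T\<close> is kept general
  because motion inside the hyperplane cannot leave the \<open>j\<close>-th pole.\<close>

lemma countable_poles_on_line:
  assumes "T \<subseteq> {1..e}" and "\<And>t. t \<in> T \<Longrightarrow> (\<Sum>i=t..e. v i) \<noteq> 0"
  shows "countable {x. \<exists>t\<in>T. \<exists>\<kappa>. E e (line e p v x) t = q e t \<kappa>}"
proof (rule countable_subset)
  let ?f = "\<lambda>(t, \<kappa>). ln (norm (q e t \<kappa>) / norm (E e p t)) / (ln \<alpha> * (\<Sum>i=t..e. v i))"
  show "{x. \<exists>t\<in>T. \<exists>\<kappa>. E e (line e p v x) t = q e t \<kappa>} \<subseteq> ?f ` UNIV"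
  proof (clarify)
    fix x t \<kappa> assume t: "t \<in> T" and eq: "E e (line e p v x) t = q e t \<kappa>"
    have "norm (q e t \<kappa>) = norm (E e p t) * exp (ln \<alpha> * x * (\<Sum>i=t..e. v i))"
      unfolding eq[symmetric] using t assms(1) by (subst E_line) (auto simp: norm_mult)
    then have "ln (norm (q e t \<kappa>) / norm (E e p t)) = ln \<alpha> * x * (\<Sum>i=t..e. v i)"
      using E_nonzero[of e p t] by simp
    then have "x = ?f (t, \<kappa>)" using assms(2)[OF t] ln_alpha by simp
    then show "x \<in> ?f ` UNIV" by (rule image_eqI[OF _ UNIV_I])
  qed
qed auto

lemma regular_points_dense:
  assumes "openin (Cn e) B" "p \<in> B"
  shows "\<exists>s\<in>B. s \<in> regular_points e"
proof -
  obtain \<epsilon> where e: "\<epsilon> > 0" "polydisc e p \<epsilon> \<subseteq> B" using polydisc_neighbourhood[OF assms] .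
  \<comment> \<open>The last coordinate enters every sum \<open>s t + ... + s e\<close>, so this one
    direction leaves all poles at once.\<close>
  define v where "v i = (if i = e then 1 else 0 :: real)" for i
  have "countable {x. \<exists>t\<in>{1..e}. \<exists>\<kappa>. E e (line e p v x) t = q e t \<kappa>}"
    by (rule countable_poles_on_line) (auto simp: v_def)
  then obtain x where x: "x \<in> {0<..<\<epsilon>}" "\<not> (\<exists>t\<in>{1..e}. \<exists>\<kappa>. E e (line e p v x) t = q e t \<kappa>)"
    using small_outside_countable[OF _ e(1)] by blast
  have "line e p v x \<in> polydisc e p \<epsilon>" using x(1) by (intro line_in_polydisc) (auto simp: v_def)
  moreover from this have "line e p v x \<in> topspace (Cn e)" using polydisc_subset_topspace by blast
  ultimately show ?thesis using x(2) e(2) by (intro bexI[of _ "line e p v x"]) (auto simp: regular_points_def)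
qed

text \<open>At a regular point every clearing factor is the constant 1, so
  \<open>numerator e p\<close> is \<open>cont e\<close> itself.\<close>

lemma regular_neighbourhood:
  assumes p: "p \<in> regular_points e"
  obtains \<epsilon> where "\<epsilon> > 0" "polydisc e p \<epsilon> \<subseteq> regular_points e" "Cn_holomorphic e (polydisc e p \<epsilon>) (cont e)"
proof -
  have pt: "p \<in> topspace (Cn e)" using p by (simp add: regular_points_def)
  have ne: "q e t \<kappa> \<noteq> E e p t" if "t \<in> {1..e}" for t \<kappa>
  proof -
    have "E e p t \<noteq> q e t \<kappa>" using p that unfolding regular_points_def by blast
    then show ?thesis by metis
  qed
  obtain \<epsilon> where e: "\<epsilon> > 0" "Cn_holomorphic e (polydisc e p \<epsilon>) (numerator e p)"
    "\<And>t \<kappa> s. t \<in> {1..e} \<Longrightarrow> s \<in> polydisc e p \<epsilon> \<Longrightarrow> q e t \<kappa> \<noteq> E e p t \<Longrightarrow> E e s t \<noteq> q e t \<kappa>"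
    by (rule local_quotient[OF pt]) auto
  have cf: "clear_factor e p t s = 1" if "t \<in> {1..e}" for t s
    using ne[OF that] by (auto simp: clear_factor_def)
  have "numerator e p s = cont e s" for s
    by (subst cont_eq_numerator[of _ p]) (use cf in auto)
  then have "Cn_holomorphic e (polydisc e p \<epsilon>) (cont e)" using Cn_holomorphic_cong[OF e(2)] by blast
  moreover have "polydisc e p \<epsilon> \<subseteq> regular_points e"
  proof
    fix s assume s: "s \<in> polydisc e p \<epsilon>"
    then have "s \<in> topspace (Cn e)" using polydisc_subset_topspace by blast
    then show "s \<in> regular_points e" unfolding regular_points_def using e(3)[OF _ s ne] by blast
  qed
  ultimately show ?thesis using that e(1) by blast
qed

lemma summable_on_cont:
  assumes p: "p \<in> regular_points e"
  shows "(\<lambda>k. (\<Prod>i=1..e. rising (p i) (k i)) *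
     (\<Prod>t=1..e. q e t (\<Sum>i=t..e. k i) / (E e p t - q e t (\<Sum>i=t..e. k i)))) summable_on exponents e"
proof -
  have pt: "p \<in> topspace (Cn e)" using p by (simp add: regular_points_def)
  have "\<exists>M. \<forall>\<kappa>. norm (cleared e p t \<kappa> p) \<le> M * \<bar>r\<bar> ^ \<kappa>" for t
    by (rule cleared_bound[OF pt, of t]) blast
  then obtain M where M: "\<And>t \<kappa>. norm (cleared e p t \<kappa> p) \<le> M t * \<bar>r\<bar> ^ \<kappa>" by metis
  have "cleared e p t \<kappa> p = q e t \<kappa> / (E e p t - q e t \<kappa>)" if "t \<in> {1..e}" for t \<kappa>
  proof -
    have "E e p t \<noteq> q e t \<kappa>" for \<kappa> using p that unfolding regular_points_def by blast
    then have "q e t \<kappa> \<noteq> E e p t" for \<kappa> by metis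
    then show ?thesis by (simp add: cleared_def clear_factor_def)
  qed
  then have "norm (q e t \<kappa> / (E e p t - q e t \<kappa>)) \<le> M t * \<bar>r\<bar> ^ \<kappa>" if "t \<in> {1..e}" for t \<kappa>
    using M[of t \<kappa>] that by simp
  then show ?thesis using r by (intro summable_on_binomial_series[of "\<bar>r\<bar>"]) auto
qed

lemma openin_regular_points: "openin (Cn e) (regular_points e)"
proof (subst openin_subopen, intro ballI)
  fix p assume p: "p \<in> regular_points e"
  then have pt: "p \<in> topspace (Cn e)" by (simp add: regular_points_def)
  obtain \<epsilon> where "\<epsilon> > 0" "polydisc e p \<epsilon> \<subseteq> regular_points e" by (rule regular_neighbourhood[OF p])
  then show "\<exists>T. openin (Cn e) T \<and> p \<in> T \<and> T \<subseteq> regular_points e"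
    by (intro exI[of _ "polydisc e p \<epsilon>"] conjI openin_polydisc polydisc_center[OF pt])
qed

lemma Cn_meromorphic_cont: "Cn_meromorphic e (cont e)"
  unfolding Cn_meromorphic_def
proof
  fix p assume p: "p \<in> topspace (Cn e)"
  obtain \<epsilon> where e: "\<epsilon> > 0" "Cn_holomorphic e (polydisc e p \<epsilon>) (numerator e p)"
    by (rule local_quotient[OF p]) auto
  have "Cn_holomorphic e (polydisc e p \<epsilon>) (\<lambda>s. \<Prod>t=1..e. clear_factor e p t s)"
    by (intro Cn_holomorphic_prod Cn_holomorphic_clear_factor openin_polydisc)
  moreover obtain s where s: "s \<in> polydisc e p \<epsilon>" "s \<in> regular_points e"
    using regular_points_dense[OF openin_polydisc polydisc_center[OF p e(1)]] by blast
  have "clear_factor e p t s \<noteq> 0" if "t \<in> {1..e}" for t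
  proof (cases "\<exists>\<kappa>. q e t \<kappa> = E e p t")
    case True
    then obtain \<kappa> where \<kappa>: "q e t \<kappa> = E e p t" by blast
    have "E e s t \<noteq> q e t \<kappa>" using s(2) that unfolding regular_points_def by blast
    then show ?thesis using True by (simp add: clear_factor_def \<kappa>)
  qed (simp add: clear_factor_def)
  then have "\<exists>s\<in>polydisc e p \<epsilon>. (\<Prod>t=1..e. clear_factor e p t s) \<noteq> 0" using s(1) by (intro bexI[of _ s]) auto
  moreover have "cont e s = numerator e p s / (\<Prod>t=1..e. clear_factor e p t s)"
    if "(\<Prod>t=1..e. clear_factor e p t s) \<noteq> 0" for s
    using that by (intro cont_eq_numerator) auto
  ultimately show "\<exists>V g h. p \<in> V \<and> connectedin (Cn e) V \<and> Cn_holomorphic e V g \<and> Cn_holomorphic e V h \<and>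
      (\<exists>s\<in>V. h s \<noteq> 0) \<and> (\<forall>s\<in>V. h s \<noteq> 0 \<longrightarrow> cont e s = g s / h s)"
    using e(2) polydisc_center[OF p e(1)] connectedin_polydisc
    by (intro exI[of _ "polydisc e p \<epsilon>"] exI[of _ "numerator e p"]
        exI[of _ "\<lambda>s. \<Prod>t=1..e. clear_factor e p t s"] conjI ballI impI)
qed

end

section \<open>The series on its region of absolute convergence\<close>

lemma increasing_tuples_D:
  assumes "m \<in> increasing_tuples e"
  shows "m \<in> extensional {1..e}" "\<And>i. i \<in> {1..e} \<Longrightarrow> m i > 0"
    "\<And>i j. i \<in> {1..e} \<Longrightarrow> j \<in> {1..e} \<Longrightarrow> i < j \<Longrightarrow> m i < m j"
  using assms by (auto simp: increasing_tuples_def PiE_def Pi_def strict_mono_on_def)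

text \<open>The consecutive differences of a strictly increasing tuple of positive integers are
  arbitrary positive integers; this substitution decouples the multiple sum.\<close>

definition partial_sums :: "nat \<Rightarrow> (nat \<Rightarrow> nat) \<Rightarrow> nat \<Rightarrow> nat" where
  "partial_sums e m = (\<lambda>i\<in>{1..e}. \<Sum>t=1..i. m t)"

lemma partial_sums_bij:
  "bij_betw (partial_sums e) (PiE {1..e} (\<lambda>_. {0<..})) (increasing_tuples e)"
\<comment> \<open>The inverse takes consecutive differences; \<open>i = 1\<close> is separate
  because an extensional tuple has no meaningful value at index 0.\<close>
proof (rule bij_betwI[where g = "\<lambda>n. \<lambda>i\<in>{1..e}. n i - (if i = 1 then 0 else n (i - 1))"])
  show "partial_sums e \<in> (PiE {1..e} (\<lambda>_. {0<..})) \<rightarrow> increasing_tuples e"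
  proof
    fix m :: "nat \<Rightarrow> nat" assume m: "m \<in> PiE {1..e} (\<lambda>_. {0<..})"
    have pos: "m t > 0" if "t \<in> {1..e}" for t using m that by auto
    have "(\<Sum>t=1..i. m t) > 0" if "i \<in> {1..e}" for i
      using that pos[of i] member_le_sum[of i "{1..i}" m] by auto
    moreover have "(\<Sum>t=1..i. m t) < (\<Sum>t=1..j. m t)" if "i \<in> {1..e}" "j \<in> {1..e}" "i < j" for i j
      using that pos by (intro sum_strict_mono2[where b = j]) auto
    ultimately show "partial_sums e m \<in> increasing_tuples e"
      by (auto simp: increasing_tuples_def partial_sums_def strict_mono_on_def)
  qed
next
  show "(\<lambda>n. \<lambda>i\<in>{1..e}. n i - (if i = 1 then 0 else n (i - 1))) \<in> increasing_tuples e \<rightarrow> PiE {1..e} (\<lambda>_. {0<..})"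
  proof
    fix n assume n: "n \<in> increasing_tuples e"
    have "n i - (if i = 1 then 0 else n (i - 1)) > 0" if "i \<in> {1..e}" for i
      using increasing_tuples_D(2)[OF n that] increasing_tuples_D(3)[OF n, of "i - 1" i] that by auto
    then show "(\<lambda>i\<in>{1..e}. n i - (if i = 1 then 0 else n (i - 1))) \<in> PiE {1..e} (\<lambda>_. {0<..})" by auto
  qed
next
  fix m :: "nat \<Rightarrow> nat" assume m: "m \<in> PiE {1..e} (\<lambda>_. {0<..})"
  show "(\<lambda>i\<in>{1..e}. partial_sums e m i - (if i = 1 then 0 else partial_sums e m (i - 1))) = m"
  proof (rule extensionalityI[of _ "{1..e}"])
    fix i assume i: "i \<in> {1..e}"
    show "(\<lambda>i\<in>{1..e}. partial_sums e m i - (if i = 1 then 0 else partial_sums e m (i - 1))) i = m i"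
    proof (cases i)
      case (Suc i')
      then show ?thesis using i by (cases "i' = 0") (auto simp: partial_sums_def)
    qed (use i in auto)
  qed (use m in \<open>auto simp: PiE_def\<close>)
next
  fix n assume n: "n \<in> increasing_tuples e"
  define m where "m = (\<lambda>i\<in>{1..e}. n i - (if i = 1 then 0 else n (i - 1)))"
  have "(\<Sum>t=1..i. m t) = n i" if "i \<in> {1..e}" for i
    using that
  proof (induction i)
    case (Suc i)
    show ?case
    proof (cases "i = 0")
      case False
      then have "(\<Sum>t=1..i. m t) = n i" using Suc by auto
      moreover have "n i < n (Suc i)" using increasing_tuples_D(3)[OF n, of i "Suc i"] False Suc.prems by auto
      ultimately show ?thesis using Suc.prems False by (simp add: m_def)
    qed (use Suc.prems in \<open>simp add: m_def\<close>)
  qed simp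
  then show "partial_sums e m = n"
    using increasing_tuples_D(1)[OF n]
    by (intro extensionalityI[of _ "{1..e}"]) (auto simp: partial_sums_def)
qed

text \<open>Exchanging the products over the pairs \<open>t \<le> i\<close> collects, at each
  difference \<open>m t\<close>, all \<open>z i\<close> with \<open>i \<ge> t\<close>.\<close>

lemma prod_power_partial_sums:
  fixes z :: "nat \<Rightarrow> 'a::comm_semiring_1"
  shows "(\<Prod>i=1..e. z i ^ partial_sums e m i) = (\<Prod>t=1..e. (\<Prod>i=t..e. z i) ^ m t)"
proof -
  have "(\<Prod>i=1..e. z i ^ partial_sums e m i) = (\<Prod>i=1..e. \<Prod>t\<in>{t \<in> {1..e}. t \<le> i}. z i ^ m t)"
  proof (rule prod.cong[OF refl])
    fix i assume i: "i \<in> {1..e}"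
    then have "{t \<in> {1..e}. t \<le> i} = {1..i}" by auto
    then show "z i ^ partial_sums e m i = (\<Prod>t\<in>{t \<in> {1..e}. t \<le> i}. z i ^ m t)"
      using i by (simp add: partial_sums_def power_sum)
  qed
  also have "\<dots> = (\<Prod>t=1..e. \<Prod>i\<in>{i \<in> {1..e}. t \<le> i}. z i ^ m t)"
    by (rule prod.swap_restrict) auto
  also have "\<dots> = (\<Prod>t=1..e. (\<Prod>i=t..e. z i) ^ m t)"
  proof (rule prod.cong[OF refl])
    fix t assume "t \<in> {1..e}"
    then have "{i \<in> {1..e}. t \<le> i} = {t..e}" by auto
    then show "(\<Prod>i\<in>{i \<in> {1..e}. t \<le> i}. z i ^ m t) = (\<Prod>i=t..e. z i) ^ m t"
      by (simp add: prod_power_distrib)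
  qed
  finally show ?thesis .
qed

text \<open>Differences start at 1, hence the numerator \<open>x\<close>.\<close>

lemma has_sum_power_positive:
  fixes x :: complex
  assumes "norm x < 1"
  shows "((\<lambda>m. x ^ m) has_sum x / (1 - x)) {0<..}" "(\<lambda>m. norm x ^ m) summable_on {0<..}"
proof -
  have s: "summable (\<lambda>m. norm x ^ Suc m)"
    using assms summable_geometric[of "norm x"] by (subst summable_Suc_iff) auto
  have "(\<lambda>m. x * x ^ m) sums (x * (1 / (1 - x)))"
    by (intro sums_mult geometric_sums assms)
  then have "((\<lambda>m. x ^ Suc m) has_sum x / (1 - x)) UNIV"
    using s by (intro norm_summable_imp_has_sum) (auto simp: norm_mult norm_power)
  moreover have bij: "bij_betw Suc UNIV {0<..}"
    by (rule bij_betwI[where g = "\<lambda>n. n - 1"]) auto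
  ultimately show "((\<lambda>m. x ^ m) has_sum x / (1 - x)) {0<..}"
    using has_sum_reindex_bij_betw[OF bij, of "\<lambda>m. x ^ m"] by simp
  have "(\<lambda>m. norm x ^ Suc m) summable_on UNIV"
    using s by (intro summable_nonneg_imp_summable_on) auto
  then show "(\<lambda>m. norm x ^ m) summable_on {0<..}"
    using summable_on_reindex_bij_betw[OF bij, of "\<lambda>m. norm x ^ m"] by simp
qed

lemma increasing_tuples_geometric:
  fixes z :: "nat \<Rightarrow> complex"
  assumes "\<And>t. t \<in> {1..e} \<Longrightarrow> norm (\<Prod>i=t..e. z i) < 1"
  shows "(\<lambda>m. \<Prod>i=1..e. norm (z i) ^ m i) summable_on increasing_tuples e"
    and "(\<Sum>\<^sub>\<infinity>m\<in>increasing_tuples e. \<Prod>i=1..e. z i ^ m i) =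
           (\<Prod>t=1..e. (\<Prod>i=t..e. z i) / (1 - (\<Prod>i=t..e. z i)))"
proof -
  let ?P = "PiE {1..e} (\<lambda>_. {0<..}) :: (nat \<Rightarrow> nat) set"
  have "(\<lambda>m. \<Prod>t=1..e. norm (\<Prod>i=t..e. z i) ^ m t) summable_on ?P"
    by (rule summable_on_prod_PiE) (use assms has_sum_power_positive(2) in auto)
  then have "(\<lambda>m. \<Prod>i=1..e. norm (z i) ^ partial_sums e m i) summable_on ?P"
    by (simp only: prod_power_partial_sums prod_norm)
  then show "(\<lambda>m. \<Prod>i=1..e. norm (z i) ^ m i) summable_on increasing_tuples e"
    using summable_on_reindex_bij_betw[OF partial_sums_bij, of "\<lambda>m. \<Prod>i=1..e. norm (z i) ^ m i"] by simp
  have "(\<Sum>\<^sub>\<infinity>m\<in>increasing_tuples e. \<Prod>i=1..e. z i ^ m i) = (\<Sum>\<^sub>\<infinity>m\<in>?P. \<Prod>i=1..e. z i ^ partial_sums e m i)"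
    by (rule infsum_reindex_bij_betw[OF partial_sums_bij, symmetric])
  also have "\<dots> = (\<Sum>\<^sub>\<infinity>m\<in>?P. \<Prod>t=1..e. (\<Prod>i=t..e. z i) ^ m t)"
    by (simp only: prod_power_partial_sums)
  also have "\<dots> = (\<Prod>t=1..e. \<Sum>\<^sub>\<infinity>m\<in>{0<..}. (\<Prod>i=t..e. z i) ^ m)"
    by (rule infsum_prod_PiE_abs) (use assms has_sum_power_positive(2) in \<open>auto simp: norm_power\<close>)
  also have "\<dots> = (\<Prod>t=1..e. (\<Prod>i=t..e. z i) / (1 - (\<Prod>i=t..e. z i)))"
    by (intro prod.cong refl infsumI has_sum_power_positive(1) assms)
  finally show "(\<Sum>\<^sub>\<infinity>m\<in>increasing_tuples e. \<Prod>i=1..e. z i ^ m i) =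
           (\<Prod>t=1..e. (\<Prod>i=t..e. z i) / (1 - (\<Prod>i=t..e. z i)))" .
qed

text \<open>Shifting the entries from \<open>t\<close> on by \<open>k\<close> in the tuple
  \<open>1, 2, ..., e\<close> gives a subfamily whose terms are a non-zero constant times the
  \<open>k\<close>-th power of the tail product.\<close>

lemma increasing_tuples_geometric_converse:
  fixes z :: "nat \<Rightarrow> complex"
  assumes sm: "(\<lambda>m. \<Prod>i=1..e. norm (z i) ^ m i) summable_on increasing_tuples e"
    and nz: "\<And>i. i \<in> {1..e} \<Longrightarrow> z i \<noteq> 0" and t: "t \<in> {1..e}"
  shows "norm (\<Prod>i=t..e. z i) < 1"
proof -
  define x where "x = (\<Prod>i=t..e. norm (z i))"
  define w where "w k = (\<lambda>i\<in>{1..e}. if t \<le> i then i + k else i)" for k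
  have "inj w"
  proof (rule injI)
    fix k l assume "w k = w l"
    then have "w k t = w l t" by simp
    then show "k = l" using t by (simp add: w_def)
  qed
  moreover have "range w \<subseteq> increasing_tuples e"
    by (auto simp: w_def increasing_tuples_def strict_mono_on_def)
  ultimately have "(\<lambda>k. \<Prod>i=1..e. norm (z i) ^ w k i) summable_on UNIV"
    using summable_on_subset_banach[OF sm] summable_on_reindex[of w UNIV "\<lambda>m. \<Prod>i=1..e. norm (z i) ^ m i"]
    by (simp add: o_def)
  moreover have "(\<Prod>i=1..e. norm (z i) ^ w k i) = (\<Prod>i=1..e. norm (z i) ^ i) * x ^ k" for k
  proof -
    have "(\<Prod>i=1..e. norm (z i) ^ w k i) =
        (\<Prod>i=1..e. norm (z i) ^ i * (if i \<in> {t..e} then norm (z i) ^ k else 1))"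
      by (intro prod.cong) (auto simp: w_def power_add)
    also have "\<dots> = (\<Prod>i=1..e. norm (z i) ^ i) * (\<Prod>i=1..e. if i \<in> {t..e} then norm (z i) ^ k else 1)"
      by (rule prod.distrib)
    also have "(\<Prod>i=1..e. if i \<in> {t..e} then norm (z i) ^ k else 1) = (\<Prod>i=t..e. norm (z i) ^ k)"
    proof -
      have "{1..e} \<inter> {t..e} = {t..e}" using t by auto
      then show ?thesis
        using prod.inter_restrict[of "{1..e}" "\<lambda>i. norm (z i) ^ k" "{t..e}"] by (simp only: finite_atLeastAtMost)
    qed
    finally show ?thesis by (simp add: prod.distrib x_def prod_power_distrib)
  qed
  ultimately have "(\<lambda>k. (\<Prod>i=1..e. norm (z i) ^ i) * x ^ k) summable_on UNIV" by (simp only:)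
  then have "summable (\<lambda>k. (\<Prod>i=1..e. norm (z i) ^ i) * x ^ k)" by (rule summable_on_imp_summable)
  moreover have "(\<Prod>i=1..e. norm (z i) ^ i) \<noteq> 0" using nz by simp
  ultimately have "summable (\<lambda>k. x ^ k)" by (simp add: summable_cmult_iff)
  then have "norm x < 1" by (simp add: summable_geometric_iff)
  then show ?thesis by (simp add: x_def prod_norm)
qed


text \<open>\<open>N\<close> bounds the depth instead of fixing it, since depths \<open>d\<close>
  and \<open>j - 1\<close> both occur.\<close>

locale lucas_series = lucas_continuation +
  fixes U :: "nat \<Rightarrow> real" and f :: "nat \<Rightarrow> int \<Rightarrow> complex" and N :: nat
  assumes U: "\<And>n. n \<ge> 1 \<Longrightarrow> U n = \<alpha> ^ n * (1 - r ^ n) / sqrt D"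
    and f: "\<And>i n. i \<in> {1..N} \<Longrightarrow> f i (int n) = u i ^ n"
    and u_nonzero: "\<And>i. i \<in> {1..N} \<Longrightarrow> u i \<noteq> 0"
begin

text \<open>The ratio of the geometric part in the \<open>i\<close>-th summation variable, that is
  \<open>f i 1 * \<alpha> powr (- s i)\<close>.\<close>

definition y :: "(nat \<Rightarrow> complex) \<Rightarrow> nat \<Rightarrow> complex" where
  "y s i = u i * exp (- (of_real (ln \<alpha>) * s i))"

lemma prod_y: "(\<Prod>i=t..e. y s i) = (\<Prod>i=t..e. u i) / E e s t"
proof -
  have "y s i = u i / exp (of_real (ln \<alpha>) * s i)" for i by (simp add: y_def exp_minus field_simps)
  then show ?thesis by (simp add: prod_dividef E_def sum_distrib_left exp_sum)
qed

lemma abs_r_power: "n \<ge> 1 \<Longrightarrow> \<bar>r ^ n\<bar> \<le> \<bar>r\<bar>"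
  using power_decreasing[of 1 n "\<bar>r\<bar>"] r by (simp add: power_abs)

lemma one_minus_r_power_pos: "n \<ge> 1 \<Longrightarrow> 1 - r ^ n > 0"
  using abs_r_power[of n] r by linarith

text \<open>\<open>U n\<close> is positive, so its complex power comes from the real logarithm,
  which splits the product formula for \<open>U n\<close>.\<close>

lemma term_factor:
  assumes i: "i \<in> {1..N}" and n: "n \<ge> 1"
  shows "f i (int n) / of_real (U n) powr s i =
     exp (of_real (ln D) * s i / 2) * (y s i ^ n * of_real (1 - r ^ n) powr (- s i))"
proof -
  have pos: "\<alpha> ^ n > 0" "1 - r ^ n > 0" "sqrt D > 0"
    using alpha one_minus_r_power_pos[OF n] D by auto
  have Un: "U n = \<alpha> ^ n * (1 - r ^ n) / sqrt D" by (rule U[OF n])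
  then have Upos: "U n > 0" using pos by simp
  have "ln (U n) = ln (\<alpha> ^ n) + ln (1 - r ^ n) - ln (sqrt D)"
    unfolding Un using pos alpha by (simp add: ln_mult_pos ln_div)
  also have "\<dots> = real n * ln \<alpha> + ln (1 - r ^ n) - ln D / 2"
    using alpha D by (simp add: ln_realpow ln_sqrt)
  finally have lnU: "ln (U n) = real n * ln \<alpha> + ln (1 - r ^ n) - ln D / 2" .
  have "of_real (U n) powr s i = exp (s i * of_real (ln (U n)))"
    using Upos by (simp add: powr_def Ln_of_real)
  also have "inverse \<dots> = exp (of_real (ln D) * s i / 2) *
      (exp (- (of_real (ln \<alpha>) * s i)) ^ n * exp (- s i * of_real (ln (1 - r ^ n))))"
    unfolding exp_minus[symmetric] exp_of_nat_mult[symmetric] exp_add[symmetric] lnU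
    by (simp add: algebra_simps)
  also have "exp (- s i * of_real (ln (1 - r ^ n))) = of_real (1 - r ^ n) powr (- s i)"
    using pos(2) by (simp add: powr_def Ln_of_real del: of_real_diff of_real_power)
  finally have inv: "inverse (of_real (U n) powr s i) = exp (of_real (ln D) * s i / 2) *
      (exp (- (of_real (ln \<alpha>) * s i)) ^ n * of_real (1 - r ^ n) powr (- s i))" .
  show ?thesis
    unfolding divide_inverse inv f[OF i] y_def by (simp add: power_mult_distrib mult_ac)
qed

lemma term_eq:
  assumes "e \<le> N" "m \<in> increasing_tuples e"
  shows "multiple_L_term U e f s m =
    Dpow e s * ((\<Prod>i=1..e. y s i ^ m i) * (\<Prod>i=1..e. of_real (1 - r ^ m i) powr (- s i)))"
proof -
  have "multiple_L_term U e f s m =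
      (\<Prod>i=1..e. exp (of_real (ln D) * s i / 2) * (y s i ^ m i * of_real (1 - r ^ m i) powr (- s i)))"
    unfolding multiple_L_term_def
  proof (rule prod.cong[OF refl])
    fix i assume i: "i \<in> {1..e}"
    then show "f i (int (m i)) / of_real (U (m i)) powr s i =
        exp (of_real (ln D) * s i / 2) * (y s i ^ m i * of_real (1 - r ^ m i) powr (- s i))"
      using increasing_tuples_D(2)[OF assms(2) i] assms(1) by (intro term_factor) auto
  qed
  moreover have "Dpow e s = (\<Prod>i=1..e. exp (of_real (ln D) * s i / 2))"
    by (simp add: Dpow_def exp_sum[symmetric] sum_distrib_left sum_divide_distrib)
  ultimately show ?thesis by (simp add: prod.distrib)
qed

text \<open>For \<open>n \<ge> 1\<close> the number \<open>1 - r ^ n\<close> stays between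
  \<open>1 - \<bar>r\<bar>\<close> and \<open>1 + \<bar>r\<bar>\<close>, so its powers are bounded
  and bounded away from 0. Absolute convergence is therefore decided by the geometric part.\<close>

lemma correction_bounds:
  obtains c C where "c > 0" "C > 0"
    "\<And>m. m \<in> increasing_tuples e \<Longrightarrow> c \<le> norm (\<Prod>i=1..e. of_real (1 - r ^ m i) powr (- s i) :: complex)"
    "\<And>m. m \<in> increasing_tuples e \<Longrightarrow> norm (\<Prod>i=1..e. of_real (1 - r ^ m i) powr (- s i) :: complex) \<le> C"
proof -
  define B where "B = max (- ln (1 - \<bar>r\<bar>)) (ln (1 + \<bar>r\<bar>))"
  have B: "\<bar>ln (1 - r ^ n)\<bar> \<le> B" if n: "n \<ge> 1" for n
  proof -
    have "1 - \<bar>r\<bar> \<le> 1 - r ^ n" "1 - r ^ n \<le> 1 + \<bar>r\<bar>" using abs_r_power[OF n] by linarith+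
    then have "ln (1 - \<bar>r\<bar>) \<le> ln (1 - r ^ n)" "ln (1 - r ^ n) \<le> ln (1 + \<bar>r\<bar>)"
      using r one_minus_r_power_pos[OF n] by (auto simp: ln_le_cancel_iff)
    then show ?thesis by (auto simp: B_def)
  qed
  have nf: "norm (of_real (1 - r ^ n) powr (- s i) :: complex) = exp (- Re (s i) * ln (1 - r ^ n))" if "n \<ge> 1" for n i
    using one_minus_r_power_pos[OF that]
    by (simp add: powr_def Ln_of_real norm_exp_eq_Re del: of_real_diff of_real_power)
  have bd: "\<bar>- Re (s i) * ln (1 - r ^ n)\<bar> \<le> \<bar>Re (s i)\<bar> * B" if "n \<ge> 1" for n i
    using B[OF that] by (simp add: abs_mult mult_left_mono)
  show ?thesis
  proof
    show "(\<Prod>i=1..e. exp (- (\<bar>Re (s i)\<bar> * B))) > 0" "(\<Prod>i=1..e. exp (\<bar>Re (s i)\<bar> * B)) > 0"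
      by (simp_all add: prod_pos)
    fix m assume m: "m \<in> increasing_tuples e"
    have m1: "m i \<ge> 1" if "i \<in> {1..e}" for i using increasing_tuples_D(2)[OF m that] by simp
    have "exp (- (\<bar>Re (s i)\<bar> * B)) \<le> norm (of_real (1 - r ^ m i) powr (- s i) :: complex)"
      and "norm (of_real (1 - r ^ m i) powr (- s i) :: complex) \<le> exp (\<bar>Re (s i)\<bar> * B)"
      if "i \<in> {1..e}" for i
      unfolding nf[OF m1[OF that]] exp_le_cancel_iff using bd[OF m1[OF that], of i] by linarith+
    then show "(\<Prod>i=1..e. exp (- (\<bar>Re (s i)\<bar> * B))) \<le> norm (\<Prod>i=1..e. of_real (1 - r ^ m i) powr (- s i) :: complex)"
      and "norm (\<Prod>i=1..e. of_real (1 - r ^ m i) powr (- s i) :: complex) \<le> (\<Prod>i=1..e. exp (\<bar>Re (s i)\<bar> * B))"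
      unfolding prod_norm[symmetric] by (auto intro!: prod_mono)
  qed
qed

definition conv_region :: "nat \<Rightarrow> (nat \<Rightarrow> complex) set" where
  "conv_region e = {s \<in> topspace (Cn e). \<forall>t\<in>{1..e}. norm (\<Prod>i=t..e. y s i) < 1}"

text \<open>The choice in \<open>multiple_L\<close> tests agreement on the whole region, so it must
  be known exactly. The two-sided bounds reduce it to geometric series, whose convergence is
  characterized in both directions.\<close>

lemma multiple_L_region_eq:
  assumes e: "e \<le> N"
  shows "multiple_L_region U e f = conv_region e"
proof -
  have "(\<lambda>m. norm (multiple_L_term U e f s m)) summable_on increasing_tuples e \<longleftrightarrow>
      (\<forall>t\<in>{1..e}. norm (\<Prod>i=t..e. y s i) < 1)" for s
  proof -
    obtain c C where c: "c > 0" "C > 0"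
      "\<And>m. m \<in> increasing_tuples e \<Longrightarrow> c \<le> norm (\<Prod>i=1..e. of_real (1 - r ^ m i) powr (- s i) :: complex)"
      "\<And>m. m \<in> increasing_tuples e \<Longrightarrow> norm (\<Prod>i=1..e. of_real (1 - r ^ m i) powr (- s i) :: complex) \<le> C"
      by (rule correction_bounds[of e s]) blast
    let ?T = "\<lambda>m. \<Prod>i=1..e. norm (y s i) ^ m i" and ?d = "norm (Dpow e s)"
    have d: "?d > 0" by (simp add: Dpow_def)
    have nt: "norm (multiple_L_term U e f s m) =
        ?d * (?T m * norm (\<Prod>i=1..e. of_real (1 - r ^ m i) powr (- s i) :: complex))"
      if "m \<in> increasing_tuples e" for m
      unfolding term_eq[OF e that] norm_mult by (simp add: prod_norm[symmetric] norm_power)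
    have T0: "?T m \<ge> 0" for m by (simp add: prod_nonneg)
    show ?thesis
    proof
      assume sm: "(\<lambda>m. norm (multiple_L_term U e f s m)) summable_on increasing_tuples e"
      have "?T summable_on increasing_tuples e"
      proof (rule summable_on_comparison_test)
        show "(\<lambda>m. norm (multiple_L_term U e f s m) * inverse (?d * c)) summable_on increasing_tuples e"
          by (rule summable_on_cmult_left[OF sm])
        fix m assume m: "m \<in> increasing_tuples e"
        have "?T m * (?d * c) \<le> norm (multiple_L_term U e f s m)"
          unfolding nt[OF m] using mult_left_mono[OF c(3)[OF m] mult_nonneg_nonneg[of ?d "?T m"]] T0 d
          by (simp add: mult_ac)
        then show "?T m \<le> norm (multiple_L_term U e f s m) * inverse (?d * c)"
          using d c(1) by (simp add: field_simps)
      qed (rule T0)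
      then show "\<forall>t\<in>{1..e}. norm (\<Prod>i=t..e. y s i) < 1"
        using e u_nonzero by (intro ballI increasing_tuples_geometric_converse) (auto simp: y_def)
    next
      assume "\<forall>t\<in>{1..e}. norm (\<Prod>i=t..e. y s i) < 1"
      then have sm: "?T summable_on increasing_tuples e"
        by (intro increasing_tuples_geometric(1)) auto
      show "(\<lambda>m. norm (multiple_L_term U e f s m)) summable_on increasing_tuples e"
      proof (rule summable_on_comparison_test)
        show "(\<lambda>m. ?T m * (?d * C)) summable_on increasing_tuples e"
          by (rule summable_on_cmult_left[OF sm])
        fix m assume m: "m \<in> increasing_tuples e"
        show "norm (multiple_L_term U e f s m) \<le> ?T m * (?d * C)"
          unfolding nt[OF m] using mult_left_mono[OF c(4)[OF m] mult_nonneg_nonneg[of ?d "?T m"]] T0 d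
          by (simp add: mult_ac)
      qed simp
    qed
  qed
  then show ?thesis by (auto simp: multiple_L_region_def conv_region_def)
qed

lemma conv_region_iff:
  "s \<in> conv_region e \<longleftrightarrow> s \<in> topspace (Cn e) \<and> (\<forall>t\<in>{1..e}. norm (q e t 0) < norm (E e s t))"
  by (auto simp: conv_region_def prod_y q_def norm_divide E_nonzero)

lemma openin_conv_region: "openin (Cn e) (conv_region e)"
proof -
  have "openin (Cn e) ((\<Inter>t\<in>{1..e}. {s \<in> topspace (Cn e). E e s t \<in> - cball 0 (norm (q e t 0))}) \<inter> topspace (Cn e))"
    by (intro openin_INT Cn_holomorphic_openin_vimage Cn_holomorphic_E) auto
  moreover have "(\<Inter>t\<in>{1..e}. {s \<in> topspace (Cn e). E e s t \<in> - cball 0 (norm (q e t 0))}) \<inter> topspace (Cn e)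
      = conv_region e"
    by (auto simp: conv_region_iff not_le)
  ultimately show ?thesis by simp
qed

lemma conv_region_nonempty: "conv_region e \<noteq> {}"
proof -
  define v where "v i = (if i = e then 1 else 0 :: real)" for i
  define S where "S = (\<Sum>t=1..e. norm (q e t 0))"
  \<comment> \<open>Chosen so that each \<open>E\<close> has norm \<open>1 + S\<close>, above every
    \<open>norm (q e t 0)\<close>.\<close>
  define x where "x = ln (1 + S) / ln \<alpha>"
  have S: "S \<ge> 0" by (simp add: S_def sum_nonneg)
  have "norm (q e t 0) < norm (E e (line e (\<lambda>_. 0) v x) t)" if t: "t \<in> {1..e}" for t
  proof -
    have "(\<Sum>i=t..e. v i) = 1" using t by (simp add: v_def)
    then have "norm (E e (line e (\<lambda>_. 0) v x) t) = 1 + S"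
      using t S ln_alpha norm_of_real[of "1 + S", where 'a = complex]
      by (subst E_line) (auto simp: E_def x_def)
    moreover have "norm (q e t 0) \<le> S" unfolding S_def using t by (intro member_le_sum) auto
    ultimately show ?thesis by simp
  qed
  then have "line e (\<lambda>_. 0) v x \<in> conv_region e" by (auto simp: conv_region_iff line_def topspace_Cn)
  then show ?thesis by blast
qed

lemma multiple_L_series_eq:
  assumes e: "e \<le> N" and s: "s \<in> conv_region e"
  shows "multiple_L_series U e f s = cont e s"
proof -
  let ?A = "increasing_tuples e" and ?K = "exponents e"
  \<comment> \<open>The general term after the binomial expansion: for fixed \<open>m\<close> it
    sums over \<open>k\<close> to a term of the series up to \<open>Dpow e s\<close>, for fixed
    \<open>k\<close> it is geometric in \<open>m\<close>.\<close>
  define a where "a m k = (\<Prod>i=1..e. y s i ^ m i) * (\<Prod>i=1..e. rising (s i) (k i) * (of_real (r ^ m i)) ^ k i)" for m k :: "nat \<Rightarrow> nat"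
  have lt1: "norm (\<Prod>i=t..e. y s i) < 1" if "t \<in> {1..e}" for t using s that by (auto simp: conv_region_def)
  have correction: "(\<Prod>i=1..e. of_real (1 - r ^ m i) powr (- s i)) =
      (\<Sum>\<^sub>\<infinity>k\<in>?K. \<Prod>i=1..e. rising (s i) (k i) * (of_real (r ^ m i)) ^ k i)" if m: "m \<in> ?A" for m
  proof -
    have r1: "\<bar>r ^ m i\<bar> < 1" if "i \<in> {1..e}" for i
      using increasing_tuples_D(2)[OF m that] abs_r_power[of "m i"] r by auto
    have hs: "((\<lambda>k. rising (s i) k * of_real (r ^ m i) ^ k) has_sum of_real (1 - r ^ m i) powr (- s i)) UNIV"
      if "i \<in> {1..e}" for i using has_sum_rising[OF r1[OF that]] .
    have "(\<Sum>\<^sub>\<infinity>k\<in>?K. \<Prod>i=1..e. rising (s i) (k i) * (of_real (r ^ m i)) ^ k i) =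
        (\<Prod>i=1..e. \<Sum>\<^sub>\<infinity>k. rising (s i) k * of_real (r ^ m i) ^ k)"
    proof (rule infsum_prod_PiE_abs)
      fix i assume "i \<in> {1..e}"
      then have "(\<lambda>k. rising (s i) k * of_real (r ^ m i) ^ k) summable_on UNIV"
        using hs has_sum_imp_summable by blast
      then show "(\<lambda>k. norm (rising (s i) k * of_real (r ^ m i) ^ k)) summable_on UNIV"
        by (simp only: summable_on_iff_abs_summable_on_complex)
    qed simp
    also have "\<dots> = (\<Prod>i=1..e. of_real (1 - r ^ m i) powr (- s i))"
      by (intro prod.cong refl infsumI hs)
    finally show ?thesis ..
  qed
  have "multiple_L_series U e f s = (\<Sum>\<^sub>\<infinity>m\<in>?A. Dpow e s * (\<Sum>\<^sub>\<infinity>k\<in>?K. a m k))"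
    unfolding multiple_L_series_def
  proof (rule infsum_cong)
    fix m assume m: "m \<in> ?A"
    show "multiple_L_term U e f s m = Dpow e s * (\<Sum>\<^sub>\<infinity>k\<in>?K. a m k)"
      unfolding term_eq[OF e m] correction[OF m] a_def infsum_cmult_right' ..
  qed
  also have "\<dots> = Dpow e s * (\<Sum>\<^sub>\<infinity>m\<in>?A. \<Sum>\<^sub>\<infinity>k\<in>?K. a m k)" by (rule infsum_cmult_right')
  also have "(\<Sum>\<^sub>\<infinity>m\<in>?A. \<Sum>\<^sub>\<infinity>k\<in>?K. a m k) = (\<Sum>\<^sub>\<infinity>k\<in>?K. \<Sum>\<^sub>\<infinity>m\<in>?A. a m k)"
  proof (rule infsum_swap_banach)
    \<comment> \<open>As \<open>m i \<ge> 1\<close> gives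
      \<open>\<bar>r ^ m i\<bar> \<le> \<bar>r\<bar>\<close>, the double family is dominated by a
      summable function of \<open>m\<close> times a summable function of \<open>k\<close>.\<close>
    let ?T = "\<lambda>m. \<Prod>i=1..e. norm (y s i) ^ m i" and ?R = "\<lambda>k. \<Prod>i=1..e. rising (norm (s i)) (k i) * \<bar>r\<bar> ^ k i"
    have T0: "?T m \<ge> 0" for m by (simp add: prod_nonneg)
    have R0: "?R k \<ge> 0" for k by (intro prod_nonneg mult_nonneg_nonneg rising_nonneg) auto
    have sT: "?T summable_on ?A" using increasing_tuples_geometric(1)[of e "y s"] lt1 by blast
    have sR: "?R summable_on ?K"
      by (rule summable_on_prod_PiE) (use r summable_on_rising rising_nonneg in auto)
    define F where "F = (\<lambda>p. ?T (fst p) * ?R (snd p))"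
    have "(\<lambda>p. norm (F p)) summable_on ?A \<times> ?K"
    proof (rule Infinite_Sum.abs_summable_on_Sigma_iff[THEN iffD2], intro conjI ballI)
      show "(\<lambda>k. norm (F (m, k))) summable_on ?K" for m
        using summable_on_cmult_right[OF sR, of "?T m"] T0 R0 by (simp add: F_def abs_mult)
      have "(\<lambda>m. ?T m * infsum ?R ?K) summable_on ?A" by (rule summable_on_cmult_left[OF sT])
      then show "(\<lambda>m. norm (\<Sum>\<^sub>\<infinity>k\<in>?K. norm (F (m, k)))) summable_on ?A"
        using T0 R0 infsum_nonneg[of ?K ?R] by (simp add: F_def infsum_cmult_right' abs_mult)
    qed
    then have "(\<lambda>(m, k). norm (a m k)) summable_on ?A \<times> ?K"
    proof (rule summable_on_comparison_test)
      fix mk assume "mk \<in> ?A \<times> ?K"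
      then obtain m k where mk: "mk = (m, k)" and m: "m \<in> ?A" by blast
      have "norm (rising (s i) (k i) * (of_real (r ^ m i)) ^ k i) \<le> rising (norm (s i)) (k i) * \<bar>r\<bar> ^ k i"
        if i: "i \<in> {1..e}" for i
      proof -
        have "\<bar>r ^ m i\<bar> ^ k i \<le> \<bar>r\<bar> ^ k i"
          using abs_r_power[of "m i"] increasing_tuples_D(2)[OF m i] by (intro power_mono) auto
        then show ?thesis
          unfolding norm_mult norm_power norm_of_real
          by (intro mult_mono norm_rising_le rising_nonneg) auto
      qed
      then have "norm (\<Prod>i=1..e. rising (s i) (k i) * (of_real (r ^ m i)) ^ k i) \<le> ?R k"
        unfolding prod_norm[symmetric] by (intro prod_mono) auto
      then have "?T m * norm (\<Prod>i=1..e. rising (s i) (k i) * (of_real (r ^ m i)) ^ k i) \<le> ?T m * ?R k"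
        by (rule mult_left_mono[OF _ T0])
      moreover have "norm (a m k) = ?T m * norm (\<Prod>i=1..e. rising (s i) (k i) * (of_real (r ^ m i)) ^ k i)"
        unfolding a_def norm_mult[of "\<Prod>i=1..e. y s i ^ m i"] by (simp only: prod_norm[symmetric] norm_power)
      ultimately have "norm (a m k) \<le> ?T m * ?R k" by simp
      also have "\<dots> \<le> norm (F mk)" unfolding F_def mk by simp
      finally show "(case mk of (m, k) \<Rightarrow> norm (a m k)) \<le> norm (F mk)"
        by (simp only: mk case_prod_conv)
    qed auto
    then show "(\<lambda>(m, k). a m k) summable_on ?A \<times> ?K"
      using abs_summable_summable[of "\<lambda>(m, k). a m k"] by (simp add: case_prod_unfold)
  qed
  also have "\<dots> = (\<Sum>\<^sub>\<infinity>k\<in>?K. (\<Prod>i=1..e. rising (s i) (k i)) *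
      (\<Prod>t=1..e. q e t (\<Sum>i=t..e. k i) / (E e s t - q e t (\<Sum>i=t..e. k i))))"
  proof (rule infsum_cong)
    fix k
    \<comment> \<open>Since \<open>(r ^ m) ^ k = (r ^ k) ^ m\<close>, for fixed \<open>k\<close> the
      correction merely changes the ratio \<open>y s i\<close> to \<open>z i\<close>.\<close>
    define z where "z i = y s i * of_real r ^ k i" for i
    have pz: "(\<Prod>i=t..e. z i) = q e t (\<Sum>i=t..e. k i) / E e s t" for t
      by (simp add: z_def prod.distrib prod_y q_def power_sum)
    have "norm (\<Prod>i=t..e. z i) < 1" if t: "t \<in> {1..e}" for t
    proof -
      have "norm (\<Prod>i=t..e. z i) = norm (\<Prod>i=t..e. y s i) * \<bar>r\<bar> ^ (\<Sum>i=t..e. k i)"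
        by (simp add: z_def prod.distrib norm_mult power_sum prod_norm[symmetric] norm_power)
      also have "\<dots> \<le> norm (\<Prod>i=t..e. y s i) * 1"
        using r by (intro mult_left_mono power_le_one) auto
      finally show ?thesis using lt1[OF t] by simp
    qed
    then have "(\<Sum>\<^sub>\<infinity>m\<in>?A. \<Prod>i=1..e. z i ^ m i) =
        (\<Prod>t=1..e. (\<Prod>i=t..e. z i) / (1 - (\<Prod>i=t..e. z i)))"
      by (intro increasing_tuples_geometric(2)) auto
    also have "\<dots> = (\<Prod>t=1..e. q e t (\<Sum>i=t..e. k i) / (E e s t - q e t (\<Sum>i=t..e. k i)))"
      unfolding pz using E_nonzero by (intro prod.cong refl) (simp add: divide_simps)
    finally have "(\<Sum>\<^sub>\<infinity>m\<in>?A. \<Prod>i=1..e. z i ^ m i) = \<dots>" .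
    moreover have "a m k = (\<Prod>i=1..e. rising (s i) (k i)) * (\<Prod>i=1..e. z i ^ m i)" for m
      unfolding a_def z_def prod.distrib[symmetric] 
      by (intro prod.cong refl) (simp add: power_mult_distrib power_mult[symmetric] mult_ac)
    ultimately show "(\<Sum>\<^sub>\<infinity>m\<in>?A. a m k) = (\<Prod>i=1..e. rising (s i) (k i)) *
      (\<Prod>t=1..e. q e t (\<Sum>i=t..e. k i) / (E e s t - q e t (\<Sum>i=t..e. k i)))"
      by (simp only: infsum_cmult_right')
  qed
  finally show ?thesis unfolding cont_def .
qed

end

section \<open>Residues along the polar hyperplanes\<close>

context lucas_continuation
begin

lemma eq_densely_regular:
  assumes "\<And>s. s \<in> V \<Longrightarrow> s \<in> regular_points e \<Longrightarrow> F s = G s"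
  shows "eq_densely e V F G"
  unfolding eq_densely_def
proof (intro allI impI, elim conjE)
  fix B assume B: "openin (Cn e) B" "B \<subseteq> V" "B \<noteq> {}"
  then obtain p where "p \<in> B" by blast
  then obtain s where "s \<in> B" "s \<in> regular_points e" using regular_points_dense[OF B(1)] by blast
  then have "B \<inter> regular_points e \<noteq> {}" by blast
  moreover have "openin (Cn e) (B \<inter> regular_points e)" using B(1) openin_regular_points by blast
  ultimately show "\<exists>B'. openin (Cn e) B' \<and> B' \<subseteq> B \<and> B' \<noteq> {} \<and> (\<forall>s\<in>B'. F s = G s)"
    using assms B(2) by (intro exI[of _ "B \<inter> regular_points e"]) auto
qed

lemma cont_0: "cont 0 s = 1"
  by (simp add: cont_def Dpow_def)

end

context lucas_series
begin

text \<open>\<open>cont e\<close> shows that the choice in \<open>multiple_L\<close> is possible;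
  whatever is chosen equals the series, hence \<open>cont e\<close>, on the non-empty open set
  \<open>conv_region e\<close>, and the identity theorem applies.\<close>

lemma multiple_L_continuation:
  assumes "1 \<le> e" "e \<le> N"
  obtains F where "multiple_L U e f = Cn_remove_sings e F"
    "eq_densely e (topspace (Cn e)) F (cont e)"
proof -
  define P where "P F \<longleftrightarrow> Cn_meromorphic e F \<and> (\<forall>s\<in>multiple_L_region U e f. F s = multiple_L_series U e f s)" for F
  have "P (cont e)"
    unfolding P_def multiple_L_region_eq[OF assms(2)]
    using Cn_meromorphic_cont multiple_L_series_eq[OF assms(2)] by auto
  then have P: "P (SOME F. P F)" by (rule someI[of P])
  have "multiple_L U e f = Cn_remove_sings e (SOME F. P F)"
    using assms(1) unfolding multiple_L_def P_def by simp
  moreover have "eq_densely e (topspace (Cn e)) (SOME F. P F) (cont e)"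
  proof (rule Cn_meromorphic_identity[OF _ Cn_meromorphic_cont openin_conv_region conv_region_nonempty])
    show "Cn_meromorphic e (SOME F. P F)" using P by (simp add: P_def)
    fix s assume s: "s \<in> conv_region e"
    then have "(SOME F. P F) s = multiple_L_series U e f s"
      using P multiple_L_region_eq[OF assms(2)] by (auto simp: P_def)
    then show "(SOME F. P F) s = cont e s" using multiple_L_series_eq[OF assms(2) s] by simp
  qed
  ultimately show ?thesis by (rule that)
qed

lemma multiple_L_regular:
  assumes e: "e \<le> N" and s: "s \<in> regular_points e"
  shows "multiple_L U e f s = cont e s"
proof (cases "e = 0")
  case False
  then obtain F where F: "multiple_L U e f = Cn_remove_sings e F" "eq_densely e (topspace (Cn e)) F (cont e)"
    using multiple_L_continuation e by (metis One_nat_def Suc_leI neq0_conv)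
  obtain \<epsilon> where e: "\<epsilon> > 0" "Cn_holomorphic e (polydisc e s \<epsilon>) (cont e)"
    by (rule regular_neighbourhood[OF s])
  have "s \<in> topspace (Cn e)" using s by (simp add: regular_points_def)
  then show ?thesis
    unfolding F(1)
    by (intro Cn_remove_sings_eq_on[OF e(2) eq_densely_mono[OF F(2) polydisc_subset_topspace]]
        polydisc_center e(1))
qed (simp add: multiple_L_def cont_0)

lemma Cn_regular_at_multiple_L:
  assumes e: "e \<le> N" and s: "s \<in> regular_points e"
  shows "Cn_regular_at e (multiple_L U e f) s"
proof -
  obtain \<epsilon> where e: "\<epsilon> > 0" "Cn_holomorphic e (polydisc e s \<epsilon>) (cont e)"
    by (rule regular_neighbourhood[OF s])
  have "s \<in> topspace (Cn e)" using s by (simp add: regular_points_def)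
  then have "s \<in> polydisc e s \<epsilon>" using e(1) by (rule polydisc_center)
  moreover have "eq_densely e (polydisc e s \<epsilon>) (multiple_L U e f) (cont e)"
    by (rule eq_densely_regular) (rule multiple_L_regular[OF assms(1)])
  ultimately have "Cn_extension_at e (multiple_L U e f) s (cont e)"
    unfolding Cn_extension_at_iff using e(2) by (intro exI[of _ "polydisc e s \<epsilon>"] conjI)
  then show ?thesis unfolding Cn_regular_at_def by (intro exI[of _ "cont e"])
qed

text \<open>\<open>multiple_L\<close> has its singularities removed, so at a regular point it is itself the extension.\<close>

lemma continuous_on_multiple_L:
  assumes e: "e \<le> N" and reg: "Cn_regular_at e (multiple_L U e f) p"
  obtains V where "openin (Cn e) V" "p \<in> V" "continuous_on V (multiple_L U e f)"
proof -
  obtain V G where V: "p \<in> V" "Cn_holomorphic e V G" "eq_densely e V (multiple_L U e f) G"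
    using reg unfolding Cn_regular_at_def Cn_extension_at_iff by blast
  have Vo: "openin (Cn e) V" by (rule Cn_holomorphicD(1)[OF V(2)])
  have "continuous_on V (multiple_L U e f)"
  proof (cases "e = 0")
    case False
    then obtain F where F: "multiple_L U e f = Cn_remove_sings e F" "eq_densely e (topspace (Cn e)) F (cont e)"
      using multiple_L_continuation e by (metis One_nat_def Suc_leI neq0_conv)
    \<comment> \<open>\<open>F\<close> and \<open>G\<close> are compared through
      \<open>cont e\<close>, which \<open>multiple_L\<close> is known to equal at the regular
      points.\<close>
    have "eq_densely e V F (cont e)" by (rule eq_densely_mono[OF F(2) openin_subset[OF Vo]])
    moreover have "eq_densely e V (cont e) (multiple_L U e f)"
      by (rule eq_densely_sym, rule eq_densely_regular) (rule multiple_L_regular[OF e])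
    ultimately have "eq_densely e V F G" using V(3) by (metis eq_densely_trans)
    then have "multiple_L U e f s = G s" if "s \<in> V" for s
      unfolding F(1) using Cn_remove_sings_eq_on[OF V(2) _ that] by simp
    then show ?thesis using Cn_holomorphicD(2)[OF V(2)] by (simp cong: continuous_on_cong)
  qed (simp add: multiple_L_def)
  then show ?thesis by (rule that[OF Vo V(1)])
qed

end

text \<open>The quotient of the true denominator \<open>exp (c * z) - 1\<close> by the linear form
  \<open>z\<close>, with its removable singularity filled by the derivative \<open>c\<close> at
  0.\<close>

definition expm1_quotient :: "complex \<Rightarrow> complex \<Rightarrow> complex" where
  "expm1_quotient c z = (if z = 0 then c else (exp (c * z) - 1) / z)"

lemma holomorphic_expm1_quotient: "expm1_quotient c holomorphic_on UNIV"
proof (rule pole_theorem_0[where a = 0 and g = "\<lambda>z. exp (c * z) - 1"])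
  have "((\<lambda>z. exp (c * z) - 1) has_field_derivative c) (at 0)"
    by (auto intro!: derivative_eq_intros)
  then show "expm1_quotient c 0 = deriv (\<lambda>z. exp (c * z) - 1) 0"
    by (simp add: expm1_quotient_def DERIV_imp_deriv)
qed (auto simp: expm1_quotient_def intro!: holomorphic_intros)

context lucas_continuation
begin

definition tails_of_sum :: "nat \<Rightarrow> nat \<Rightarrow> nat \<Rightarrow> (nat \<Rightarrow> nat) set" where
  "tails_of_sum j d K = {k \<in> PiE {j..d} (\<lambda>_. UNIV). (\<Sum>i=j..d. k i) = K}"

definition residue_sum :: "nat \<Rightarrow> nat \<Rightarrow> nat \<Rightarrow> (nat \<Rightarrow> complex) \<Rightarrow> complex" where
  "residue_sum j d K s = (\<Sum>k\<in>tails_of_sum j d K. (\<Prod>i=j..d. rising (s i) (k i)) *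
     (\<Prod>t=j+1..d. q d t (\<Sum>i=t..d. k i) / (E d s t - q d t (\<Sum>i=t..d. k i))))"

lemma finite_tails_of_sum: "finite (tails_of_sum j d K)"
proof (rule finite_subset)
  show "tails_of_sum j d K \<subseteq> PiE {j..d} (\<lambda>_. {..K})"
  proof
    fix k assume k: "k \<in> tails_of_sum j d K"
    have "k i \<le> K" if "i \<in> {j..d}" for i
      using k that member_le_sum[of i "{j..d}" k] by (auto simp: tails_of_sum_def)
    then show "k \<in> PiE {j..d} (\<lambda>_. {..K})" using k by (auto simp: tails_of_sum_def)
  qed
qed (auto intro: finite_PiE)

text \<open>The powers of \<open>\<bar>r\<bar>\<close> strictly decrease, so the polar value
  determines the tail sum \<open>K\<close>.\<close>

lemma q_inj:
  assumes "q e t K \<noteq> 0" "q e t \<kappa> = q e t K"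
  shows "\<kappa> = K"
proof -
  have "complex_of_real r ^ \<kappa> = of_real r ^ K" using assms by (auto simp: q_def)
  then have "\<bar>r\<bar> ^ \<kappa> = \<bar>r\<bar> ^ K" by (metis norm_of_real norm_power)
  then show ?thesis using r power_inject_exp'[of "\<bar>r\<bar>"] 
    by (metis linorder_neqE_nat nless_le power_strict_decreasing zero_less_abs_iff)
qed

lemma prod_split_at:
  fixes h :: "nat \<Rightarrow> 'a::comm_monoid_mult"
  assumes "1 \<le> j" "j \<le> d"
  shows "(\<Prod>t=1..d. h t) = (\<Prod>t=1..j-1. h t) * (\<Prod>t=j..d. h t)"
proof -
  have "{1..d} = {1..j-1} \<union> {j..d}" using assms by auto
  then show ?thesis using assms by (simp add: prod.union_disjoint)
qed

lemma sum_split_at: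
  fixes h :: "nat \<Rightarrow> 'a::comm_monoid_add"
  assumes "t < j" "j \<le> d"
  shows "(\<Sum>i=t..d. h i) = (\<Sum>i=t..j-1. h i) + (\<Sum>i=j..d. h i)"
proof -
  have "{t..d} = {t..j-1} \<union> {j..d}" using assms by auto
  then show ?thesis using assms by (simp add: sum.union_disjoint)
qed

text \<open>At the pole only exponents with tail sum \<open>K\<close> survive; they split into free
  exponents below \<open>j\<close>, which rebuild depth \<open>j - 1\<close>, and a finite set of
  tails.\<close>

lemma exponents_split_bij:
  assumes j: "1 \<le> j" "j \<le> d"
  shows "bij_betw (\<lambda>(k, l). \<lambda>i\<in>{1..d}. if i < j then k i else l i)
    (exponents (j - 1) \<times> tails_of_sum j d K) {k \<in> exponents d. (\<Sum>i=j..d. k i) = K}"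
proof (rule bij_betwI[where g = "\<lambda>k. (restrict k {1..j-1}, restrict k {j..d})"])
  show "(\<lambda>(k, l). \<lambda>i\<in>{1..d}. if i < j then k i else l i) \<in>
      exponents (j - 1) \<times> tails_of_sum j d K \<rightarrow> {k \<in> exponents d. (\<Sum>i=j..d. k i) = K}"
  proof
    fix x assume "x \<in> exponents (j - 1) \<times> tails_of_sum j d K"
    then obtain k l where x: "x = (k, l)" "(\<Sum>i=j..d. l i) = K" by (auto simp: tails_of_sum_def)
    have "(\<Sum>i=j..d. (\<lambda>i\<in>{1..d}. if i < j then k i else l i) i) = (\<Sum>i=j..d. l i)"
      using j by (intro sum.cong) auto
    then show "(\<lambda>(k, l). \<lambda>i\<in>{1..d}. if i < j then k i else l i) x \<in> {k \<in> exponents d. (\<Sum>i=j..d. k i) = K}"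
      unfolding x(1) case_prod_conv mem_Collect_eq x(2)[symmetric] by (intro conjI) auto
  qed
  show "(\<lambda>k. (restrict k {1..j-1}, restrict k {j..d})) \<in>
      {k \<in> exponents d. (\<Sum>i=j..d. k i) = K} \<rightarrow> exponents (j - 1) \<times> tails_of_sum j d K"
    by (auto simp: tails_of_sum_def)
next
  fix x assume "x \<in> exponents (j - 1) \<times> tails_of_sum j d K"
  then obtain k l where x: "x = (k, l)" "k \<in> exponents (j - 1)" "l \<in> PiE {j..d} (\<lambda>_. UNIV)"
    by (auto simp: tails_of_sum_def)
  have "restrict (\<lambda>i\<in>{1..d}. if i < j then k i else l i) {1..j-1} = k"
    by (rule extensionalityI[of _ "{1..j-1}"]) (use x j in \<open>auto simp: PiE_def\<close>)
  moreover have "restrict (\<lambda>i\<in>{1..d}. if i < j then k i else l i) {j..d} = l"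
    by (rule extensionalityI[of _ "{j..d}"]) (use x j in \<open>auto simp: PiE_def\<close>)
  ultimately show "(restrict ((\<lambda>(k, l). \<lambda>i\<in>{1..d}. if i < j then k i else l i) x) {1..j-1},
      restrict ((\<lambda>(k, l). \<lambda>i\<in>{1..d}. if i < j then k i else l i) x) {j..d}) = x"
    by (simp add: x(1))
next
  fix k assume k: "k \<in> {k \<in> exponents d. (\<Sum>i=j..d. k i) = K}"
  show "(\<lambda>(k, l). \<lambda>i\<in>{1..d}. if i < j then k i else l i) (restrict k {1..j-1}, restrict k {j..d}) = k"
    unfolding case_prod_conv
    by (rule extensionalityI[of _ "{1..d}"]) (use k j in \<open>auto simp: PiE_def\<close>)
qed

end

lemma has_sum_Times_finite:
  fixes A :: "'a \<Rightarrow> complex"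
  assumes A: "(A has_sum a) X" and Y: "finite Y"
  shows "((\<lambda>(k, l). A k * B l) has_sum a * (\<Sum>l\<in>Y. B l)) (X \<times> Y)"
  using Y
proof induction
  case (insert y Y)
  have "((\<lambda>k. A k * B y) has_sum a * B y) X" by (rule has_sum_cmult_left[OF A])
  moreover have "bij_betw (\<lambda>k. (k, y)) X (X \<times> {y})" by (auto simp: bij_betw_def inj_on_def)
  ultimately have "((\<lambda>(k, l). A k * B l) has_sum a * B y) (X \<times> {y})"
    using has_sum_reindex_bij_betw[of "\<lambda>k. (k, y)" X "X \<times> {y}" "\<lambda>(k, l). A k * B l"] by simp
  then have "((\<lambda>(k, l). A k * B l) has_sum a * B y + a * (\<Sum>l\<in>Y. B l)) (X \<times> {y} \<union> X \<times> Y)"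
    by (rule has_sum_Un_disjoint[OF _ insert.IH]) (use insert in auto)
  moreover have "X \<times> {y} \<union> X \<times> Y = X \<times> insert y Y" by auto
  ultimately show ?case using insert by (simp add: algebra_simps)
qed simp

section \<open>The numerator at a point on a single polar hyperplane\<close>

context lucas_continuation
begin

lemma E_split:
  assumes "1 \<le> t" "t < j" "j \<le> d"
  shows "E d s t = E (j - 1) (restrict s {1..j-1}) t * E d s j"
proof -
  have "(\<Sum>i=t..j-1. restrict s {1..j-1} i) = (\<Sum>i=t..j-1. s i)"
    using assms by (intro sum.cong) auto
  then show ?thesis
    unfolding E_def exp_add[symmetric] sum_split_at[OF assms(2,3), of s] by (simp add: algebra_simps)
qed

text \<open>With \<open>E_split\<close> this shows that on the hyperplane, where
  \<open>E d s j = q d j K\<close>, numerator and denominator of a factor with \<open>t < j\<close>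
  share \<open>q d j K\<close>. Cancelling it leaves the factor of depth
  \<open>j - 1\<close>.\<close>

lemma q_split:
  assumes "t < j" "j \<le> d"
  shows "q d t (\<kappa> + K) = q (j - 1) t \<kappa> * q d j K"
proof -
  have "{t..d} = {t..j-1} \<union> {j..d}" using assms by auto
  then have "(\<Prod>i=t..d. u i) = (\<Prod>i=t..j-1. u i) * (\<Prod>i=j..d. u i)"
    using assms by (simp add: prod.union_disjoint)
  then show ?thesis by (simp add: q_def power_add)
qed

lemma Dpow_split:
  assumes "1 \<le> j" "j \<le> d"
  shows "Dpow d s = Dpow (j - 1) (restrict s {1..j-1}) * exp (of_real (ln D) * (\<Sum>i=j..d. s i) / 2)"
proof -
  have "(\<Sum>i=1..j-1. restrict s {1..j-1} i) = (\<Sum>i=1..j-1. s i)" by (intro sum.cong) auto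
  moreover have "(\<Sum>i=1..d. s i) = (\<Sum>i=1..j-1. s i) + (\<Sum>i=j..d. s i)"
    using assms sum_split_at[of 1 j d s] by (cases "j = 1") auto
  ultimately show ?thesis
    unfolding Dpow_def exp_add[symmetric] by (simp add: field_simps)
qed

context
  fixes d j K :: nat and p :: "nat \<Rightarrow> complex"
  assumes p: "p \<in> topspace (Cn d)" and j: "1 \<le> j" "j \<le> d"
    and pole: "E d p j = q d j K"
    and others: "\<And>t \<kappa>. t \<in> {1..d} \<Longrightarrow> t \<noteq> j \<Longrightarrow> E d p t \<noteq> q d t \<kappa>"
begin

text \<open>A pole of depth \<open>j - 1\<close> with tail sum \<open>\<kappa>\<close> would lift to
  a pole of depth \<open>d\<close> with tail sum \<open>\<kappa> + K\<close>, which
  \<open>others\<close> excludes.\<close>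

lemma restrict_regular: "restrict p {1..j-1} \<in> regular_points (j - 1)"
proof -
  have "E (j - 1) (restrict p {1..j-1}) t \<noteq> q (j - 1) t \<kappa>" if t: "t \<in> {1..j-1}" for t \<kappa>
  proof
    assume eq: "E (j - 1) (restrict p {1..j-1}) t = q (j - 1) t \<kappa>"
    have t': "1 \<le> t" "t < j" using t by auto
    have "E d p t = q d t (\<kappa> + K)"
      unfolding E_split[OF t' j(2)] q_split[OF t'(2) j(2)] eq pole ..
    then show False using others[of t "\<kappa> + K"] t' j by auto
  qed
  then show ?thesis by (simp add: regular_points_def topspace_Cn)
qed

lemma cleared_other: "t \<in> {1..d} \<Longrightarrow> t \<noteq> j \<Longrightarrow> cleared d p t \<kappa> s = q d t \<kappa> / (E d s t - q d t \<kappa>)"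
  using others[of t] by (simp add: cleared_def clear_factor_def eq_commute[of "q d t _"])

text \<open>The clearing factor vanishes at \<open>p\<close> and kills every term except those whose
  own pole it has cancelled.\<close>

lemma cleared_pole: "cleared d p j \<kappa> p = (if \<kappa> = K then q d j K else 0)"
proof -
  have "q d j K \<noteq> 0" using E_nonzero[of d p j] pole by simp
  then have "q d j \<kappa> = E d p j \<longleftrightarrow> \<kappa> = K" using q_inj[of d j K \<kappa>] pole by auto
  moreover have "clear_factor d p j p = 0" using pole by (auto simp: clear_factor_def)
  ultimately show ?thesis by (simp add: cleared_def)
qed

lemma numerator_at_pole:
  "numerator d p p = exp (of_real (ln D) * (\<Sum>i=j..d. p i) / 2) * cont (j - 1) (restrict p {1..j-1}) *
     q d j K * residue_sum j d K p"
proof -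
  let ?p' = "restrict p {1..j-1}" and ?Q = "q d j K"
  let ?S = "{k \<in> exponents d. (\<Sum>i=j..d. k i) = K}"
  define join where "join = (\<lambda>(k :: nat \<Rightarrow> nat, l). \<lambda>i\<in>{1..d}. if i < j then k i else l i)"
  define T where "T k = (\<Prod>i=1..d. rising (p i) (k i)) * (\<Prod>t=1..d. cleared d p t (\<Sum>i=t..d. k i) p)" for k
  define A where "A k = (\<Prod>i=1..j-1. rising (?p' i) (k i)) *
    (\<Prod>t=1..j-1. q (j-1) t (\<Sum>i=t..j-1. k i) / (E (j-1) ?p' t - q (j-1) t (\<Sum>i=t..j-1. k i)))" for k
  define B where "B l = (\<Prod>i=j..d. rising (p i) (l i)) *
    (\<Prod>t=j+1..d. q d t (\<Sum>i=t..d. l i) / (E d p t - q d t (\<Sum>i=t..d. l i)))" for l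
  have Q: "?Q \<noteq> 0" using E_nonzero[of d p j] pole by simp
  \<comment> \<open>Factors below \<open>j\<close> lose their common \<open>?Q\<close>, the
    \<open>j\<close>-th one equals \<open>?Q\<close>, and those above \<open>j\<close> depend on the
    tail \<open>l\<close> alone.\<close>
  have T_join: "T (join (k, l)) = A k * (?Q * B l)" if l: "l \<in> tails_of_sum j d K" for k l
  proof -
    let ?m = "join (k, l)"
    have m1: "?m i = k i" if "i \<in> {1..j-1}" for i using that j by (auto simp: join_def)
    have m2: "?m i = l i" if "i \<in> {j..d}" for i using that j by (auto simp: join_def)
    have sl: "(\<Sum>i=t..d. ?m i) = (\<Sum>i=t..d. l i)" if "j \<le> t" for t
      using that by (intro sum.cong refl m2) auto
    have lK: "(\<Sum>i=j..d. l i) = K" using l by (simp add: tails_of_sum_def)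
    have sk: "(\<Sum>i=t..d. ?m i) = (\<Sum>i=t..j-1. k i) + K" if "1 \<le> t" "t < j" for t
    proof -
      have "(\<Sum>i=t..j-1. ?m i) = (\<Sum>i=t..j-1. k i)" using that by (intro sum.cong refl m1) auto
      then show ?thesis unfolding sum_split_at[OF that(2) j(2)] sl[OF order_refl] lK by simp
    qed
    have "(\<Prod>i=1..d. rising (p i) (?m i)) = (\<Prod>i=1..j-1. rising (?p' i) (k i)) * (\<Prod>i=j..d. rising (p i) (l i))"
      unfolding prod_split_at[OF j] by (intro arg_cong2[of _ _ _ _ "(*)"] prod.cong) (auto simp: m1 m2)
    moreover have "(\<Prod>t=1..j-1. cleared d p t (\<Sum>i=t..d. ?m i) p) =
        (\<Prod>t=1..j-1. q (j-1) t (\<Sum>i=t..j-1. k i) / (E (j-1) ?p' t - q (j-1) t (\<Sum>i=t..j-1. k i)))"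
    proof (rule prod.cong[OF refl])
      fix t assume "t \<in> {1..j-1}"
      then have t: "1 \<le> t" "t < j" by auto
      have "cleared d p t (\<Sum>i=t..d. ?m i) p = q (j-1) t (\<Sum>i=t..j-1. k i) * ?Q /
          (E (j-1) ?p' t * ?Q - q (j-1) t (\<Sum>i=t..j-1. k i) * ?Q)"
        using t j by (subst cleared_other) (auto simp: sk q_split E_split pole)
      also have "\<dots> = q (j-1) t (\<Sum>i=t..j-1. k i) / (E (j-1) ?p' t - q (j-1) t (\<Sum>i=t..j-1. k i))"
        using Q by (simp add: left_diff_distrib[symmetric])
      finally show "cleared d p t (\<Sum>i=t..d. ?m i) p =
          q (j-1) t (\<Sum>i=t..j-1. k i) / (E (j-1) ?p' t - q (j-1) t (\<Sum>i=t..j-1. k i))" .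
    qed
    moreover have "(\<Prod>t=j..d. cleared d p t (\<Sum>i=t..d. ?m i) p) = ?Q *
        (\<Prod>t=j+1..d. q d t (\<Sum>i=t..d. l i) / (E d p t - q d t (\<Sum>i=t..d. l i)))"
    proof -
      have "(\<Prod>t=j..d. cleared d p t (\<Sum>i=t..d. ?m i) p) =
          cleared d p j (\<Sum>i=j..d. ?m i) p * (\<Prod>t=j+1..d. cleared d p t (\<Sum>i=t..d. ?m i) p)"
        using j by (simp add: prod.atLeast_Suc_atMost)
      moreover have "(\<Prod>t=j+1..d. cleared d p t (\<Sum>i=t..d. ?m i) p) =
          (\<Prod>t=j+1..d. q d t (\<Sum>i=t..d. l i) / (E d p t - q d t (\<Sum>i=t..d. l i)))"
        by (intro prod.cong refl) (subst cleared_other; use j in \<open>auto simp: sl\<close>)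
      ultimately show ?thesis by (simp add: cleared_pole sl lK)
    qed
    ultimately show ?thesis unfolding T_def A_def B_def prod_split_at[OF j, of "\<lambda>t. cleared d p t _ p"]
      by (simp only: prod_split_at[OF j, of "\<lambda>t. cleared d p t (\<Sum>i=t..d. ?m i) p"] mult_ac)
  qed
  have "A summable_on exponents (j - 1)"
    unfolding A_def using summable_on_cont[OF restrict_regular] .
  then have A: "(A has_sum infsum A (exponents (j - 1))) (exponents (j - 1))" by (rule has_sum_infsum)
  have "numerator d p p = Dpow d p * infsum T (exponents d)"
    unfolding numerator_def T_def ..
  also have "infsum T (exponents d) = infsum T ?S"
  proof (rule infsum_cong_neutral)
    fix k assume k: "k \<in> exponents d - ?S"
    then have "cleared d p j (\<Sum>i=j..d. k i) p = 0" by (simp add: cleared_pole)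
    then have "(\<Prod>t=1..d. cleared d p t (\<Sum>i=t..d. k i) p) = 0"
      using j by (intro prod_zero) (auto intro!: bexI[of _ j])
    then show "T k = 0" by (simp add: T_def)
  qed auto
  also have "\<dots> = (\<Sum>\<^sub>\<infinity>x\<in>exponents (j - 1) \<times> tails_of_sum j d K. T (join x))"
    unfolding join_def by (rule infsum_reindex_bij_betw[OF exponents_split_bij[OF j], symmetric])
  also have "\<dots> = (\<Sum>\<^sub>\<infinity>x\<in>exponents (j - 1) \<times> tails_of_sum j d K. case x of (k, l) \<Rightarrow> A k * (?Q * B l))"
    by (rule infsum_cong) (auto simp: T_join)
  also have "\<dots> = infsum A (exponents (j - 1)) * (\<Sum>l\<in>tails_of_sum j d K. ?Q * B l)"
    by (rule infsumI) (rule has_sum_Times_finite[OF A finite_tails_of_sum])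
  also have "(\<Sum>l\<in>tails_of_sum j d K. ?Q * B l) = ?Q * residue_sum j d K p"
    by (simp add: residue_sum_def B_def sum_distrib_left)
  finally show ?thesis
    unfolding cont_def Dpow_split[OF j] A_def by (simp only: mult_ac)
qed

end

end

context lucas_series
begin

text \<open>The clearing factor at \<open>j\<close> equals \<open>?Q * h s * (?l s - b)\<close> with
  \<open>h\<close> holomorphic and non-zero near \<open>p\<close>, and all others are 1. So the
  linear form cancels and the product extends as \<open>numerator d p s / (?Q * h s)\<close>, where
  \<open>h p = ln \<alpha>\<close>.\<close>

lemma residue_at_simple_pole:
  assumes p: "p \<in> topspace (Cn d)" and j: "1 \<le> j" "j \<le> d" and d: "d \<le> N"
    and b: "(\<Sum>i=j..d. p i) = b"
    and pole: "exp (of_real (ln \<alpha>) * b) = q d j K"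
    and others: "\<And>t \<kappa>. t \<in> {1..d} \<Longrightarrow> t \<noteq> j \<Longrightarrow> E d p t \<noteq> q d t \<kappa>"
  shows "\<exists>R. Cn_extension_at d (\<lambda>s. ((\<Sum>i=j..d. s i) - b) * multiple_L U d f s) p R \<and>
    R p = exp (of_real (ln D) * b / 2) * multiple_L U (j - 1) f (restrict p {1..j-1}) *
          residue_sum j d K p / of_real (ln \<alpha>)"
proof -
  let ?c = "complex_of_real (ln \<alpha>)" and ?l = "\<lambda>s :: nat \<Rightarrow> complex. \<Sum>i=j..d. s i" and ?Q = "q d j K"
  have c: "?c \<noteq> 0" using ln_alpha by simp
  have Ep: "E d p j = ?Q" unfolding E_def b pole ..
  then have Q: "?Q \<noteq> 0" using E_nonzero[of d p j] by simp
  define h where "h s = expm1_quotient ?c (?l s - b)" for s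
  define R where "R s = numerator d p s / (?Q * h s)" for s
  obtain \<epsilon> where e: "\<epsilon> > 0" "Cn_holomorphic d (polydisc d p \<epsilon>) (numerator d p)"
    by (rule local_quotient[OF p]) auto
  let ?N = "polydisc d p \<epsilon>"
  define V where "V = {s \<in> ?N. h s \<in> - {0}}"
  have hh: "Cn_holomorphic d ?N h"
    unfolding h_def
    by (rule Cn_holomorphic_compose[OF _ holomorphic_expm1_quotient])
      (auto intro!: Cn_holomorphic_diff Cn_holomorphic_sum Cn_holomorphic_coord Cn_holomorphic_const openin_polydisc)
  have Vo: "openin (Cn d) V"
    unfolding V_def by (rule Cn_holomorphic_openin_vimage[OF hh]) auto
  have VN: "V \<subseteq> ?N" by (auto simp: V_def)
  have hol: "Cn_holomorphic d V R"
    unfolding R_def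
    by (intro Cn_holomorphic_divide Cn_holomorphic_mult Cn_holomorphic_const Vo
        Cn_holomorphic_subset[OF e(2) Vo VN] Cn_holomorphic_subset[OF hh Vo VN])
      (use Q in \<open>auto simp: V_def\<close>)
  have hp: "h p = ?c" using b by (simp add: h_def expm1_quotient_def)
  have pV: "p \<in> V" using polydisc_center[OF p e(1)] hp c by (simp add: V_def)
  have "eq_densely d V (\<lambda>s. (?l s - b) * multiple_L U d f s) R"
  proof (rule eq_densely_regular)
    fix s assume sV: "s \<in> V" and sr: "s \<in> regular_points d"
    have Es: "E d s j = ?Q * exp (?c * (?l s - b))"
      unfolding E_def pole[symmetric] exp_add[symmetric] by (simp add: algebra_simps)
    have "E d s j \<noteq> ?Q" using sr j unfolding regular_points_def by auto
    then have lb: "?l s - b \<noteq> 0" using Es by auto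
    then have hs: "h s = (exp (?c * (?l s - b)) - 1) / (?l s - b)" by (simp add: h_def expm1_quotient_def)
    have hs0: "h s \<noteq> 0" using sV by (simp add: V_def)
    have "clear_factor d p j s = ?Q * (exp (?c * (?l s - b)) - 1)"
      using Ep Es by (auto simp: clear_factor_def right_diff_distrib)
    then have cfj: "clear_factor d p j s = ?Q * h s * (?l s - b)" using lb by (simp add: hs)
    have cft: "clear_factor d p t s = 1" if "t \<in> {1..d}" "t \<noteq> j" for t
    proof -
      have "q d t \<kappa> \<noteq> E d p t" for \<kappa> using others[OF that, of \<kappa>] by metis
      then show ?thesis by (simp add: clear_factor_def)
    qed
    have "multiple_L U d f s = numerator d p s / (\<Prod>t=1..d. clear_factor d p t s)"
      unfolding multiple_L_regular[OF d sr]
    proof (rule cont_eq_numerator)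
      fix t assume "t \<in> {1..d}"
      then show "clear_factor d p t s \<noteq> 0" using cft[of t] cfj lb Q hs0 by (cases "t = j") auto
    qed
    also have "(\<Prod>t=1..d. clear_factor d p t s) = (\<Prod>t\<in>{j}. clear_factor d p t s)"
      by (rule prod.mono_neutral_right) (use j cft in auto)
    finally show "(?l s - b) * multiple_L U d f s = R s"
      using lb Q hs0 by (simp add: cfj R_def)
  qed
  then have "Cn_extension_at d (\<lambda>s. (?l s - b) * multiple_L U d f s) p R"
    unfolding Cn_extension_at_iff using pV hol by (intro exI[of _ V] conjI)
  moreover have "R p = exp (of_real (ln D) * b / 2) * multiple_L U (j - 1) f (restrict p {1..j-1}) *
          residue_sum j d K p / ?c"
  proof -
    have "multiple_L U (j - 1) f (restrict p {1..j-1}) = cont (j - 1) (restrict p {1..j-1})"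
      using restrict_regular[OF p j Ep others] d j by (intro multiple_L_regular) auto
    moreover have "numerator d p p = exp (of_real (ln D) * b / 2) * cont (j - 1) (restrict p {1..j-1}) *
        ?Q * residue_sum j d K p"
      unfolding b[symmetric] by (rule numerator_at_pole[OF p j Ep others])
    ultimately show ?thesis using Q by (simp add: R_def hp)
  qed
  ultimately show ?thesis by blast
qed

end

section \<open>Limits along lines, the Lucas parameters and the residue formula\<close>

lemma eventually_in_openin_Cn:
  assumes "openin (Cn e) V" "(w \<longlongrightarrow> p) F" "p \<in> V" "\<And>n. w n \<in> topspace (Cn e)"
  shows "\<forall>\<^sub>F n in F. w n \<in> V"
proof -
  obtain T where T: "open T" "V = extensional {1..e} \<inter> T"
    using assms(1) by (auto simp: Cn_eq openin_open)
  then have "\<forall>\<^sub>F n in F. w n \<in> T" using assms(2,3) by (auto simp: tendsto_def)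
  then show ?thesis using assms(4) T(2) by (auto simp: topspace_Cn elim: eventually_mono)
qed

lemma tendsto_line:
  assumes "x \<longlonglongrightarrow> 0"
  shows "(\<lambda>n. line e s v (x n)) \<longlonglongrightarrow> restrict s {1..e}"
proof -
  have "continuous_on UNIV (\<lambda>x. line e s v x)"
  proof (rule continuous_on_coordinatewise_then_product)
    fix i show "continuous_on UNIV (\<lambda>x. line e s v x i)"
      by (cases "i \<in> {1..e}") (auto simp: line_def intro!: continuous_intros)
  qed
  then have "(\<lambda>n. line e s v (x n)) \<longlonglongrightarrow> line e s v 0"
    using assms by (rule continuous_on_tendsto_compose) auto
  then show ?thesis by (simp add: line_def restrict_def)
qed

lemma lucas_parameter_facts:
  assumes "lucas_params P Q"
  defines "\<alpha> \<equiv> lucas_alpha P Q" and "r \<equiv> lucas_beta P Q / lucas_alpha P Q"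
  shows "lucas_D P Q > 0" "\<alpha> > 1" "r \<noteq> 0" "\<bar>r\<bar> < 1" "Q = \<alpha>\<^sup>2 * r"
    "lucas_U P Q n = \<alpha> ^ n * (1 - r ^ n) / sqrt (lucas_D P Q)"
proof -
  let ?D = "lucas_D P Q" and ?\<beta> = "lucas_beta P Q"
  have P: "P > 0" "Q \<noteq> 0" "P \<le> 2 \<Longrightarrow> Q < P - 1" "P > 2 \<Longrightarrow> Q \<le> P - 1"
    using assms(1) by (auto simp: lucas_params_def)
  \<comment> \<open>Completing the square in this way brings out \<open>P - 1 - Q\<close>, whose
    sign the parameter conditions control.\<close>
  have sq: "?D = (P - 2)\<^sup>2 + 4 * (P - 1 - Q)" by (simp add: lucas_D_def power2_eq_square algebra_simps)
  show D: "?D > 0"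
  proof (cases "P \<le> 2")
    case False
    then have "(P - 2)\<^sup>2 > 0" "Q \<le> P - 1" using P(4) by simp_all
    then show ?thesis unfolding sq by (intro add_pos_nonneg) auto
  next
    case True
    then show ?thesis unfolding sq using P(3) by (intro add_nonneg_pos) auto
  qed
  have sD: "sqrt ?D > 0" using D by simp
  show alpha: "\<alpha> > 1"
  proof (cases "P \<le> 2")
    case True
    \<comment> \<open>\<open>\<alpha> > 1\<close> amounts to \<open>2 - P < sqrt D\<close>, so
      \<open>D\<close> is compared with the square of \<open>2 - P\<close>.\<close>
    then have "(2 - P)\<^sup>2 < ?D" using P(3)[OF True] sq by (simp add: power2_commute)
    then have "2 - P < sqrt ?D" by (rule real_less_rsqrt)
    then show ?thesis by (simp add: \<alpha>_def lucas_alpha_def)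
  next
    case False
    then have "2 < P + sqrt ?D" using sD by linarith
    then show ?thesis by (simp add: \<alpha>_def lucas_alpha_def)
  qed
  have "\<alpha> * ?\<beta> = (P\<^sup>2 - (sqrt ?D)\<^sup>2) / 4"
    by (simp add: \<alpha>_def lucas_alpha_def lucas_beta_def power2_eq_square field_simps)
  also have "\<dots> = Q" using D by (simp add: lucas_D_def)
  finally have ab: "\<alpha> * ?\<beta> = Q" .
  have \<beta>: "?\<beta> = \<alpha> * r" using alpha by (simp add: r_def \<alpha>_def)
  show Q: "Q = \<alpha>\<^sup>2 * r" using ab by (simp add: \<beta> power2_eq_square)
  then show "r \<noteq> 0" using P(2) by auto
  have "\<bar>P - sqrt ?D\<bar> < P + sqrt ?D" using P(1) sD by linarith
  then have "\<bar>?\<beta>\<bar> < \<alpha>" by (simp add: \<alpha>_def lucas_alpha_def lucas_beta_def)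
  then show "\<bar>r\<bar> < 1" using alpha by (simp add: r_def \<alpha>_def)
  have "\<alpha> - ?\<beta> = sqrt ?D" by (simp add: \<alpha>_def lucas_alpha_def lucas_beta_def field_simps)
  moreover have "\<alpha> ^ n - ?\<beta> ^ n = \<alpha> ^ n * (1 - r ^ n)" by (simp add: \<beta> power_mult_distrib algebra_simps)
  ultimately show "lucas_U P Q n = \<alpha> ^ n * (1 - r ^ n) / sqrt ?D"
    by (simp add: lucas_U_def \<alpha>_def)
qed

lemma additive_character_power:
  assumes "additive_character f"
  shows "f (int n) = f 1 ^ n"
proof (induction n)
  case 0
  have "f (0 + 0) = f 0 * f 0" "f 0 \<noteq> 0" using assms unfolding additive_character_def by blast+
  then show ?case by simp
next
  case (Suc n)
  have "f (1 + int n) = f 1 * f (int n)" using assms unfolding additive_character_def by blast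
  then show ?case using Suc by simp
qed

lemma gbinomial_minus_eq_rising: "((- z) gchoose k) * (- 1) ^ k = rising (z::complex) k"
  by (simp add: gbinomial_pochhammer rising_def mult.assoc power_add[symmetric] flip: mult_2)

lemma tendsto_rising:
  assumes "(w \<longlongrightarrow> z) F"
  shows "((\<lambda>n. rising (w n :: complex) k) \<longlongrightarrow> rising z k) F"
  unfolding rising_def pochhammer_prod by (intro tendsto_intros assms) auto

context lucas_continuation
begin

text \<open>Only the finitely many denominators of the surviving tails enter; these are the ones
  required to be non-zero on \<open>A\<close>.\<close>

lemma tendsto_residue_sum:
  assumes w: "\<And>i. i \<in> {j..d} \<Longrightarrow> (\<lambda>n. w n i) \<longlonglongrightarrow> s i"
    and nz: "\<And>k t. k \<in> tails_of_sum j d K \<Longrightarrow> t \<in> {j+1..d} \<Longrightarrow> E d s t \<noteq> q d t (\<Sum>i=t..d. k i)"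
  shows "(\<lambda>n. residue_sum j d K (w n)) \<longlonglongrightarrow> residue_sum j d K s"
proof -
  have E: "(\<lambda>n. E d (w n) t) \<longlonglongrightarrow> E d s t" if "t \<in> {j+1..d}" for t
    unfolding E_def by (intro tendsto_intros w) (use that in auto)
  show ?thesis
    unfolding residue_sum_def
    by (intro tendsto_sum tendsto_mult tendsto_prod tendsto_divide tendsto_diff tendsto_const tendsto_rising w E)
      (use nz in auto)
qed

end

theorem theorem11:
  fixes P Q D \<alpha> :: real and d j :: nat and f :: "nat \<Rightarrow> int \<Rightarrow> complex"
    and n :: int and k' :: "nat \<Rightarrow> nat" and K l :: nat and logg b :: complex
    and L :: "nat \<Rightarrow> (nat \<Rightarrow> complex) \<Rightarrow> complex"
    and g :: "nat \<Rightarrow> complex" and den :: "(nat \<Rightarrow> nat) \<Rightarrow> nat \<Rightarrow> (nat \<Rightarrow> complex) \<Rightarrow> complex"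
    and ks :: "(nat \<Rightarrow> nat) set" and H A :: "(nat \<Rightarrow> complex) set"
  assumes params: "lucas_params P Q"
    and D: "D = lucas_D P Q"
    and \<alpha>: "\<alpha> = lucas_alpha P Q"
    and L: "\<And>e. L e = multiple_L (lucas_U P Q) e f"
    and d: "d \<ge> 2"
    and j: "1 \<le> j" "j \<le> d - 1"
    and f: "\<And>i. i \<in> {1..d} \<Longrightarrow> additive_character (f i)"
    and f_le: "\<And>i. i \<in> {1..d} \<Longrightarrow> (\<Prod>k=i..d. norm (f k 1)) \<le> 1"
    and g: "\<And>t. g t = (\<Prod>k=t..d. f k 1)"
    and logg: "exp logg = g j"
    and K: "K = (\<Sum>i=j..d. k' i)"
    and l: "l = (if Q > 0 then 0 else K)"
    and b: "b = - 2 * of_nat K + logg / of_real (ln \<alpha>)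
                + of_nat K * of_real (ln \<bar>Q\<bar>) / of_real (ln \<alpha>)
                + (2 * of_int n + of_nat l) * of_real pi * \<i> / of_real (ln \<alpha>)"
    and ks: "ks = {k \<in> {j..d} \<rightarrow>\<^sub>E UNIV. (\<Sum>i=j..d. k i) = K}"
    and den: "\<And>k t s. den k t s =
                of_real \<alpha> powr ((\<Sum>i=t..d. s i) + 2 * of_nat (\<Sum>i=t..d. k i))
                - g t * of_real Q ^ (\<Sum>i=t..d. k i)"
    and H: "H = {s \<in> topspace (Cn d). (\<Sum>i=j..d. s i) = b}"
    \<comment> \<open>the points of the hyperplane at which both sides of the residue formula are defined\<close>
    and A: "A = {s \<in> H. hyperplane_residue_defined d (\<lambda>s. \<Sum>i=j..d. s i) b (L d) s \<and>
                   Cn_regular_at (j - 1) (L (j - 1)) (restrict s {1..j - 1}) \<and>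
                   (\<forall>k\<in>ks. \<forall>t\<in>{j+1..d}. den k t s \<noteq> 0)}"
  shows "H \<subseteq> Cn d closure_of A \<and>
    (\<forall>s\<in>A. hyperplane_residue d (\<lambda>s. \<Sum>i=j..d. s i) b (L d) s =
       of_real D powr (b / 2) * L (j - 1) (restrict s {1..j - 1}) *
       (\<Sum>k\<in>ks. (\<Prod>i=j..d. ((- s i) gchoose k i) * (- 1) ^ k i) *
                (\<Prod>t=j+1..d. g t * of_real Q ^ (\<Sum>i=t..d. k i) / den k t s)) *
       (1 / of_real (ln \<alpha>)))"
proof -
  define r where "r = lucas_beta P Q / lucas_alpha P Q"
  note facts = lucas_parameter_facts[OF params, folded D \<alpha>, folded r_def[folded \<alpha>]]
  have fn: "f i 1 \<noteq> 0" if "i \<in> {1..d}" for i using f[OF that] by (simp add: additive_character_def)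
  interpret lucas_series \<alpha> r D "\<lambda>i. f i 1" "lucas_U P Q" f d
    by unfold_locales (use facts fn additive_character_power f in auto)
  let ?c = "complex_of_real (ln \<alpha>)"
  have jd: "1 \<le> j" "j \<le> d" "j < d" using j d by auto
  have c0: "?c \<noteq> 0" using ln_alpha by simp
  have a0: "\<alpha> > 0" using alpha by simp
  have q_eq: "q d t \<kappa> = g t * of_real r ^ \<kappa>" for t \<kappa> by (simp add: q_def g)
  have Q_pow: "of_real Q ^ \<kappa> = of_real \<alpha> ^ (2 * \<kappa>) * (of_real r ^ \<kappa> :: complex)" for \<kappa>
    unfolding facts(5) by (simp add: power_mult_distrib power_mult)
  \<comment> \<open>The stated denominators carry an extra power of \<open>\<alpha>\<close>, which
    \<open>Q_pow\<close> also finds in the numerators, so it cancels from each quotient.\<close>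
  have den_eq: "den k t s = of_real \<alpha> ^ (2 * (\<Sum>i=t..d. k i)) * (E d s t - q d t (\<Sum>i=t..d. k i))" for k t s
  proof -
    have "of_real \<alpha> powr ((\<Sum>i=t..d. s i) + 2 * of_nat (\<Sum>i=t..d. k i)) =
        E d s t * exp (of_nat (2 * (\<Sum>i=t..d. k i)) * ?c)"
      using a0 by (simp add: powr_def Ln_of_real E_def exp_add[symmetric] algebra_simps)
    also have "exp (of_nat (2 * (\<Sum>i=t..d. k i)) * ?c) = of_real \<alpha> ^ (2 * (\<Sum>i=t..d. k i))"
      unfolding exp_of_nat_mult exp_of_real using a0 by simp
    finally show ?thesis unfolding den q_eq Q_pow by (simp add: algebra_simps)
  qed
  have apow: "complex_of_real \<alpha> ^ m \<noteq> 0" for m using a0 by simp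
  \<comment> \<open>This explains the shape of \<open>b\<close>: \<open>exp logg\<close> is
    \<open>g j\<close>, the \<open>2 * n\<close> half-turns disappear, and the \<open>l\<close>
    half-turns supply the sign that turns \<open>\<bar>Q\<bar> ^ K\<close> into \<open>Q ^ K\<close>
    for negative \<open>Q\<close>.\<close>
  have pole: "exp (?c * b) = q d j K"
  proof -
    have "?c * b = logg + of_nat K * of_real (ln \<bar>Q\<bar>) - of_nat (2 * K) * ?c
        + (of_real (real l) * of_real pi * \<i> + 2 * of_int n * of_real pi * \<i>)"
      using c0 by (simp add: b field_simps)
    then have "exp (?c * b) = g j * exp (of_nat K * of_real (ln \<bar>Q\<bar>)) / exp (of_nat (2 * K) * ?c)
        * (exp (of_nat l * (of_real pi * \<i>)) * exp (2 * of_int n * of_real pi * \<i>))"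
      by (simp add: exp_add exp_diff logg mult.assoc)
    also have "exp (of_nat (2 * K) * ?c) = of_real \<alpha> ^ (2 * K)"
      unfolding exp_of_nat_mult exp_of_real using a0 by simp
    also have "exp (of_nat K * complex_of_real (ln \<bar>Q\<bar>)) = of_real \<bar>Q\<bar> ^ K"
      unfolding exp_of_nat_mult exp_of_real using facts(3,5) a0 by simp
    also have "exp (2 * of_int n * of_real pi * \<i>) = 1"
      using exp_integer_2pi[of "of_int n"] by (simp add: mult_ac)
    also have "exp (of_nat l * (of_real pi * \<i>)) = (- 1) ^ l"
      unfolding exp_of_nat_mult by (simp add: exp_pi_i)
    finally have "exp (?c * b) = g j * (of_real \<bar>Q\<bar> ^ K * (- 1) ^ l) / of_real \<alpha> ^ (2 * K)" by simp
    also have "of_real \<bar>Q\<bar> ^ K * (- 1) ^ l = (of_real Q ^ K :: complex)"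
    proof (cases "Q > 0")
      case False
      then show ?thesis by (simp add: l power_mult_distrib[symmetric])
    qed (simp add: l)
    finally show ?thesis unfolding Q_pow q_eq using a0 by simp
  qed
  define rhs where "rhs s = exp (of_real (ln D) * b / 2) * L (j - 1) (restrict s {1..j - 1}) *
    residue_sum j d K s / ?c" for s
  have rhs_eq: "of_real D powr (b / 2) * L (j - 1) (restrict s {1..j - 1}) *
       (\<Sum>k\<in>ks. (\<Prod>i=j..d. ((- s i) gchoose k i) * (- 1) ^ k i) *
                (\<Prod>t=j+1..d. g t * of_real Q ^ (\<Sum>i=t..d. k i) / den k t s)) *
       (1 / ?c) = rhs s" for s
  proof -
    have "g t * of_real Q ^ \<kappa> / (of_real \<alpha> ^ (2 * \<kappa>) * (E d s t - q d t \<kappa>)) = q d t \<kappa> / (E d s t - q d t \<kappa>)" for t \<kappa>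
      unfolding Q_pow using a0 by (simp add: q_eq)
    moreover have "ks = tails_of_sum j d K" by (simp add: ks tails_of_sum_def)
    moreover have "of_real D powr (b / 2) = exp (of_real (ln D) * b / 2)"
      using facts(1) by (simp add: powr_def Ln_of_real mult_ac)
    ultimately show ?thesis
      unfolding rhs_def residue_sum_def den_eq gbinomial_minus_eq_rising by simp
  qed
  let ?l = "\<lambda>s :: nat \<Rightarrow> complex. \<Sum>i=j..d. s i"
  \<comment> \<open>moving along \<open>v\<close> changes \<open>s t + \<dots> + s d\<close> at unit speed for \<open>t \<noteq> j\<close>, and not at all for \<open>t = j\<close>\<close>
  define v :: "nat \<Rightarrow> real" where "v i = (if i = d then 1 else if i = j then - 1 else if i + 1 = j then 1 else 0)" for i
  have v_d: "(\<Sum>i=t..d. v i) = 1" if "j < t" "t \<le> d" for t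
  proof -
    have "(\<Sum>i=t..d. v i) = (\<Sum>i\<in>{d}. v i)"
      by (rule sum.mono_neutral_right) (use that in \<open>auto simp: v_def\<close>)
    then show ?thesis by (simp add: v_def)
  qed
  have v_j: "(\<Sum>i=j..d. v i) = 0"
    using jd v_d[of "j + 1"] by (simp add: sum.atLeast_Suc_atMost v_def)
  have v_t: "(\<Sum>i=t..d. v i) = 1" if "1 \<le> t" "t < j" for t
  proof -
    have "(\<Sum>i=t..j-1. v i) = (\<Sum>i\<in>{j-1}. v i)"
      by (rule sum.mono_neutral_right) (use that jd in \<open>auto simp: v_def\<close>)
    then show ?thesis using that jd v_j sum_split_at[OF that(2) jd(2), of v] by (simp add: v_def)
  qed
  have v1: "\<bar>v i\<bar> \<le> 1" for i by (simp add: v_def)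
  \<comment> \<open>The index \<open>j\<close> is left out because \<open>E\<close> at
    \<open>j\<close> is constant along \<open>v\<close>.\<close>
  have countable_bad: "countable {x. \<exists>t\<in>{1..d}-{j}. \<exists>\<kappa>. E d (line d s v x) t = q d t \<kappa>}" for s
  proof (rule countable_poles_on_line)
    fix t assume "t \<in> {1..d} - {j}"
    then show "(\<Sum>i=t..d. v i) \<noteq> 0" using v_d[of t] v_t[of t] by (cases "t < j") auto
  qed auto
  have good_points: "\<exists>x\<in>{0<..<\<epsilon>}. \<forall>t\<in>{1..d}-{j}. \<forall>\<kappa>. E d (line d s v x) t \<noteq> q d t \<kappa>" if "\<epsilon> > 0" for s \<epsilon>
    using small_outside_countable[OF countable_bad that] by blast
  have line_top: "line e s v x \<in> topspace (Cn e)" for e s x by (simp add: line_def topspace_Cn)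
  have line_H: "line d s v x \<in> H" if "s \<in> H" for s x
  proof -
    have "?l (line d s v x) = ?l s + of_real (x * (\<Sum>i=j..d. v i))"
      unfolding of_real_mult of_real_sum sum_distrib_left sum.distrib[symmetric]
      using jd by (intro sum.cong) (auto simp: line_def)
    then show ?thesis using that line_top[of d s x] by (simp add: v_j H)
  qed
  have generic: "\<exists>R. Cn_extension_at d (\<lambda>s. (?l s - b) * L d s) p R \<and> R p = rhs p"
    if "p \<in> H" "\<forall>t\<in>{1..d}-{j}. \<forall>\<kappa>. E d p t \<noteq> q d t \<kappa>" for p
    unfolding rhs_def L
    by (rule residue_at_simple_pole[OF _ jd(1,2) order_refl _ pole]) (use that in \<open>auto simp: H\<close>)
  have generic_A: "p \<in> A" if p: "p \<in> H" "\<forall>t\<in>{1..d}-{j}. \<forall>\<kappa>. E d p t \<noteq> q d t \<kappa>" for p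
  proof -
    have "hyperplane_residue_defined d ?l b (L d) p"
      using generic[OF p] unfolding hyperplane_residue_defined_def Cn_regular_at_def by blast
    moreover have "restrict p {1..j-1} \<in> regular_points (j - 1)"
    proof (rule restrict_regular[OF _ jd(1,2)])
      show "p \<in> topspace (Cn d)" using p(1) by (simp add: H)
      show "E d p j = q d j K" using p(1) pole by (simp add: H E_def)
    qed (use p(2) in auto)
    then have "Cn_regular_at (j - 1) (L (j - 1)) (restrict p {1..j-1})"
      unfolding L using jd by (intro Cn_regular_at_multiple_L) auto
    moreover have "den k t p \<noteq> 0" if "t \<in> {j+1..d}" for k t
      using p(2) that jd apow by (auto simp: den_eq)
    ultimately show ?thesis using p(1) by (simp add: A)
  qed
  have "H \<subseteq> Cn d closure_of A"
  proof
    fix s assume s: "s \<in> H"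
    then have st: "s \<in> topspace (Cn d)" by (simp add: H)
    have "\<exists>p. p \<in> A \<and> p \<in> B" if B: "s \<in> B" "openin (Cn d) B" for B
    proof -
      obtain \<epsilon> where e: "\<epsilon> > 0" "polydisc d s \<epsilon> \<subseteq> B" by (rule polydisc_neighbourhood[OF B(2,1)])
      obtain x where x: "x \<in> {0<..<\<epsilon>}" "\<forall>t\<in>{1..d}-{j}. \<forall>\<kappa>. E d (line d s v x) t \<noteq> q d t \<kappa>"
        using good_points[OF e(1)] by blast
      have "line d s v x \<in> polydisc d s \<epsilon>" using x(1) by (intro line_in_polydisc v1) auto
      then show ?thesis using generic_A[OF line_H[OF s] x(2)] e(2) by blast
    qed
    then show "s \<in> Cn d closure_of A" using st by (auto simp: in_closure_of)
  qed
  \<comment> \<open>Other denominators may vanish at \<open>s\<close>, where the explicit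
    computation does not apply. Both sides are therefore compared along a sequence of generic points
    of the hyperplane tending to \<open>s\<close>.\<close>
  moreover have "hyperplane_residue d ?l b (L d) s = rhs s" if s: "s \<in> A" for s
  proof -
    have sH: "s \<in> H" using s by (simp add: A)
    have st: "s \<in> extensional {1..d}" using sH by (simp add: H topspace_Cn)
    have "\<exists>x\<in>{0<..<inverse (real (Suc m))}. \<forall>t\<in>{1..d}-{j}. \<forall>\<kappa>. E d (line d s v x) t \<noteq> q d t \<kappa>" for m
      by (rule good_points) simp
    then obtain x where x: "\<And>m. x m \<in> {0<..<inverse (real (Suc m))}"
      "\<And>m. \<forall>t\<in>{1..d}-{j}. \<forall>\<kappa>. E d (line d s v (x m)) t \<noteq> q d t \<kappa>"
      by metis
    have "0 \<le> x m" "x m \<le> inverse (real (Suc m))" for m using x(1)[of m] by auto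
    then have x0: "x \<longlonglongrightarrow> 0"
      by (intro real_tendsto_sandwich[OF always_eventually always_eventually tendsto_const
            LIMSEQ_inverse_real_of_nat]) auto
    define w where "w m = line d s v (x m)" for m
    have w: "w \<longlonglongrightarrow> s"
      using tendsto_line[OF x0, of d s v] extensional_restrict[OF st] by (simp add: w_def[abs_def])
    have wi: "(\<lambda>m. w m i) \<longlonglongrightarrow> s i" for i
      using continuous_on_tendsto_compose[OF continuous_on_product_coordinates w, of i] by simp
    \<comment> \<open>The line in depth \<open>d\<close> restricts to a line in depth
      \<open>j - 1\<close>, so the limit theorem for lines applies there as well.\<close>
    have w': "restrict (w m) {1..j-1} = line (j - 1) s v (x m)" for m
      using jd by (auto simp: w_def line_def restrict_def fun_eq_iff)
    have wgen: "\<exists>R. Cn_extension_at d (\<lambda>s. (?l s - b) * L d s) (w m) R \<and> R (w m) = rhs (w m)" for m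
      unfolding w_def by (rule generic[OF line_H[OF sH] x(2)])
    \<comment> \<open>\<open>G\<close> is the extension granted by membership in \<open>A\<close>;
      it represents the residue throughout \<open>V\<close>, at \<open>s\<close> as well as at the
      nearby generic points.\<close>
    obtain G V where G: "s \<in> V" "Cn_holomorphic d V G" "eq_densely d V (\<lambda>s. (?l s - b) * L d s) G"
      using s unfolding A hyperplane_residue_defined_def Cn_regular_at_def Cn_extension_at_iff by blast
    have res_G: "hyperplane_residue d ?l b (L d) p = G p" if "p \<in> V" for p
      unfolding hyperplane_residue_def by (rule Cn_remove_sings_eq_on[OF G(2,3) that])
    have ev: "\<forall>\<^sub>F m in sequentially. w m \<in> V"
      by (rule eventually_in_openin_Cn[OF Cn_holomorphicD(1)[OF G(2)] w G(1)]) (simp add: w_def line_top)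
    have G_rhs: "G (w m) = rhs (w m)" if "w m \<in> V" for m
    proof -
      obtain R where R: "Cn_extension_at d (\<lambda>s. (?l s - b) * L d s) (w m) R" "R (w m) = rhs (w m)"
        using wgen by blast
      have "hyperplane_residue d ?l b (L d) (w m) = R (w m)"
        unfolding hyperplane_residue_def by (rule Cn_remove_sings_eqI[OF R(1)])
      then show ?thesis using R(2) res_G[OF that] by simp
    qed
    have "(\<lambda>m. G (w m)) \<longlonglongrightarrow> G s"
      by (rule continuous_on_tendsto_compose[OF Cn_holomorphicD(2)[OF G(2)] w G(1) ev])
    moreover have "(\<lambda>m. rhs (w m)) \<longlonglongrightarrow> rhs s"
    proof -
      have "Cn_regular_at (j - 1) (multiple_L (lucas_U P Q) (j - 1) f) (restrict s {1..j-1})"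
        using s unfolding A L by blast
      then obtain V' where V': "openin (Cn (j - 1)) V'" "restrict s {1..j-1} \<in> V'"
        "continuous_on V' (multiple_L (lucas_U P Q) (j - 1) f)"
        by (rule continuous_on_multiple_L[rotated]) (use jd in auto)
      have lim': "(\<lambda>m. restrict (w m) {1..j-1}) \<longlonglongrightarrow> restrict s {1..j-1}"
        unfolding w' by (rule tendsto_line[OF x0])
      have "(\<lambda>m. L (j - 1) (restrict (w m) {1..j-1})) \<longlonglongrightarrow> L (j - 1) (restrict s {1..j-1})"
        unfolding L
        by (rule continuous_on_tendsto_compose[OF V'(3) lim' V'(2)],
            rule eventually_in_openin_Cn[OF V'(1) lim' V'(2)]) (simp only: w' line_top)
      moreover have "(\<lambda>m. residue_sum j d K (w m)) \<longlonglongrightarrow> residue_sum j d K s"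
      proof (rule tendsto_residue_sum[OF wi])
        fix k t assume "k \<in> tails_of_sum j d K" "t \<in> {j+1..d}"
        then have "den k t s \<noteq> 0" using s by (auto simp: A ks tails_of_sum_def)
        then show "E d s t \<noteq> q d t (\<Sum>i=t..d. k i)" by (auto simp: den_eq)
      qed
      ultimately show ?thesis unfolding rhs_def using c0 by (intro tendsto_intros) auto
    qed
    then have "(\<lambda>m. G (w m)) \<longlonglongrightarrow> rhs s"
      by (rule Lim_transform_eventually) (use ev in \<open>auto elim!: eventually_mono simp: G_rhs\<close>)
    ultimately have "G s = rhs s" by (rule LIMSEQ_unique)
    then show ?thesis using res_G[OF G(1)] by simp
  qed
  ultimately show ?thesis unfolding rhs_eq by blast
qed

end
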